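(* Suppose that $\alpha\in\mathbb{R}$ is such that $$\lim_{t\uparrow T} I_{X^{(\alpha)}}(t)=\infty\qquad\text{and}\qquad \lim_{t\uparrow T}\int_0^t\sigma(s)^2\exp\left\{-2\alpha\int_0^s b(v)\,\mathrm{d}v\right\}\mathrm{d}s<\infty.$$ Then $$\left(\int_0^t\frac{b(u)^2\,(X_u^{(\alpha)})^2}{\sigma(u)^2}\,\mathrm{d}u\right)^{1/2}\left(\widehat{\alpha}_t^{(X^{(\alpha)})}-\alpha\right)\ \longrightarrow\ \mathcal{N}(0,1)\qquad\text{in distribution as } t\uparrow T.$$
   Context: Let $T\in(0,\infty]$ be fixed. Let $b:[0,T)\to\mathbb{R}$ and $\sigma:[0,T)\to\mathbb{R}$ be continuous functions such that $\sigma(t)>0$ for all $t\in[0,T)$, and there exists $t_0\in(0,T)$ with $b(t)\neq0$ for all $t\in[t_0,T)$. Let $(B_t)_{t\in[0,T)}$ be a standard Wiener process on a filtered probability space $(\Omega,\mathcal{F},(\mathcal{F}_t)_{t\in[0,T)},\mathsf{P})$ constructed with the help of $B$, satisfying the usual conditions, with $\mathcal{F}=\sigma\big(\bigcup_{t\in[0,T)}\mathcal{F}_t\big)$. For $\alpha\in\mathbb{R}$, let $(X_t^{(\alpha)})_{t\in[0,T)}$ be the unique strong solution of $$\mathrm{d}X_t^{(\alpha)}=\alpha b(t)X_t^{(\alpha)}\,\mathrm{d}t+\sigma(t)\,\mathrm{d}B_t,\quad t\in[0,T),\qquad X_0^{(\alpha)}=0,$$ that is, $X_t^{(\alpha)}=\int_0^t\sigma(s)\exp\{\alpha\int_s^t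 b(u)\,\mathrm{d}u\}\,\mathrm{d}B_s$. The maximum likelihood estimator (MLE) $\widehat{\alpha}_t^{(X^{(\alpha)})}$ of $\alpha$ based on $(X_s^{(\alpha)})_{s\in[0,t]}$ is the maximizer over $\theta\in\mathbb{R}$ of the log-likelihood $\theta\int_0^t\frac{b(s)X_s^{(\alpha)}}{\sigma(s)^2}\,\mathrm{d}X_s^{(\alpha)}-\frac{\theta^2}{2}\int_0^t\frac{b(s)^2(X_s^{(\alpha)})^2}{\sigma(s)^2}\,\mathrm{d}s$; for $t\in[t_0,T)$ it exists $\mathsf{P}$-almost surely, is unique, and is given by $$\widehat{\alpha}_t^{(X^{(\alpha)})}=\frac{\int_0^t\frac{b(s)X_s^{(\alpha)}}{\sigma(s)^2}\,\mathrm{d}X_s^{(\alpha)}}{\int_0^t\frac{b(s)^2(X_s^{(\alpha)})^2}{\sigma(s)^2}\,\mathrm{d}s},\quad\text{so that}\quad \widehat{\alpha}_t^{(X^{(\alpha)})}-\alpha=\frac{\int_0^t\frac{b(s)X_s^{(\alpha)}}{\sigma(s)}\,\mathrm{d}B_s}{\int_0^t\frac{b(s)^2(X_s^{(\alpha)})^2}{\sigma(s)^2}\,\mathrm{d}s}.$$ The Fisher information for $\alpha$ contained in $(X_s^{(\alpha)})_{s\in[0,t]}$ is $$I_{X^{(\alpha)}}(t)=\int_0^t\frac{b(s)^2\,\mathsf{E}(X_s^{(\alpha)})^2}{\sigma(s)^2}\,\mathrm{d}s,\qquad \mathsf{E}(X_s^{(\alpha)})^2=\int_0^s\sigma(u)^2\exp\Big\{2\alpha\int_u^s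 b(v)\,\mathrm{d}v\Big\}\,\mathrm{d}u .$$ $\mathcal{N}(0,1)$ denotes the standard normal distribution. *)

theory Defs
  imports "HOL-Probability.Probability"
begin

text \<open>
  Processes are indexed by real times, but only their values on the interval \<open>[0,T)\<close> matter, where
  \<open>T\<close> is an extended real. The filter \<open>t \<up> T\<close> on real times is the trace of \<open>at_left T\<close>; for
  \<open>T = \<infinity>\<close> it is \<open>at_top\<close>.
\<close>

definition horizon :: "ereal \<Rightarrow> real set" where
  "horizon T = {t. 0 \<le> t \<and> ereal t < T}"

definition upto_horizon :: "ereal \<Rightarrow> real filter" where
  "upto_horizon T = filtercomap ereal (at_left T)"

definition continuous_paths :: "'a measure \<Rightarrow> ereal \<Rightarrow> (real \<Rightarrow> 'a \<Rightarrow> real) \<Rightarrow> bool" where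
  "continuous_paths M T X \<longleftrightarrow> (\<forall>\<omega>\<in>space M. continuous_on (horizon T) (\<lambda>t. X t \<omega>))"

definition adapted :: "(real \<Rightarrow> 'a measure) \<Rightarrow> ereal \<Rightarrow> (real \<Rightarrow> 'a \<Rightarrow> real) \<Rightarrow> bool" where
  "adapted F T X \<longleftrightarrow> (\<forall>t\<in>horizon T. X t \<in> borel_measurable (F t))"

definition progressive :: "(real \<Rightarrow> 'a measure) \<Rightarrow> ereal \<Rightarrow> (real \<Rightarrow> 'a \<Rightarrow> real) \<Rightarrow> bool" where
  "progressive F T X \<longleftrightarrow> (\<forall>t\<in>horizon T.
     (\<lambda>(s, \<omega>). X s \<omega>) \<in> borel_measurable (restrict_space borel {0..t} \<Otimes>\<^sub>M F t))"

definition augmented_filtration ::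
    "'a measure \<Rightarrow> ereal \<Rightarrow> (real \<Rightarrow> 'a \<Rightarrow> real) \<Rightarrow> real \<Rightarrow> 'a measure" where
  "augmented_filtration M T B t = sigma (space M)
     ({B s -` A \<inter> space M | s A. s \<in> horizon T \<and> s \<le> t \<and> A \<in> sets borel} \<union> null_sets M)"

text \<open>
  A standard Wiener process on a complete filtered probability space whose filtration is the
  augmentation of the natural filtration of the Wiener process. For this filtration right
  continuity is automatic; it is listed as part of the usual conditions.
\<close>

locale wiener_space = prob_space M + complete_measure M
  for M :: "'a measure" +
  fixes F :: "real \<Rightarrow> 'a measure" and T :: ereal and B :: "real \<Rightarrow> 'a \<Rightarrow> real"
  assumes horizon_pos: "0 < T"
    and space_filtration: "\<And>t. t \<in> horizon T \<Longrightarrow> space (F t) = space M"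
    and sets_filtration:
      "\<And>t. t \<in> horizon T \<Longrightarrow> sets (F t) = sets (augmented_filtration M T B t)"
    and right_continuous_filtration:
      "\<And>t. t \<in> horizon T \<Longrightarrow> sets (F t) = (\<Inter>u\<in>{u \<in> horizon T. t < u}. sets (F u))"
    and sets_generated: "sets M = sigma_sets (space M) (\<Union>t\<in>horizon T. sets (F t))"
    and wiener_adapted: "adapted F T B"
    and wiener_start: "AE \<omega> in M. B 0 \<omega> = 0"
    and wiener_continuous: "AE \<omega> in M. continuous_on (horizon T) (\<lambda>t. B t \<omega>)"
    and wiener_increment: "\<And>s t. s \<in> horizon T \<Longrightarrow> t \<in> horizon T \<Longrightarrow> s < t \<Longrightarrow>
      distributed M lborel (\<lambda>\<omega>. B t \<omega> - B s \<omega>) (normal_density 0 (sqrt (t - s)))"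
    and wiener_indep: "\<And>s t. s \<in> horizon T \<Longrightarrow> t \<in> horizon T \<Longrightarrow> s < t \<Longrightarrow>
      indep_set (sets (F s)) {(\<lambda>\<omega>. B t \<omega> - B s \<omega>) -` A \<inter> space M | A. A \<in> sets borel}"

definition tendsto_in_probability ::
    "'a measure \<Rightarrow> (nat \<Rightarrow> 'a \<Rightarrow> real) \<Rightarrow> ('a \<Rightarrow> real) \<Rightarrow> bool" where
  "tendsto_in_probability M Y Z \<longleftrightarrow>
     (\<forall>n. Y n \<in> borel_measurable M) \<and> Z \<in> borel_measurable M \<and>
     (\<forall>\<epsilon>>0. (\<lambda>n. measure M {\<omega> \<in> space M. \<bar>Y n \<omega> - Z \<omega>\<bar> > \<epsilon>}) \<longlonglongrightarrow> 0)"

definition tendsto_in_distribution ::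
    "'a measure \<Rightarrow> ('i \<Rightarrow> 'a \<Rightarrow> real) \<Rightarrow> real measure \<Rightarrow> 'i filter \<Rightarrow> bool" where
  "tendsto_in_distribution M Z \<nu> G \<longleftrightarrow>
     (\<forall>\<^sub>F t in G. Z t \<in> borel_measurable M) \<and>
     (\<forall>x. isCont (cdf \<nu>) x \<longrightarrow> ((\<lambda>t. cdf (distr M borel (Z t)) x) \<longlongrightarrow> cdf \<nu> x) G)"

text \<open>
  The Ito integral is a relation between an integrand and a version of its integral process.
  For a simple integrand \<open>\<Sum>i<n. \<xi> i * 1_(\<tau> i, \<tau> (i+1)]\<close> it is the usual sum of increments; the
  integral of a progressively measurable, almost surely locally square integrable integrand \<open>H\<close> is
  the limit in probability of integrals of simple integrands \<open>h n\<close> for which the integral of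
  \<open>(h n - H)\<^sup>2\<close> over \<open>[0,t]\<close> tends to zero in probability for every \<open>t < T\<close>.
\<close>

definition has_simple_ito_integral ::
    "'a measure \<Rightarrow> (real \<Rightarrow> 'a measure) \<Rightarrow> ereal \<Rightarrow> (real \<Rightarrow> 'a \<Rightarrow> real) \<Rightarrow>
     (real \<Rightarrow> 'a \<Rightarrow> real) \<Rightarrow> (real \<Rightarrow> 'a \<Rightarrow> real) \<Rightarrow> bool" where
  "has_simple_ito_integral M F T B H J \<longleftrightarrow>
     (\<exists>(n::nat) \<tau> \<xi>.
        (\<forall>i\<le>n. \<tau> i \<in> horizon T) \<and> (\<forall>i<n. \<tau> i \<le> \<tau> (Suc i)) \<and>
        (\<forall>i<n. \<xi> i \<in> borel_measurable (F (\<tau> i)) \<and> (\<exists>K. \<forall>\<omega>\<in>space M. \<bar>\<xi> i \<omega>\<bar> \<le> K)) \<and>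
        H = (\<lambda>s \<omega>. \<Sum>i<n. \<xi> i \<omega> * indicator {\<tau> i<..\<tau> (Suc i)} s) \<and>
        J = (\<lambda>t \<omega>. \<Sum>i<n. \<xi> i \<omega> * (B (min (\<tau> (Suc i)) t) \<omega> - B (min (\<tau> i) t) \<omega>)))"

definition has_ito_integral ::
    "'a measure \<Rightarrow> (real \<Rightarrow> 'a measure) \<Rightarrow> ereal \<Rightarrow> (real \<Rightarrow> 'a \<Rightarrow> real) \<Rightarrow>
     (real \<Rightarrow> 'a \<Rightarrow> real) \<Rightarrow> (real \<Rightarrow> 'a \<Rightarrow> real) \<Rightarrow> bool" where
  "has_ito_integral M F T B H J \<longleftrightarrow>
     progressive F T H \<and>
     (AE \<omega> in M. \<forall>t\<in>horizon T. set_integrable lborel {0..t} (\<lambda>s. (H s \<omega>)\<^sup>2)) \<and>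
     adapted F T J \<and> (AE \<omega> in M. continuous_on (horizon T) (\<lambda>t. J t \<omega>)) \<and>
     (\<exists>h j. (\<forall>n. has_simple_ito_integral M F T B (h n) (j n)) \<and>
        (\<forall>t\<in>horizon T.
           tendsto_in_probability M (\<lambda>n \<omega>. LBINT s:{0..t}. (h n s \<omega> - H s \<omega>)\<^sup>2) (\<lambda>\<omega>. 0) \<and>
           tendsto_in_probability M (\<lambda>n. j n t) (J t)))"

text \<open>\<open>X\<close> has the stochastic differential \<open>dX = a dt + c dB\<close> on \<open>[0,T)\<close>.\<close>

definition ito_process ::
    "'a measure \<Rightarrow> (real \<Rightarrow> 'a measure) \<Rightarrow> ereal \<Rightarrow> (real \<Rightarrow> 'a \<Rightarrow> real) \<Rightarrow>
     (real \<Rightarrow> 'a \<Rightarrow> real) \<Rightarrow> (real \<Rightarrow> 'a \<Rightarrow> real) \<Rightarrow> (real \<Rightarrow> 'a \<Rightarrow> real) \<Rightarrow> bool" where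
  "ito_process M F T B a c X \<longleftrightarrow>
     adapted F T X \<and> continuous_paths M T X \<and> progressive F T a \<and>
     (AE \<omega> in M. \<forall>t\<in>horizon T. set_integrable lborel {0..t} (\<lambda>s. a s \<omega>)) \<and>
     (\<exists>J. has_ito_integral M F T B c J \<and>
        (AE \<omega> in M. \<forall>t\<in>horizon T. X t \<omega> = X 0 \<omega> + (LBINT s:{0..t}. a s \<omega>) + J t \<omega>))"

text \<open>
  \<open>N\<close> is a version of the integral process \<open>\<integral> H dX\<close>, where \<open>dX = a dt + c dB\<close>; by definition it is
  \<open>\<integral> H a dt + \<integral> H c dB\<close>.
\<close>

definition has_integral_wrt_ito_process ::
    "'a measure \<Rightarrow> (real \<Rightarrow> 'a measure) \<Rightarrow> ereal \<Rightarrow> (real \<Rightarrow> 'a \<Rightarrow> real) \<Rightarrow>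
     (real \<Rightarrow> 'a \<Rightarrow> real) \<Rightarrow> (real \<Rightarrow> 'a \<Rightarrow> real) \<Rightarrow> (real \<Rightarrow> 'a \<Rightarrow> real) \<Rightarrow>
     (real \<Rightarrow> 'a \<Rightarrow> real) \<Rightarrow> (real \<Rightarrow> 'a \<Rightarrow> real) \<Rightarrow> bool" where
  "has_integral_wrt_ito_process M F T B a c X H N \<longleftrightarrow>
     ito_process M F T B a c X \<and> progressive F T H \<and>
     (AE \<omega> in M. \<forall>t\<in>horizon T. set_integrable lborel {0..t} (\<lambda>s. H s \<omega> * a s \<omega>)) \<and>
     (\<exists>J. has_ito_integral M F T B (\<lambda>s \<omega>. H s \<omega> * c s \<omega>) J \<and>
        (AE \<omega> in M. \<forall>t\<in>horizon T. N t \<omega> = (LBINT s:{0..t}. H s \<omega> * a s \<omega>) + J t \<omega>))"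

text \<open>
  \<open>X\<close> is the strong solution of \<open>dX = \<alpha> b(t) X dt + \<sigma>(t) dB\<close>, \<open>X\<^sub>0 = 0\<close>, the filtration being the
  augmented one of \<open>B\<close>.
\<close>

definition strong_solution ::
    "'a measure \<Rightarrow> (real \<Rightarrow> 'a measure) \<Rightarrow> ereal \<Rightarrow> (real \<Rightarrow> 'a \<Rightarrow> real) \<Rightarrow>
     (real \<Rightarrow> real) \<Rightarrow> (real \<Rightarrow> real) \<Rightarrow> real \<Rightarrow> (real \<Rightarrow> 'a \<Rightarrow> real) \<Rightarrow> bool" where
  "strong_solution M F T B b \<sigma> \<alpha> X \<longleftrightarrow>
     ito_process M F T B (\<lambda>s \<omega>. \<alpha> * b s * X s \<omega>) (\<lambda>s \<omega>. \<sigma> s) X \<and>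
     (AE \<omega> in M. X 0 \<omega> = 0)"

definition observed_information ::
    "(real \<Rightarrow> real) \<Rightarrow> (real \<Rightarrow> real) \<Rightarrow> (real \<Rightarrow> 'a \<Rightarrow> real) \<Rightarrow> real \<Rightarrow> 'a \<Rightarrow> real" where
  "observed_information b \<sigma> X t \<omega> = (LBINT s:{0..t}. (b s)\<^sup>2 * (X s \<omega>)\<^sup>2 / (\<sigma> s)\<^sup>2)"

definition fisher_information ::
    "'a measure \<Rightarrow> (real \<Rightarrow> real) \<Rightarrow> (real \<Rightarrow> real) \<Rightarrow> (real \<Rightarrow> 'a \<Rightarrow> real) \<Rightarrow> real \<Rightarrow> real" where
  "fisher_information M b \<sigma> X t =
     (LBINT s:{0..t}. (b s)\<^sup>2 * (\<integral>\<omega>. (X s \<omega>)\<^sup>2 \<partial>M) / (\<sigma> s)\<^sup>2)"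

text \<open>Below, \<open>N\<close> stands for a version of the integral process of \<open>b X / \<sigma>\<^sup>2\<close> with respect to \<open>X\<close>.\<close>

definition log_likelihood ::
    "(real \<Rightarrow> real) \<Rightarrow> (real \<Rightarrow> real) \<Rightarrow> (real \<Rightarrow> 'a \<Rightarrow> real) \<Rightarrow> (real \<Rightarrow> 'a \<Rightarrow> real) \<Rightarrow>
     real \<Rightarrow> 'a \<Rightarrow> real \<Rightarrow> real" where
  "log_likelihood b \<sigma> X N t \<omega> \<theta> = \<theta> * N t \<omega> - \<theta>\<^sup>2 / 2 * observed_information b \<sigma> X t \<omega>"

definition mle ::
    "(real \<Rightarrow> real) \<Rightarrow> (real \<Rightarrow> real) \<Rightarrow> (real \<Rightarrow> 'a \<Rightarrow> real) \<Rightarrow> (real \<Rightarrow> 'a \<Rightarrow> real) \<Rightarrow>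
     real \<Rightarrow> 'a \<Rightarrow> real" where
  "mle b \<sigma> X N t \<omega> = (ARG_MAX (log_likelihood b \<sigma> X N t \<omega>) \<theta>. True)"

end

theory Submission
  imports Defs
begin

text \<open>Let \<open>e(s) = exp (-\<alpha> \<integral>\<^sub>0\<^sup>s b)\<close> be the integrating factor of the drift. The discounted solution
  \<open>Y = e X\<close> satisfies \<open>Y\<^sub>t = \<integral>\<^sub>0\<^sup>t \<sigma> e dB\<close>: it is a Gaussian martingale, and the second hypothesis says that
  its variance \<open>V\<close> has a finite limit \<open>L\<close> at \<open>T\<close>. With \<open>g = b / (\<sigma> e)\<close> the estimation error,
  multiplied by the root of the observed information, is
  \<open>(\<integral> g Y dB) / sqrt (\<integral> g\<^sup>2 Y\<^sup>2 ds)\<close>, a stochastic integral divided by the root of its own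
  quadratic variation. As \<open>E Y\<^sup>2 \<le> L\<close>, the Fisher information is at most \<open>L \<integral> g\<^sup>2\<close>, so the energy
  \<open>\<integral> g\<^sup>2\<close> of the signal diverges by the first hypothesis.

  The idea is to freeze \<open>Y\<close> at a late time \<open>a\<close>. After \<open>a\<close> the process \<open>Y\<close> moves by at most \<open>L - V a\<close>
  in mean square, and the energy spent before \<open>a\<close> is negligible when \<open>t\<close> tends to \<open>T\<close>. Hence
  the numerator is close to \<open>Y\<^sub>a \<integral>\<^sub>a\<^sup>t g dB\<close> and the denominator is close to
  \<open>\<bar>Y\<^sub>a\<bar> sqrt (\<integral>\<^sub>a\<^sup>t g\<^sup>2)\<close>, so that their quotient is close to \<open>sgn Y\<^sub>a\<close> times a standard normal
  variable that is independent of \<open>Y\<^sub>a\<close>. Such a product is again standard normal, although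
  \<open>Y\<^sub>a\<close> itself stays random in the limit.

  Closeness of stochastic integrals is measured by Lenglart's inequality, which bounds the
  probability of a large integral by that of a large quadratic variation. It is proved for
  elementary sums by stopping (\<open>discrete_lenglart\<close>) and carried over to the Ito integral by its
  definition as a limit in probability (\<open>ito_lenglart\<close>). The sign argument is \<open>signed_increment\<close>,
  the Gaussian behaviour of \<open>Y\<close> comes from \<open>discounted_tendsto_in_probability\<close>, the cost of freezing
  \<open>Y\<close> is \<open>frozen_score_error\<close>, and \<open>studentized_score_near_normal\<close> puts them together.\<close>

section \<open>Step functions on finite grids\<close>

definition step_fun :: "nat \<Rightarrow> (nat \<Rightarrow> real) \<Rightarrow> (nat \<Rightarrow> real) \<Rightarrow> real \<Rightarrow> real" where
  "step_fun n q c s = (\<Sum>i<n. c i * indicator {q i<..q (Suc i)} s)"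

definition increment_sum :: "nat \<Rightarrow> (nat \<Rightarrow> real) \<Rightarrow> (nat \<Rightarrow> real) \<Rightarrow> (real \<Rightarrow> real) \<Rightarrow> real" where
  "increment_sum n q c f = (\<Sum>i<n. c i * (f (q (Suc i)) - f (q i)))"

lemma grid_mono:
  fixes q :: "nat \<Rightarrow> real"
  assumes "\<And>i. i < n \<Longrightarrow> q i \<le> q (Suc i)" "i \<le> j" "j \<le> n"
  shows "q i \<le> q j"
  using assms(2,3)
proof (induction j rule: dec_induct)
  case (step k)
  then show ?case using assms(1)[of k] by force
qed simp

lemma grid_strict_mono:
  fixes q :: "nat \<Rightarrow> real"
  assumes "\<And>i. i < n \<Longrightarrow> q i < q (Suc i)" "i < j" "j \<le> n"
  shows "q i < q j"
proof -
  have "q i < q (Suc i)" using assms by simp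
  also have "q (Suc i) \<le> q j"
    by (rule grid_mono[of n]) (use assms in \<open>auto intro: less_imp_le\<close>)
  finally show ?thesis .
qed

text \<open>Every pointwise identity between step functions on one grid reduces to this case distinction: at
  a given point all of them pick the coefficient of the same cell, or all of them vanish.\<close>

lemma step_fun_cases:
  assumes mono: "\<And>i. i < n \<Longrightarrow> q i \<le> q (Suc i)"
  obtains (cell) k where "k < n" "q k < s" "s \<le> q (Suc k)" "\<And>c. step_fun n q c s = c k"
  | (outside) "\<And>i. i < n \<Longrightarrow> s \<notin> {q i<..q (Suc i)}" "\<And>c. step_fun n q c s = 0"
proof (cases "\<exists>k<n. s \<in> {q k<..q (Suc k)}")
  case True
  then obtain k where k: "k < n" "s \<in> {q k<..q (Suc k)}"
    by (elim exE conjE)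
  have other: "s \<notin> {q i<..q (Suc i)}" if "i < n" "i \<noteq> k" for i
  proof (cases "i < k")
    case True
    then have "q (Suc i) \<le> q k" by (intro grid_mono[where n=n and q=q, OF mono]) (use k in auto)
    then show ?thesis using k by auto
  next
    case False
    then have "q (Suc k) \<le> q i" by (intro grid_mono[where n=n and q=q, OF mono]) (use that k in auto)
    then show ?thesis using k by auto
  qed
  have "step_fun n q c s = c k" for c
  proof -
    have "step_fun n q c s = (\<Sum>i<n. if i = k then c k else 0)"
      unfolding step_fun_def by (intro sum.cong) (use other k in \<open>auto simp: indicator_def\<close>)
    then show ?thesis using k by simp
  qed
  then show ?thesis using cell k by auto
next
  case False
  then show ?thesis by (intro outside) (auto simp: step_fun_def intro!: sum.neutral)
qed

lemma step_fun_mult: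
  assumes "\<And>i. i < n \<Longrightarrow> q i \<le> q (Suc i)"
  shows "step_fun n q c s * step_fun n q d s = step_fun n q (\<lambda>i. c i * d i) s"
  by (rule step_fun_cases[of n q s]) (use assms in auto)

lemma step_fun_diff: "step_fun n q c s - step_fun n q d s = step_fun n q (\<lambda>i. c i - d i) s"
  by (simp add: step_fun_def sum_subtractf left_diff_distrib)

lemma step_fun_power2:
  assumes "\<And>i. i < n \<Longrightarrow> q i \<le> q (Suc i)"
  shows "(step_fun n q c s)\<^sup>2 = step_fun n q (\<lambda>i. (c i)\<^sup>2) s"
  by (simp add: power2_eq_square step_fun_mult assms)

lemma step_fun_outside:
  assumes "\<And>i. i < n \<Longrightarrow> q i \<le> q (Suc i)" "s \<le> q 0 \<or> q n < s"
  shows "step_fun n q c s = 0"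
proof (rule step_fun_cases[of n q s])
  fix k assume k: "k < n" "q k < s" "s \<le> q (Suc k)"
  have "q 0 \<le> q k" "q (Suc k) \<le> q n"
    using k assms(1) grid_mono[of n q 0 k] grid_mono[of n q "Suc k" n] by auto
  then show ?thesis using k assms by auto
qed (use assms in auto)

lemma step_fun_const:
  assumes "\<And>i. i < n \<Longrightarrow> q i \<le> q (Suc i)"
  shows "step_fun n q (\<lambda>i. a) s = a * indicator {q 0<..q n} s"
  using assms
proof (induction n)
  case (Suc n)
  have "q 0 \<le> q n" "q n \<le> q (Suc n)" using Suc.prems grid_mono[of "Suc n" q 0 n] by auto
  moreover have "step_fun (Suc n) q (\<lambda>i. a) s
      = a * indicator {q 0<..q n} s + a * indicator {q n<..q (Suc n)} s"
    using Suc by (simp add: step_fun_def)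
  ultimately show ?case by (auto simp: indicator_def)
qed (simp add: step_fun_def)

lemma borel_measurable_step_fun [measurable]: "step_fun n q c \<in> borel_measurable borel"
  unfolding step_fun_def[abs_def] by measurable

lemma integrable_indicator_Ioc: "integrable lborel (indicator {u<..v::real} :: real \<Rightarrow> real)"
  by (cases "u \<le> v") auto

lemma integrable_step_fun: "integrable lborel (step_fun n q c)"
  unfolding step_fun_def[abs_def] by (intro Bochner_Integration.integrable_sum integrable_mult_right integrable_indicator_Ioc)

lemma integral_step_fun:
  assumes "\<And>i. i < n \<Longrightarrow> q i \<le> q (Suc i)"
  shows "(\<integral>s. step_fun n q c s \<partial>lborel) = (\<Sum>i<n. c i * (q (Suc i) - q i))"
proof -
  have "(\<integral>s. step_fun n q c s \<partial>lborel) = (\<Sum>i<n. (\<integral>s. c i * indicator {q i<..q (Suc i)} s \<partial>lborel))"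
    unfolding step_fun_def by (intro Bochner_Integration.integral_sum integrable_mult_right integrable_indicator_Ioc)
  also have "\<dots> = (\<Sum>i<n. c i * (q (Suc i) - q i))"
    using assms by (intro sum.cong) auto
  finally show ?thesis .
qed

lemma set_integral_step_fun:
  assumes "\<And>i. i < n \<Longrightarrow> q i \<le> q (Suc i)" "a \<le> q 0" "q n \<le> t"
  shows "(LBINT s:{a..t}. step_fun n q c s) = (\<Sum>i<n. c i * (q (Suc i) - q i))"
proof -
  have "indicator {a..t} s *\<^sub>R step_fun n q c s = step_fun n q c s" for s
    using step_fun_outside[of n q s c] assms by (cases "s \<le> q 0 \<or> q n < s") auto
  then have "(LBINT s:{a..t}. step_fun n q c s) = (\<integral>s. step_fun n q c s \<partial>lborel)"
    unfolding set_lebesgue_integral_def by (simp only:)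
  then show ?thesis by (simp add: integral_step_fun assms)
qed

text \<open>Since the grid is strictly increasing, the cells between two of its points are consecutive, and
  the sum telescopes.\<close>

lemma sum_telescope_cells:
  fixes f :: "real \<Rightarrow> real"
  assumes "\<And>k. k < m \<Longrightarrow> p k < p (Suc k)" "u \<in> p ` {..m}" "v \<in> p ` {..m}" "u \<le> v"
  shows "f v - f u = (\<Sum>k<m. if u \<le> p k \<and> p k < v then f (p (Suc k)) - f (p k) else 0)"
proof -
  obtain a b where ab: "u = p a" "v = p b" "a \<le> m" "b \<le> m" using assms by auto
  have lt: "p i < p j" if "i < j" "j \<le> m" for i j
    using grid_strict_mono[of m p i j] assms(1) that by blast
  have iff: "p i < p j \<longleftrightarrow> i < j" if "i \<le> m" "j \<le> m" for i j
    using lt[of i j] lt[of j i] that by (cases i j rule: linorder_cases) auto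
  have le: "a \<le> b" using iff[of b a] ab assms(4) by auto
  have "(\<Sum>k<m. if u \<le> p k \<and> p k < v then f (p (Suc k)) - f (p k) else 0)
      = (\<Sum>k\<in>{a..<b}. f (p (Suc k)) - f (p k))"
    using ab iff by (intro sum.mono_neutral_cong_right) (auto simp: not_less[symmetric])
  also have "\<dots> = f (p b) - f (p a)"
    using le by (simp add: sum_Suc_diff'[of a b "\<lambda>k. f (p k)"])
  finally show ?thesis using ab by simp
qed

text \<open>The coefficients that a step function receives on a finer grid \<open>p\<close>: its value just to the right
  of each point of \<open>p\<close>.\<close>

definition refined_coeff :: "nat \<Rightarrow> (nat \<Rightarrow> real) \<Rightarrow> (nat \<Rightarrow> real) \<Rightarrow> (nat \<Rightarrow> real) \<Rightarrow> nat \<Rightarrow> real" where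
  "refined_coeff n q c p k = (\<Sum>i<n. if q i \<le> p k \<and> p k < q (Suc i) then c i else 0)"

lemma increment_sum_refine:
  assumes "\<And>k. k < m \<Longrightarrow> p k < p (Suc k)" "\<And>i. i < n \<Longrightarrow> q i \<le> q (Suc i)" "q ` {..n} \<subseteq> p ` {..m}"
  shows "increment_sum n q c f = increment_sum m p (refined_coeff n q c p) f"
proof -
  have "increment_sum n q c f = (\<Sum>i<n. \<Sum>k<m.
      (if q i \<le> p k \<and> p k < q (Suc i) then c i else 0) * (f (p (Suc k)) - f (p k)))"
    unfolding increment_sum_def
  proof (intro sum.cong refl)
    fix i assume i: "i \<in> {..<n}"
    have "q i \<in> p ` {..m}" "q (Suc i) \<in> p ` {..m}" using assms(3) i by auto
    then have "f (q (Suc i)) - f (q i)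
        = (\<Sum>k<m. if q i \<le> p k \<and> p k < q (Suc i) then f (p (Suc k)) - f (p k) else 0)"
      using i assms(1,2) by (intro sum_telescope_cells) auto
    then show "c i * (f (q (Suc i)) - f (q i)) = (\<Sum>k<m.
      (if q i \<le> p k \<and> p k < q (Suc i) then c i else 0) * (f (p (Suc k)) - f (p k)))"
      by (simp add: sum_distrib_left if_distrib if_distribR cong: if_cong)
  qed
  also have "\<dots> = increment_sum m p (refined_coeff n q c p) f"
    unfolding increment_sum_def refined_coeff_def sum_distrib_right by (rule sum.swap)
  finally show ?thesis .
qed

text \<open>A step function is itself an increment sum, namely of the function that jumps at \<open>s\<close>. Refinement of
  step functions is therefore an instance of refinement of increment sums.\<close>

lemma step_fun_eq_increment_sum:
  assumes "\<And>i. i < n \<Longrightarrow> q i \<le> q (Suc i)"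
  shows "step_fun n q c s = increment_sum n q c (\<lambda>x. of_bool (s \<le> x))"
  unfolding step_fun_def increment_sum_def
proof (intro sum.cong refl)
  fix i assume "i \<in> {..<n}"
  then have "q i \<le> q (Suc i)" using assms by simp
  then show "c i * indicator {q i<..q (Suc i)} s = c i * (of_bool (s \<le> q (Suc i)) - of_bool (s \<le> q i))"
    by (auto simp: indicator_def)
qed

lemma step_fun_refine:
  assumes "\<And>k. k < m \<Longrightarrow> p k < p (Suc k)" "\<And>i. i < n \<Longrightarrow> q i \<le> q (Suc i)" "q ` {..n} \<subseteq> p ` {..m}"
  shows "step_fun n q c s = step_fun m p (refined_coeff n q c p) s"
proof -
  have "step_fun m p (refined_coeff n q c p) s
      = increment_sum m p (refined_coeff n q c p) (\<lambda>x. of_bool (s \<le> x))"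
    by (rule step_fun_eq_increment_sum) (use assms(1) in \<open>auto intro: less_imp_le\<close>)
  then show ?thesis
    using increment_sum_refine[OF assms] step_fun_eq_increment_sum[of n q] assms(2) by simp
qed

lemma finite_set_as_grid:
  assumes "finite S" "S \<noteq> {}"
  obtains m and p :: "nat \<Rightarrow> real" where "\<And>k. k < m \<Longrightarrow> p k < p (Suc k)" "p ` {..m} = S"
proof
  let ?l = "sorted_list_of_set S"
  let ?m = "card S - 1"
  have len: "length ?l = Suc ?m" using assms by (simp add: card_gt_0_iff)
  show "?l ! k < ?l ! Suc k" if "k < ?m" for k
  proof -
    have "sorted_wrt (<) ?l" by simp
    then show ?thesis using that len by (intro sorted_wrt_nth_less[of "(<)"]) auto
  qed
  have "(\<lambda>k. ?l ! k) ` {..?m} = set ?l"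
    unfolding set_conv_nth len by (auto simp: less_Suc_eq_le)
  then show "(\<lambda>k. ?l ! k) ` {..?m} = S" using assms by simp
qed

section \<open>Lenglart's inequality for discrete stochastic integrals\<close>

lemma (in prob_space) prob_le_add:
  assumes "AE \<omega> in M. P \<omega> \<longrightarrow> Q \<omega> \<or> R \<omega>"
    and [measurable]: "{\<omega> \<in> space M. Q \<omega>} \<in> events" "{\<omega> \<in> space M. R \<omega>} \<in> events"
  shows "prob {\<omega> \<in> space M. P \<omega>} \<le> prob {\<omega> \<in> space M. Q \<omega>} + prob {\<omega> \<in> space M. R \<omega>}"
proof -
  have "prob {\<omega> \<in> space M. P \<omega>} \<le> prob ({\<omega> \<in> space M. Q \<omega>} \<union> {\<omega> \<in> space M. R \<omega>})"
    using assms(1) by (intro finite_measure_mono_AE) (auto elim!: eventually_mono)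
  also have "\<dots> \<le> prob {\<omega> \<in> space M. Q \<omega>} + prob {\<omega> \<in> space M. R \<omega>}"
    by (intro measure_Un_le) measurable
  finally show ?thesis .
qed

context wiener_space
begin

lemma zero_in_horizon: "0 \<in> horizon T"
  using horizon_pos by (simp add: horizon_def zero_ereal_def)

lemma horizon_downward: "t \<in> horizon T \<Longrightarrow> 0 \<le> s \<Longrightarrow> s \<le> t \<Longrightarrow> s \<in> horizon T"
  by (auto simp: horizon_def intro: le_less_trans[of "ereal s" "ereal t"])

lemma horizon_nonneg: "t \<in> horizon T \<Longrightarrow> 0 \<le> t"
  by (simp add: horizon_def)

lemma subalgebra_F: "t \<in> horizon T \<Longrightarrow> subalgebra M (F t)"
  using space_filtration sets_generated
  by (auto simp: subalgebra_def intro: sigma_sets.Basic)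

lemma subalgebra_F_mono:
  assumes "s \<in> horizon T" "t \<in> horizon T" "s \<le> t"
  shows "subalgebra (F t) (F s)"
proof -
  let ?gen = "\<lambda>u. {B s -` A \<inter> space M | s A. s \<in> horizon T \<and> s \<le> u \<and> A \<in> sets borel} \<union> null_sets M"
  have "?gen u \<subseteq> Pow (space M)" for u
    using sets.sets_into_space by (auto simp: null_sets_def)
  then have "sets (F u) = sigma_sets (space M) (?gen u)" if "u \<in> horizon T" for u
    using sets_filtration[OF that] unfolding augmented_filtration_def by (simp add: sets_measure_of)
  moreover have "sigma_sets (space M) (?gen s) \<subseteq> sigma_sets (space M) (?gen t)"
    using \<open>s \<le> t\<close> by (intro sigma_sets_mono') force
  ultimately show ?thesis using assms by (simp add: subalgebra_def space_filtration)
qed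

lemma measurable_F_mono:
  "Z \<in> measurable (F s) N \<Longrightarrow> s \<in> horizon T \<Longrightarrow> t \<in> horizon T \<Longrightarrow> s \<le> t \<Longrightarrow> Z \<in> measurable (F t) N"
  using measurable_from_subalg[OF subalgebra_F_mono] by blast

lemma measurable_F_M: "Z \<in> measurable (F t) N \<Longrightarrow> t \<in> horizon T \<Longrightarrow> Z \<in> measurable M N"
  using measurable_from_subalg[OF subalgebra_F] by blast

lemma measurable_B: "s \<in> horizon T \<Longrightarrow> t \<in> horizon T \<Longrightarrow> s \<le> t \<Longrightarrow> B s \<in> borel_measurable (F t)"
  using wiener_adapted measurable_F_mono unfolding adapted_def by blast

lemma indep_var_past:
  assumes s: "s \<in> horizon T"
    and Z: "Z \<in> borel_measurable (F s)" and D: "D \<in> borel_measurable M"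
    and ind: "indep_set (sets (F s)) {D -` A \<inter> space M | A. A \<in> sets borel}"
  shows "indep_var borel Z borel D"
  unfolding indep_var_eq
proof (intro conjI indep_set_sigma_sets)
  show "random_variable borel Z" using Z s by (rule measurable_F_M)
  have "{Z -` A \<inter> space M | A. A \<in> sets borel} \<subseteq> sets (F s)"
    using measurable_sets[OF Z] space_filtration[OF s] by auto
  with ind show "indep_set {Z -` A \<inter> space M | A. A \<in> sets borel} {D -` A \<inter> space M | A. A \<in> sets borel}"
    unfolding indep_sets2_eq by blast
  show "Int_stable {Z -` A \<inter> space M | A. A \<in> sets borel}"
    "Int_stable {D -` A \<inter> space M | A. A \<in> sets borel}"
    unfolding Int_stable_def
    by (safe; metis (no_types, lifting) sets.Int vimage_Int Int_assoc Int_commute Int_left_absorb)+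
qed (use D in auto)

lemma indep_var_increment:
  assumes "s \<in> horizon T" "t \<in> horizon T" "s < t" "Z \<in> borel_measurable (F s)"
  shows "indep_var borel Z borel (\<lambda>\<omega>. B t \<omega> - B s \<omega>)"
proof (rule indep_var_past[of s])
  show "(\<lambda>\<omega>. B t \<omega> - B s \<omega>) \<in> borel_measurable M"
    using measurable_F_M[OF measurable_B[of s s]] measurable_F_M[OF measurable_B[of t t]] assms
    by (intro borel_measurable_diff) auto
qed (use assms wiener_indep[OF assms(1-3)] in auto)

lemma increment_moments:
  assumes "s \<in> horizon T" "t \<in> horizon T" "s < t"
  shows "integrable M (\<lambda>\<omega>. B t \<omega> - B s \<omega>)" "expectation (\<lambda>\<omega>. B t \<omega> - B s \<omega>) = 0"
    "integrable M (\<lambda>\<omega>. (B t \<omega> - B s \<omega>)\<^sup>2)" "expectation (\<lambda>\<omega>. (B t \<omega> - B s \<omega>)\<^sup>2) = t - s"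
proof -
  note d = wiener_increment[OF assms]
  have pos: "0 < sqrt (t - s)" using assms by simp
  show "expectation (\<lambda>\<omega>. B t \<omega> - B s \<omega>) = 0"
    using normal_distributed_expectation[OF pos d] .
  show "integrable M (\<lambda>\<omega>. B t \<omega> - B s \<omega>)"
    using distributed_integrable[OF d, of "\<lambda>x. x"] integrable_normal_moment[OF pos, of 0 1] by simp
  show "integrable M (\<lambda>\<omega>. (B t \<omega> - B s \<omega>)\<^sup>2)"
    using distributed_integrable[OF d, of "\<lambda>x. x\<^sup>2"] integrable_normal_moment[OF pos, of 0 2] by simp
  show "expectation (\<lambda>\<omega>. (B t \<omega> - B s \<omega>)\<^sup>2) = t - s"
    using distributed_integral[OF d, of "\<lambda>x. x\<^sup>2"] integral_normal_moment_even[OF pos, of 0 1] assms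
    by simp
qed

lemma increment_sum_measurable:
  assumes "\<And>k. k < n \<Longrightarrow> p k \<le> p (Suc k)" "\<And>k. k \<le> n \<Longrightarrow> p k \<in> horizon T"
    "\<And>k. k < n \<Longrightarrow> \<zeta> k \<in> borel_measurable (F (p k))"
  shows "(\<lambda>\<omega>. increment_sum n p (\<lambda>k. \<zeta> k \<omega>) (\<lambda>s. B s \<omega>)) \<in> borel_measurable (F (p n))"
  unfolding increment_sum_def
proof (intro borel_measurable_sum borel_measurable_times borel_measurable_diff)
  fix k assume k: "k \<in> {..<n}"
  have le: "p k \<le> p n" by (rule grid_mono[of n p k n]) (use k assms(1) in auto)
  have le': "p (Suc k) \<le> p n" by (rule grid_mono[of n p "Suc k" n]) (use k assms(1) in auto)
  have h: "p k \<in> horizon T" "p (Suc k) \<in> horizon T" "p n \<in> horizon T" using assms(2) k by auto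
  show "B (p (Suc k)) \<in> borel_measurable (F (p n))" by (rule measurable_B[OF h(2,3) le'])
  show "B (p k) \<in> borel_measurable (F (p n))" by (rule measurable_B[OF h(1,3) le])
  show "\<zeta> k \<in> borel_measurable (F (p n))"
    by (rule measurable_F_mono[OF _ h(1,3) le]) (use assms(3) k in blast)
qed

text \<open>The last increment is centred and independent of everything that is known at the start of its
  cell, so the mixed term has mean zero and the mean of the last square factorises.\<close>

lemma discrete_ito_isometry:
  assumes "\<And>k. k < n \<Longrightarrow> p k < p (Suc k)" "\<And>k. k \<le> n \<Longrightarrow> p k \<in> horizon T"
    "\<And>k. k < n \<Longrightarrow> \<zeta> k \<in> borel_measurable (F (p k))"
    "\<And>k. k < n \<Longrightarrow> \<exists>K. \<forall>\<omega>\<in>space M. \<bar>\<zeta> k \<omega>\<bar> \<le> K"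
  shows "integrable M (\<lambda>\<omega>. (increment_sum n p (\<lambda>k. \<zeta> k \<omega>) (\<lambda>s. B s \<omega>))\<^sup>2) \<and>
    expectation (\<lambda>\<omega>. (increment_sum n p (\<lambda>k. \<zeta> k \<omega>) (\<lambda>s. B s \<omega>))\<^sup>2) =
      expectation (\<lambda>\<omega>. \<Sum>k<n. (\<zeta> k \<omega>)\<^sup>2 * (p (Suc k) - p k)) \<and>
    integrable M (\<lambda>\<omega>. \<Sum>k<n. (\<zeta> k \<omega>)\<^sup>2 * (p (Suc k) - p k))"
  using assms
proof (induction n)
  case 0
  then show ?case by (simp add: increment_sum_def)
next
  case (Suc n)
  define S where "S = (\<lambda>\<omega>. increment_sum n p (\<lambda>k. \<zeta> k \<omega>) (\<lambda>s. B s \<omega>))"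
  define D where "D = (\<lambda>\<omega>. B (p (Suc n)) \<omega> - B (p n) \<omega>)"
  define V where "V = (\<lambda>\<omega>. \<Sum>k<n. (\<zeta> k \<omega>)\<^sup>2 * (p (Suc k) - p k))"
  have IH: "integrable M (\<lambda>\<omega>. (S \<omega>)\<^sup>2)" "expectation (\<lambda>\<omega>. (S \<omega>)\<^sup>2) = expectation V" "integrable M V"
    using Suc.IH Suc.prems unfolding S_def V_def by auto
  have p: "p n \<in> horizon T" "p (Suc n) \<in> horizon T" "p n < p (Suc n)" using Suc.prems by auto
  obtain K where K: "\<And>\<omega>. \<omega> \<in> space M \<Longrightarrow> \<bar>\<zeta> n \<omega>\<bar> \<le> K" using Suc.prems(4)[of n] by auto
  have SF [measurable]: "S \<in> borel_measurable (F (p n))"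
    unfolding S_def by (rule increment_sum_measurable) (use Suc.prems in \<open>auto intro: less_imp_le\<close>)
  have zF [measurable]: "\<zeta> n \<in> borel_measurable (F (p n))" using Suc.prems by simp
  have SM [measurable]: "S \<in> borel_measurable M" and zM [measurable]: "\<zeta> n \<in> borel_measurable M"
    using SF zF p measurable_F_M by blast+
  have mom: "integrable M D" "expectation D = 0" "integrable M (\<lambda>\<omega>. (D \<omega>)\<^sup>2)"
      "expectation (\<lambda>\<omega>. (D \<omega>)\<^sup>2) = p (Suc n) - p n"
    using increment_moments[OF p] unfolding D_def by blast+
  have S1: "integrable M S" using square_integrable_imp_integrable[OF SM] IH(1) by simp
  have bdd: "integrable M (\<lambda>\<omega>. f \<omega> * \<zeta> n \<omega>)" if "integrable M f" for f :: "'a \<Rightarrow> real"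
  proof (rule Bochner_Integration.integrable_bound[of M "\<lambda>\<omega>. K * f \<omega>"])
    show "AE \<omega> in M. norm (f \<omega> * \<zeta> n \<omega>) \<le> norm (K * f \<omega>)"
    proof (rule AE_I2)
      fix \<omega> assume "\<omega> \<in> space M"
      then have "\<bar>\<zeta> n \<omega>\<bar> \<le> \<bar>K\<bar>" using K by fastforce
      then show "norm (f \<omega> * \<zeta> n \<omega>) \<le> norm (K * f \<omega>)"
        by (simp add: abs_mult mult.commute[of "\<bar>K\<bar>"] mult_left_mono)
    qed
  qed (use that borel_measurable_integrable[OF that] in auto)
  have Sz: "integrable M (\<lambda>\<omega>. S \<omega> * \<zeta> n \<omega>)" by (rule bdd[OF S1])
  have z1: "integrable M (\<lambda>\<omega>. \<zeta> n \<omega>)" using bdd[of "\<lambda>_. 1"] by simp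
  have z2: "integrable M (\<lambda>\<omega>. (\<zeta> n \<omega>)\<^sup>2)" using bdd[OF z1] by (simp add: power2_eq_square)
  have "(\<lambda>\<omega>. S \<omega> * \<zeta> n \<omega>) \<in> borel_measurable (F (p n))" by measurable
  then have i1: "indep_var borel (\<lambda>\<omega>. S \<omega> * \<zeta> n \<omega>) borel D"
    unfolding D_def by (rule indep_var_increment[OF p])
  note c1 = indep_var_integrable[OF i1 Sz mom(1)] indep_var_lebesgue_integral[OF i1 Sz mom(1)]
  have "(\<lambda>\<omega>. \<zeta> n \<omega>) \<in> borel_measurable (F (p n))" by measurable
  then have "indep_var borel (\<zeta> n) borel D"
    unfolding D_def by (rule indep_var_increment[OF p])
  from indep_var_compose[OF this, of "\<lambda>x. x\<^sup>2" borel "\<lambda>x. x\<^sup>2" borel]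
  have i2: "indep_var borel (\<lambda>\<omega>. (\<zeta> n \<omega>)\<^sup>2) borel (\<lambda>\<omega>. (D \<omega>)\<^sup>2)" by (simp add: comp_def)
  note c2 = indep_var_integrable[OF i2 z2 mom(3)] indep_var_lebesgue_integral[OF i2 z2 mom(3)]
  have eq: "(increment_sum (Suc n) p (\<lambda>k. \<zeta> k \<omega>) (\<lambda>s. B s \<omega>))\<^sup>2
      = ((S \<omega>)\<^sup>2 + 2 * (S \<omega> * \<zeta> n \<omega> * D \<omega>)) + (\<zeta> n \<omega>)\<^sup>2 * (D \<omega>)\<^sup>2" for \<omega>
    by (simp add: increment_sum_def S_def D_def power2_eq_square algebra_simps)
  have V': "(\<Sum>k<Suc n. (\<zeta> k \<omega>)\<^sup>2 * (p (Suc k) - p k)) = V \<omega> + (\<zeta> n \<omega>)\<^sup>2 * (p (Suc n) - p n)" for \<omega>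
    by (simp add: V_def)
  show ?case
    unfolding eq V'
    using IH c1 c2 z2 mom by auto
qed

text \<open>Stopping the sum as soon as the accumulated variance exceeds \<open>\<delta>\<close> changes it only when the
  total variance exceeds \<open>\<delta>\<close>, and the stopped sum has second moment at most \<open>\<delta>\<close>. The variance
  accumulated up to the end of a cell is known at its start, so stopping keeps the coefficients
  predictable; it also makes them bounded, because every cell has positive length.\<close>

lemma discrete_lenglart:
  assumes grid: "\<And>k. k < n \<Longrightarrow> p k < p (Suc k)" "\<And>k. k \<le> n \<Longrightarrow> p k \<in> horizon T"
    and \<zeta>: "\<And>k. k < n \<Longrightarrow> \<zeta> k \<in> borel_measurable (F (p k))" and pos: "0 < \<epsilon>" "0 \<le> \<delta>"
  shows "prob {\<omega> \<in> space M. \<bar>increment_sum n p (\<lambda>k. \<zeta> k \<omega>) (\<lambda>s. B s \<omega>)\<bar> > \<epsilon>}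
    \<le> \<delta> / \<epsilon>\<^sup>2 + prob {\<omega> \<in> space M. (\<Sum>k<n. (\<zeta> k \<omega>)\<^sup>2 * (p (Suc k) - p k)) > \<delta>}"
proof -
  define A where "A k \<omega> = (\<Sum>l<k. (\<zeta> l \<omega>)\<^sup>2 * (p (Suc l) - p l))" for k \<omega>
  define \<zeta>' where "\<zeta>' k \<omega> = (if A (Suc k) \<omega> \<le> \<delta> then \<zeta> k \<omega> else 0)" for k \<omega>
  define S where "S = (\<lambda>\<omega>. increment_sum n p (\<lambda>k. \<zeta> k \<omega>) (\<lambda>s. B s \<omega>))"
  define S' where "S' = (\<lambda>\<omega>. increment_sum n p (\<lambda>k. \<zeta>' k \<omega>) (\<lambda>s. B s \<omega>))"
  have d: "0 \<le> p (Suc k) - p k" if "k < n" for k using grid(1)[OF that] by simp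
  have AF: "A k \<in> borel_measurable (F (p j))" if "k \<le> Suc j" "j < n" for k j
    unfolding A_def
  proof (intro borel_measurable_sum borel_measurable_times borel_measurable_power)
    fix l assume l: "l \<in> {..<k}"
    have "p l \<le> p j" by (rule grid_mono[of n p l j]) (use l that grid(1) in \<open>auto intro: less_imp_le\<close>)
    have h: "p l \<in> horizon T" "p j \<in> horizon T" using l that grid(2) by auto
    show "\<zeta> l \<in> borel_measurable (F (p j))"
      by (rule measurable_F_mono[OF \<zeta> h \<open>p l \<le> p j\<close>]) (use l that in simp)
  qed simp
  have \<zeta>'F: "\<zeta>' k \<in> borel_measurable (F (p k))" if "k < n" for k
    using AF[of "Suc k" k] \<zeta>[OF that] that unfolding \<zeta>'_def by measurable
  have A_mono: "A k \<omega> \<le> A l \<omega>" if "k \<le> l" "l \<le> n" for k l \<omega>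
    unfolding A_def using that d by (intro sum_mono2) auto
  have bounded: "\<bar>\<zeta>' k \<omega>\<bar> \<le> sqrt (\<delta> / (p (Suc k) - p k))" if "k < n" for k \<omega>
  proof (cases "A (Suc k) \<omega> \<le> \<delta>")
    case True
    have "0 \<le> A k \<omega>" using A_mono[of 0 k \<omega>] that by (simp add: A_def)
    with True have "(\<zeta> k \<omega>)\<^sup>2 * (p (Suc k) - p k) \<le> \<delta>" by (simp add: A_def)
    then have "(\<zeta> k \<omega>)\<^sup>2 \<le> \<delta> / (p (Suc k) - p k)" using grid(1)[OF that] by (simp add: field_simps)
    then show ?thesis using True real_sqrt_le_mono by (fastforce simp: \<zeta>'_def)
  qed (use d[OF that] pos in \<open>simp add: \<zeta>'_def\<close>)
  have stopped: "(\<Sum>k<j. (\<zeta>' k \<omega>)\<^sup>2 * (p (Suc k) - p k)) \<le> \<delta>" if "j \<le> n" for j \<omega>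
    using that
  proof (induction j)
    case (Suc j)
    show ?case
    proof (cases "A (Suc j) \<omega> \<le> \<delta>")
      case True
      have "(\<Sum>k<Suc j. (\<zeta>' k \<omega>)\<^sup>2 * (p (Suc k) - p k)) \<le> A (Suc j) \<omega>"
        unfolding A_def using Suc.prems d by (intro sum_mono mult_right_mono) (auto simp: \<zeta>'_def)
      then show ?thesis using True by simp
    qed (use Suc in \<open>auto simp: \<zeta>'_def\<close>)
  qed (use pos in simp)
  have iso: "integrable M (\<lambda>\<omega>. (S' \<omega>)\<^sup>2)"
    "expectation (\<lambda>\<omega>. (S' \<omega>)\<^sup>2) = expectation (\<lambda>\<omega>. \<Sum>k<n. (\<zeta>' k \<omega>)\<^sup>2 * (p (Suc k) - p k))"
    "integrable M (\<lambda>\<omega>. \<Sum>k<n. (\<zeta>' k \<omega>)\<^sup>2 * (p (Suc k) - p k))"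
    using discrete_ito_isometry[of n p \<zeta>'] grid \<zeta>'F bounded unfolding S'_def by blast+
  have "expectation (\<lambda>\<omega>. (S' \<omega>)\<^sup>2) \<le> expectation (\<lambda>\<omega>. \<delta>)"
    unfolding iso(2) using iso(3) stopped by (intro integral_mono) auto
  then have E: "expectation (\<lambda>\<omega>. (S' \<omega>)\<^sup>2) \<le> \<delta>" by (simp add: prob_space)
  have meas: "S \<in> borel_measurable M" "S' \<in> borel_measurable M" "A n \<in> borel_measurable M"
  proof -
    have "S \<in> borel_measurable (F (p n))" "S' \<in> borel_measurable (F (p n))"
      unfolding S_def S'_def
      by (rule increment_sum_measurable; use grid \<zeta> \<zeta>'F in \<open>auto intro: less_imp_le\<close>)+
    then show "S \<in> borel_measurable M" "S' \<in> borel_measurable M"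
      using grid(2) measurable_F_M by blast+
    show "A n \<in> borel_measurable M"
      unfolding A_def using \<zeta> grid(2)
      by (intro borel_measurable_sum borel_measurable_times borel_measurable_power)
         (auto intro!: measurable_F_M)
  qed
  note [measurable] = meas
  have "prob {\<omega> \<in> space M. \<bar>S \<omega>\<bar> > \<epsilon>}
      \<le> prob {\<omega> \<in> space M. \<epsilon> \<le> \<bar>S' \<omega>\<bar>} + prob {\<omega> \<in> space M. A n \<omega> > \<delta>}"
  proof (rule prob_le_add[OF AE_I2])
    fix \<omega>
    have "S' \<omega> = S \<omega>" if "A n \<omega> \<le> \<delta>"
    proof -
      have "\<zeta>' k \<omega> = \<zeta> k \<omega>" if "k < n" for k
        using A_mono[of "Suc k" n \<omega>] that \<open>A n \<omega> \<le> \<delta>\<close> by (auto simp: \<zeta>'_def)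
      then show ?thesis by (simp add: S_def S'_def increment_sum_def)
    qed
    then show "\<epsilon> < \<bar>S \<omega>\<bar> \<longrightarrow> \<epsilon> \<le> \<bar>S' \<omega>\<bar> \<or> \<delta> < A n \<omega>" by fastforce
  qed measurable
  also have "prob {\<omega> \<in> space M. \<epsilon> \<le> \<bar>S' \<omega>\<bar>} \<le> expectation (\<lambda>\<omega>. (S' \<omega>)\<^sup>2) / \<epsilon>\<^sup>2"
    using second_moment_method[OF meas(2) iso(1) pos(1)] by simp
  also have "\<dots> \<le> \<delta> / \<epsilon>\<^sup>2" using E by (intro divide_right_mono) auto
  finally show ?thesis by (simp add: S_def A_def)
qed

end

section \<open>Square-integrable functions on a set\<close>

text \<open>Measurability of the function itself is included, because products need it and it does not follow
  from that of the square.\<close>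

definition square_integrable_on :: "real set \<Rightarrow> (real \<Rightarrow> real) \<Rightarrow> bool" where
  "square_integrable_on A f \<longleftrightarrow>
     set_borel_measurable lborel A f \<and> set_integrable lborel A (\<lambda>s. (f s)\<^sup>2)"

lemma square_integrable_on_add:
  assumes "square_integrable_on A f" "square_integrable_on A g"
  shows "square_integrable_on A (\<lambda>s. f s + g s)"
    "set_integrable lborel A (\<lambda>s. f s * g s)"
proof -
  have m: "(\<lambda>s. indicator A s * f s) \<in> borel_measurable lborel"
    "(\<lambda>s. indicator A s * g s) \<in> borel_measurable lborel"
    and i: "integrable lborel (\<lambda>s. indicator A s * (f s)\<^sup>2)"
      "integrable lborel (\<lambda>s. indicator A s * (g s)\<^sup>2)"
    using assms by (simp_all add: square_integrable_on_def set_borel_measurable_def set_integrable_def)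
  have eq: "indicator A s * (f s * g s) = (indicator A s * f s) * (indicator A s * g s)" for s
    by (simp add: indicator_def)
  have eq': "indicator A s * (f s + g s) = indicator A s * f s + indicator A s * g s" for s
    by (simp add: algebra_simps)
  have bound: "\<bar>x * y\<bar> \<le> x\<^sup>2 + y\<^sup>2" for x y :: real
  proof -
    have "2 * (\<bar>x\<bar> * \<bar>y\<bar>) \<le> \<bar>x\<bar>\<^sup>2 + \<bar>y\<bar>\<^sup>2" using sum_squares_bound[of "\<bar>x\<bar>" "\<bar>y\<bar>"] by (simp add: mult.assoc)
    moreover have "0 \<le> \<bar>x\<bar> * \<bar>y\<bar>" by simp
    ultimately show ?thesis unfolding power2_abs abs_mult by linarith
  qed
  have prod: "integrable lborel (\<lambda>s. indicator A s * (f s * g s))"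
  proof (rule Bochner_Integration.integrable_bound[OF Bochner_Integration.integrable_add[OF i]])
    show "(\<lambda>s. indicator A s * (f s * g s)) \<in> borel_measurable lborel" unfolding eq using m by measurable
    show "AE s in lborel. norm (indicator A s * (f s * g s))
        \<le> norm (indicator A s * (f s)\<^sup>2 + indicator A s * (g s)\<^sup>2)"
      using bound by (auto simp: indicator_def)
  qed
  then show "set_integrable lborel A (\<lambda>s. f s * g s)" by (simp add: set_integrable_def)
  have "integrable lborel (\<lambda>s. indicator A s * (f s)\<^sup>2 + indicator A s * (g s)\<^sup>2
      + 2 * (indicator A s * (f s * g s)))"
    using i prod by auto
  also have "(\<lambda>s. indicator A s * (f s)\<^sup>2 + indicator A s * (g s)\<^sup>2
      + 2 * (indicator A s * (f s * g s))) = (\<lambda>s. indicator A s * (f s + g s)\<^sup>2)"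
    by (auto simp: power2_eq_square algebra_simps)
  finally show "square_integrable_on A (\<lambda>s. f s + g s)"
    using m by (simp add: square_integrable_on_def set_borel_measurable_def set_integrable_def eq')
qed

lemma square_integrable_on_mult_bounded:
  assumes "square_integrable_on A f" "c \<in> borel_measurable borel" "\<And>s. s \<in> A \<Longrightarrow> \<bar>c s\<bar> \<le> C"
  shows "square_integrable_on A (\<lambda>s. c s * f s)"
proof -
  have m: "(\<lambda>s. indicator A s * f s) \<in> borel_measurable lborel"
    and i: "integrable lborel (\<lambda>s. indicator A s * (f s)\<^sup>2)"
    using assms by (simp_all add: square_integrable_on_def set_borel_measurable_def set_integrable_def)
  have eq: "indicator A s * (c s * f s) = c s * (indicator A s * f s)"
    "indicator A s * (c s * f s)\<^sup>2 = (c s * (indicator A s * f s))\<^sup>2" for s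
    by (auto simp: indicator_def)
  have "integrable lborel (\<lambda>s. indicator A s * (c s * f s)\<^sup>2)"
  proof (rule Bochner_Integration.integrable_bound[OF integrable_mult_right[OF i, of "C\<^sup>2"]])
    show "(\<lambda>s. indicator A s * (c s * f s)\<^sup>2) \<in> borel_measurable lborel"
      unfolding eq using m assms(2) by measurable
    have "(c s)\<^sup>2 \<le> C\<^sup>2" if "s \<in> A" for s
      using assms(3)[OF that] by (meson abs_le_square_iff abs_ge_self order_trans)
    then show "AE s in lborel. norm (indicator A s * (c s * f s)\<^sup>2) \<le> norm (C\<^sup>2 * (indicator A s * (f s)\<^sup>2))"
      by (auto simp: indicator_def power_mult_distrib abs_mult intro!: mult_right_mono)
  qed
  moreover have "(\<lambda>s. c s * (indicator A s * f s)) \<in> borel_measurable lborel" using m assms(2) by measurable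
  ultimately show ?thesis
    by (simp add: square_integrable_on_def set_borel_measurable_def set_integrable_def eq(1))
qed

lemma square_integrable_on_bounded:
  assumes "c \<in> borel_measurable borel" "\<And>s. s \<in> {a..b} \<Longrightarrow> \<bar>c s\<bar> \<le> C"
  shows "square_integrable_on {a..b} c"
proof -
  have "square_integrable_on {a..b} (\<lambda>s. 1)"
    by (auto simp: square_integrable_on_def set_borel_measurable_def set_integrable_def
        intro!: integrable_real_indicator emeasure_bounded_finite)
  from square_integrable_on_mult_bounded[OF this assms] show ?thesis by simp
qed

lemma square_integrable_on_cmult:
  "square_integrable_on A f \<Longrightarrow> square_integrable_on A (\<lambda>s. c * f s)"
  using square_integrable_on_mult_bounded[of A f "\<lambda>_. c" "\<bar>c\<bar>"] by simp

lemma square_integrable_on_diff: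
  assumes "square_integrable_on A f" "square_integrable_on A g"
  shows "square_integrable_on A (\<lambda>s. f s - g s)"
  using square_integrable_on_add(1)[OF assms(1) square_integrable_on_cmult[OF assms(2), of "-1"]] by simp

lemma square_integrable_on_step_fun: "square_integrable_on {a..b} (step_fun n q c)"
proof (rule square_integrable_on_bounded)
  show "\<bar>step_fun n q c s\<bar> \<le> (\<Sum>i<n. \<bar>c i\<bar>)" for s
    unfolding step_fun_def by (rule order_trans[OF sum_abs sum_mono]) (auto simp: indicator_def)
qed measurable

lemma square_integrable_on_continuous:
  fixes f :: "real \<Rightarrow> real"
  assumes "continuous_on {a..t} f"
  shows "square_integrable_on {a..t} f"
  unfolding square_integrable_on_def
proof
  have "set_integrable lborel {a..t} f" using assms by (rule borel_integrable_atLeastAtMost')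
  then show "set_borel_measurable lborel {a..t} f"
    by (simp add: set_integrable_def set_borel_measurable_def borel_measurable_integrable)
  show "set_integrable lborel {a..t} (\<lambda>s. (f s)\<^sup>2)"
    using assms by (intro borel_integrable_atLeastAtMost' continuous_on_power)
qed

lemma set_integral_square_le:
  assumes f: "square_integrable_on A f" and g: "square_integrable_on A g" and h: "square_integrable_on A h"
    and le: "\<And>s. s \<in> A \<Longrightarrow> \<bar>f s\<bar> \<le> \<bar>g s\<bar> + \<bar>h s\<bar>"
  shows "(LBINT s:A. (f s)\<^sup>2) \<le> 2 * (LBINT s:A. (g s)\<^sup>2) + 2 * (LBINT s:A. (h s)\<^sup>2)"
proof -
  note i = f[unfolded square_integrable_on_def, THEN conjunct2]
    g[unfolded square_integrable_on_def, THEN conjunct2]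
    h[unfolded square_integrable_on_def, THEN conjunct2]
  have "(LBINT s:A. (f s)\<^sup>2) \<le> (LBINT s:A. 2 * (g s)\<^sup>2 + 2 * (h s)\<^sup>2)"
  proof (rule set_integral_mono)
    fix s assume "s \<in> A"
    then have "(f s)\<^sup>2 \<le> (\<bar>g s\<bar> + \<bar>h s\<bar>)\<^sup>2" using power_mono[OF le, of s 2] by simp
    also have "\<dots> \<le> 2 * (g s)\<^sup>2 + 2 * (h s)\<^sup>2"
      using sum_squares_bound[of "\<bar>g s\<bar>" "\<bar>h s\<bar>"] by (simp add: power2_sum)
    finally show "(f s)\<^sup>2 \<le> 2 * (g s)\<^sup>2 + 2 * (h s)\<^sup>2" .
  qed (use i in auto)
  also have "\<dots> = 2 * (LBINT s:A. (g s)\<^sup>2) + 2 * (LBINT s:A. (h s)\<^sup>2)"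
    using i by (subst set_integral_add(2)) auto
  finally show ?thesis .
qed

section \<open>Convergence in probability\<close>

context prob_space
begin

lemma tendsto_in_probability_cmult:
  assumes "tendsto_in_probability M Y Z"
  shows "tendsto_in_probability M (\<lambda>n \<omega>. c * Y n \<omega>) (\<lambda>\<omega>. c * Z \<omega>)"
proof (cases "c = 0")
  case False
  have "{\<omega> \<in> space M. \<epsilon> < \<bar>c * Y n \<omega> - c * Z \<omega>\<bar>} = {\<omega> \<in> space M. \<epsilon> / \<bar>c\<bar> < \<bar>Y n \<omega> - Z \<omega>\<bar>}" for \<epsilon> n
    using False by (simp add: right_diff_distrib[symmetric] abs_mult pos_divide_less_eq mult.commute)
  then show ?thesis
    using assms False by (auto simp: tendsto_in_probability_def intro!: borel_measurable_times)
qed (auto simp: tendsto_in_probability_def)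

lemma tendsto_in_probability_add:
  assumes "tendsto_in_probability M Y Z" "tendsto_in_probability M Y' Z'"
  shows "tendsto_in_probability M (\<lambda>n \<omega>. Y n \<omega> + Y' n \<omega>) (\<lambda>\<omega>. Z \<omega> + Z' \<omega>)"
proof -
  have [measurable]: "Y n \<in> borel_measurable M" "Y' n \<in> borel_measurable M"
    "Z \<in> borel_measurable M" "Z' \<in> borel_measurable M" for n
    using assms by (auto simp: tendsto_in_probability_def)
  have "(\<lambda>n. prob {\<omega> \<in> space M. \<bar>Y n \<omega> + Y' n \<omega> - (Z \<omega> + Z' \<omega>)\<bar> > \<epsilon>}) \<longlonglongrightarrow> 0"
    if "\<epsilon> > 0" for \<epsilon> :: real
  proof (rule tendsto_sandwich[OF _ _ tendsto_const])
    show "(\<lambda>n. prob {\<omega> \<in> space M. \<bar>Y n \<omega> - Z \<omega>\<bar> > \<epsilon> / 2}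
        + prob {\<omega> \<in> space M. \<bar>Y' n \<omega> - Z' \<omega>\<bar> > \<epsilon> / 2}) \<longlonglongrightarrow> 0"
      using assms half_gt_zero[OF that] unfolding tendsto_in_probability_def
      by (intro tendsto_add_zero) blast+
    show "\<forall>\<^sub>F n in sequentially. prob {\<omega> \<in> space M. \<bar>Y n \<omega> + Y' n \<omega> - (Z \<omega> + Z' \<omega>)\<bar> > \<epsilon>}
       \<le> prob {\<omega> \<in> space M. \<bar>Y n \<omega> - Z \<omega>\<bar> > \<epsilon> / 2} + prob {\<omega> \<in> space M. \<bar>Y' n \<omega> - Z' \<omega>\<bar> > \<epsilon> / 2}"
    proof (intro always_eventually allI)
      fix n
      show "prob {\<omega> \<in> space M. \<bar>Y n \<omega> + Y' n \<omega> - (Z \<omega> + Z' \<omega>)\<bar> > \<epsilon>}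
          \<le> prob {\<omega> \<in> space M. \<bar>Y n \<omega> - Z \<omega>\<bar> > \<epsilon> / 2}
            + prob {\<omega> \<in> space M. \<bar>Y' n \<omega> - Z' \<omega>\<bar> > \<epsilon> / 2}"
      proof (rule prob_le_add[OF AE_I2])
        fix \<omega>
        have "\<bar>Y n \<omega> + Y' n \<omega> - (Z \<omega> + Z' \<omega>)\<bar> \<le> \<bar>Y n \<omega> - Z \<omega>\<bar> + \<bar>Y' n \<omega> - Z' \<omega>\<bar>" by linarith
        then show "\<epsilon> < \<bar>Y n \<omega> + Y' n \<omega> - (Z \<omega> + Z' \<omega>)\<bar>
            \<longrightarrow> \<epsilon> / 2 < \<bar>Y n \<omega> - Z \<omega>\<bar> \<or> \<epsilon> / 2 < \<bar>Y' n \<omega> - Z' \<omega>\<bar>"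
          by argo
      qed measurable
    qed
  qed simp
  then show ?thesis by (simp add: tendsto_in_probability_def)
qed

lemma tendsto_in_probability_increment_sum:
  assumes "\<And>i. i \<le> n \<Longrightarrow> tendsto_in_probability M (\<lambda>m. j m (q i)) (J (q i))"
  shows "tendsto_in_probability M (\<lambda>m \<omega>. increment_sum n q c (\<lambda>s. j m s \<omega>))
    (\<lambda>\<omega>. increment_sum n q c (\<lambda>s. J s \<omega>))"
  using assms
proof (induction n)
  case 0
  then show ?case by (simp add: increment_sum_def tendsto_in_probability_def)
next
  case (Suc n)
  have "tendsto_in_probability M (\<lambda>m \<omega>. increment_sum n q c (\<lambda>s. j m s \<omega>)
      + (c n * j m (q (Suc n)) \<omega> + (- c n) * j m (q n) \<omega>))
    (\<lambda>\<omega>. increment_sum n q c (\<lambda>s. J s \<omega>) + (c n * J (q (Suc n)) \<omega> + (- c n) * J (q n) \<omega>))"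
    by (intro tendsto_in_probability_add tendsto_in_probability_cmult) (use Suc in auto)
  then show ?case by (simp add: increment_sum_def right_diff_distrib)
qed

end

section \<open>Lenglart's inequality for the Ito integral\<close>

context wiener_space
begin

text \<open>Clamping the time to \<open>{0..t}\<close> and viewing the outcome in the smaller sigma-algebra \<open>F t\<close> is a
  measurable map from the full product into the domain of the progressive process.\<close>

lemma progressive_jointly_measurable:
  assumes "progressive F T H" and t: "t \<in> horizon T"
  shows "(\<lambda>(\<omega>, s). indicator {0..t} s * H s \<omega>) \<in> borel_measurable (M \<Otimes>\<^sub>M lborel)"
proof -
  have H: "(\<lambda>(s, \<omega>). H s \<omega>) \<in> borel_measurable (restrict_space borel {0..t} \<Otimes>\<^sub>M F t)"
    using assms by (auto simp: progressive_def)
  have id: "(\<lambda>\<omega>. \<omega>) \<in> measurable M (F t)"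
    using measurable_from_subalg[OF subalgebra_F[OF t], of "\<lambda>\<omega>. \<omega>" "F t"] by simp
  have "(\<lambda>x. (max 0 (min (snd x) t), fst x))
      \<in> measurable (M \<Otimes>\<^sub>M lborel) (restrict_space borel {0..t} \<Otimes>\<^sub>M F t)"
    using horizon_nonneg[OF t]
    by (intro measurable_Pair measurable_restrict_space2 measurable_compose[OF measurable_fst id]) auto
  from measurable_compose[OF this H]
  have [measurable]: "(\<lambda>x. H (max 0 (min (snd x) t)) (fst x)) \<in> borel_measurable (M \<Otimes>\<^sub>M lborel)"
    by simp
  have "(\<lambda>x. indicator {0..t} (snd x) * H (max 0 (min (snd x) t)) (fst x)) \<in> borel_measurable (M \<Otimes>\<^sub>M lborel)"
    by measurable
  also have "(\<lambda>x. indicator {0..t} (snd x) * H (max 0 (min (snd x) t)) (fst x))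
      = (\<lambda>(\<omega>, s). indicator {0..t} s * H s \<omega>)"
    by (auto simp: indicator_def max_def min_def)
  finally show ?thesis .
qed

lemma progressive_section_measurable:
  assumes "progressive F T H" "t \<in> horizon T" "\<omega> \<in> space M"
  shows "set_borel_measurable lborel {0..t} (\<lambda>s. H s \<omega>)"
  using measurable_Pair2[OF progressive_jointly_measurable[OF assms(1,2)] assms(3)]
  by (simp add: set_borel_measurable_def)

text \<open>Between two neighbouring grid points only one cell is active: the earlier cells have ended and
  the later ones have not begun.\<close>

lemma simple_integral_cell:
  assumes p: "\<And>k. k < m \<Longrightarrow> p k < p (Suc k)" and k: "k < m"
  shows "increment_sum m p c (\<lambda>u. f (min u (p (Suc k)))) - increment_sum m p c (\<lambda>u. f (min u (p k)))
    = c k * (f (p (Suc k)) - f (p k))"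
proof -
  have le: "p a \<le> p b" if "a \<le> b" "b \<le> m" for a b
    by (rule grid_mono[of m p a b]) (use that p in \<open>auto intro: less_imp_le\<close>)
  have "increment_sum m p c (\<lambda>u. f (min u (p (Suc k)))) - increment_sum m p c (\<lambda>u. f (min u (p k)))
      = (\<Sum>l<m. c l * ((f (min (p (Suc l)) (p (Suc k))) - f (min (p l) (p (Suc k))))
          - (f (min (p (Suc l)) (p k)) - f (min (p l) (p k)))))"
    by (simp add: increment_sum_def sum_subtractf[symmetric] right_diff_distrib)
  also have "\<dots> = (\<Sum>l<m. if l = k then c k * (f (p (Suc k)) - f (p k)) else 0)"
  proof (intro sum.cong refl)
    fix l assume l: "l \<in> {..<m}"
    consider "l < k" | "l = k" | "l > k" by linarith
    then show "c l * ((f (min (p (Suc l)) (p (Suc k))) - f (min (p l) (p (Suc k))))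
          - (f (min (p (Suc l)) (p k)) - f (min (p l) (p k))))
        = (if l = k then c k * (f (p (Suc k)) - f (p k)) else 0)"
    proof cases
      case 1
      then have "p l \<le> p k" "p (Suc l) \<le> p k" "p k \<le> p (Suc k)" using k le by auto
      then show ?thesis using 1 by (simp add: min_absorb1)
    next
      case 2
      then have "p k \<le> p (Suc k)" using k le by auto
      then show ?thesis using 2 by (simp add: min_absorb1 min_absorb2)
    next
      case 3
      then have "p (Suc k) \<le> p l" "p (Suc k) \<le> p (Suc l)" "p k \<le> p (Suc k)" using l le by auto
      then show ?thesis using 3 by (simp add: min_absorb2)
    qed
  qed
  finally show ?thesis using k by simp
qed

text \<open>A coefficient enters at \<open>p k\<close> only if its own cell has begun by then, so refinement keeps the
  coefficients adapted.\<close>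

lemma refined_coeff_measurable:
  assumes "\<And>i. i < n \<Longrightarrow> q i \<in> horizon T" "p k \<in> horizon T"
    "\<And>i. i < n \<Longrightarrow> d i \<in> borel_measurable (F (q i))"
  shows "(\<lambda>\<omega>. refined_coeff n q (\<lambda>i. d i \<omega>) p k) \<in> borel_measurable (F (p k))"
  unfolding refined_coeff_def
proof (intro borel_measurable_sum)
  fix i assume i: "i \<in> {..<n}"
  show "(\<lambda>\<omega>. if q i \<le> p k \<and> p k < q (Suc i) then d i \<omega> else 0) \<in> borel_measurable (F (p k))"
  proof (cases "q i \<le> p k \<and> p k < q (Suc i)")
    case True
    then have "d i \<in> borel_measurable (F (p k))"
      using measurable_F_mono[of "d i" "q i" borel "p k"] assms i by blast
    then show ?thesis using True by simp
  next
    case False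
    then have "(\<lambda>\<omega>. if q i \<le> p k \<and> p k < q (Suc i) then d i \<omega> else 0) = (\<lambda>\<omega>. 0)" by auto
    then show ?thesis by simp
  qed
qed

text \<open>On a common refinement of the two grids the difference is one elementary sum, and its accumulated
  variance is the time integral of the squared difference of the integrands.\<close>

lemma simple_lenglart:
  assumes simple: "has_simple_ito_integral M F T B h j"
    and q: "\<And>i. i < n \<Longrightarrow> q i \<le> q (Suc i)" "\<And>i. i \<le> n \<Longrightarrow> q i \<in> horizon T" "q n \<le> t"
    and d: "\<And>i. i < n \<Longrightarrow> d i \<in> borel_measurable (F (q i))"
    and pos: "0 < \<epsilon>" "0 \<le> \<delta>"
  shows "prob {\<omega> \<in> space M. \<bar>increment_sum n q c (\<lambda>s. j s \<omega>)
        - increment_sum n q (\<lambda>i. d i \<omega>) (\<lambda>s. B s \<omega>)\<bar> > \<epsilon>}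
    \<le> \<delta> / \<epsilon>\<^sup>2 + prob {\<omega> \<in> space M.
        (LBINT s:{0..t}. (step_fun n q c s * h s \<omega> - step_fun n q (\<lambda>i. d i \<omega>) s)\<^sup>2) > \<delta>}"
proof -
  obtain N \<tau> \<xi> where \<tau>: "\<And>i. i \<le> N \<Longrightarrow> \<tau> i \<in> horizon T" "\<And>i. i < N \<Longrightarrow> \<tau> i \<le> \<tau> (Suc i)"
    and \<xi>: "\<And>i. i < N \<Longrightarrow> \<xi> i \<in> borel_measurable (F (\<tau> i))"
    and h: "h = (\<lambda>s \<omega>. step_fun N \<tau> (\<lambda>i. \<xi> i \<omega>) s)"
    and j: "j = (\<lambda>s \<omega>. increment_sum N \<tau> (\<lambda>i. \<xi> i \<omega>) (\<lambda>u. B (min u s) \<omega>))"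
    using simple unfolding has_simple_ito_integral_def step_fun_def increment_sum_def by blast
  obtain m p where p: "\<And>k. k < m \<Longrightarrow> p k < p (Suc k)" "p ` {..m} = \<tau> ` {..N} \<union> q ` {..n}"
    by (rule finite_set_as_grid[of "\<tau> ` {..N} \<union> q ` {..n}"]) auto
  have sub: "\<tau> ` {..N} \<subseteq> p ` {..m}" "q ` {..n} \<subseteq> p ` {..m}" using p by auto
  have ph: "p k \<in> horizon T" if "k \<le> m" for k
  proof -
    have "p k \<in> \<tau> ` {..N} \<union> q ` {..n}" using p(2) that by blast
    then show ?thesis using \<tau>(1) q(2) by auto
  qed
  have ple: "\<And>k. k < m \<Longrightarrow> p k \<le> p (Suc k)" using p(1) by (simp add: less_imp_le)
  define \<eta> where "\<eta> k \<omega> = refined_coeff N \<tau> (\<lambda>i. \<xi> i \<omega>) p k" for k \<omega>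
  define \<gamma> where "\<gamma> = refined_coeff n q c p"
  define \<theta> where "\<theta> k \<omega> = refined_coeff n q (\<lambda>i. d i \<omega>) p k" for k \<omega>
  define \<zeta> where "\<zeta> k \<omega> = \<gamma> k * \<eta> k \<omega> - \<theta> k \<omega>" for k \<omega>
  have "\<eta> k \<in> borel_measurable (F (p k))" "\<theta> k \<in> borel_measurable (F (p k))" if "k < m" for k
    unfolding \<eta>_def \<theta>_def using that ph \<tau> \<xi> q d by (auto intro!: refined_coeff_measurable)
  then have \<zeta>: "\<zeta> k \<in> borel_measurable (F (p k))" if "k < m" for k
    unfolding \<zeta>_def using that by (intro borel_measurable_diff borel_measurable_times) auto
  have jcell: "j (p (Suc k)) \<omega> - j (p k) \<omega> = \<eta> k \<omega> * (B (p (Suc k)) \<omega> - B (p k) \<omega>)" if "k < m" for k \<omega>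
  proof -
    have "j s \<omega> = increment_sum m p (\<lambda>k. \<eta> k \<omega>) (\<lambda>u. B (min u s) \<omega>)" for s
      unfolding j \<eta>_def by (rule increment_sum_refine[OF p(1) \<tau>(2) sub(1)])
    then show ?thesis using simple_integral_cell[of m p k, OF p(1) that, of _ "\<lambda>u. B u \<omega>"] by simp
  qed
  have sum_eq: "increment_sum n q c (\<lambda>s. j s \<omega>) - increment_sum n q (\<lambda>i. d i \<omega>) (\<lambda>s. B s \<omega>)
      = increment_sum m p (\<lambda>k. \<zeta> k \<omega>) (\<lambda>s. B s \<omega>)" for \<omega>
  proof -
    have "increment_sum n q c (\<lambda>s. j s \<omega>) = increment_sum m p \<gamma> (\<lambda>s. j s \<omega>)"
      unfolding \<gamma>_def by (rule increment_sum_refine[OF p(1) q(1) sub(2)])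
    also have "\<dots> = increment_sum m p (\<lambda>k. \<gamma> k * \<eta> k \<omega>) (\<lambda>s. B s \<omega>)"
      unfolding increment_sum_def using jcell by (simp add: mult.assoc)
    finally have "increment_sum n q c (\<lambda>s. j s \<omega>)
        = increment_sum m p (\<lambda>k. \<gamma> k * \<eta> k \<omega>) (\<lambda>s. B s \<omega>)" .
    moreover have "increment_sum n q (\<lambda>i. d i \<omega>) (\<lambda>s. B s \<omega>)
        = increment_sum m p (\<lambda>k. \<theta> k \<omega>) (\<lambda>s. B s \<omega>)"
      unfolding \<theta>_def by (rule increment_sum_refine[OF p(1) q(1) sub(2)])
    ultimately show ?thesis
      by (simp add: increment_sum_def sum_subtractf[symmetric] \<zeta>_def left_diff_distrib)
  qed
  have int_eq: "(LBINT s:{0..t}. (step_fun n q c s * h s \<omega> - step_fun n q (\<lambda>i. d i \<omega>) s)\<^sup>2)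
      = (\<Sum>k<m. (\<zeta> k \<omega>)\<^sup>2 * (p (Suc k) - p k))" for \<omega>
  proof -
    have eq: "step_fun n q c s * h s \<omega> - step_fun n q (\<lambda>i. d i \<omega>) s = step_fun m p (\<lambda>k. \<zeta> k \<omega>) s" for s
    proof -
      have "h s \<omega> = step_fun m p (\<lambda>k. \<eta> k \<omega>) s"
        unfolding h \<eta>_def by (rule step_fun_refine[OF p(1) \<tau>(2) sub(1)])
      moreover have "step_fun n q c s = step_fun m p \<gamma> s"
        unfolding \<gamma>_def by (rule step_fun_refine[OF p(1) q(1) sub(2)])
      moreover have "step_fun n q (\<lambda>i. d i \<omega>) s = step_fun m p (\<lambda>k. \<theta> k \<omega>) s"
        unfolding \<theta>_def by (rule step_fun_refine[OF p(1) q(1) sub(2)])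
      ultimately show ?thesis by (simp add: step_fun_mult ple step_fun_diff \<zeta>_def)
    qed
    have "0 \<le> q 0" using q(2) horizon_nonneg by blast
    have "indicator {0..t} s *\<^sub>R (step_fun m p (\<lambda>k. \<zeta> k \<omega>) s)\<^sup>2 = step_fun m p (\<lambda>k. (\<zeta> k \<omega>)\<^sup>2) s" for s
    proof (cases "s \<in> {0..t}")
      case False
      then have "s \<le> q 0 \<or> q n < s" using \<open>0 \<le> q 0\<close> q(3) by auto
      then have "step_fun m p (\<lambda>k. \<zeta> k \<omega>) s = 0"
        unfolding eq[symmetric] using step_fun_outside[of n q s] q(1) by simp
      then show ?thesis using step_fun_power2[of m p "\<lambda>k. \<zeta> k \<omega>" s] ple by simp
    qed (simp add: step_fun_power2 ple)
    then show ?thesis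
      unfolding eq set_lebesgue_integral_def by (simp only: integral_step_fun[of m p, OF ple])
  qed
  show ?thesis
    unfolding sum_eq int_eq by (rule discrete_lenglart[of m p \<zeta>, OF p(1) ph \<zeta> pos])
qed

text \<open>The approximating simple integrals satisfy the inequality, and the factors 2 and 1/4 pay for the
  distances between these and the limit. The deterministic weights \<open>c\<close> serve to insert an integrating
  factor, the random coefficients \<open>d\<close> to insert the value of a process at an earlier time.\<close>

lemma ito_lenglart:
  assumes ito: "has_ito_integral M F T B H J" and t: "t \<in> horizon T"
    and q: "\<And>i. i < n \<Longrightarrow> q i \<le> q (Suc i)" "\<And>i. i \<le> n \<Longrightarrow> q i \<in> horizon T" "q n \<le> t"
    and d: "\<And>i. i < n \<Longrightarrow> d i \<in> borel_measurable (F (q i))"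
    and pos: "0 < \<epsilon>" "0 < \<delta>"
  shows "prob {\<omega> \<in> space M. \<bar>increment_sum n q c (\<lambda>s. J s \<omega>)
        - increment_sum n q (\<lambda>i. d i \<omega>) (\<lambda>s. B s \<omega>)\<bar> > 2 * \<epsilon>}
    \<le> \<delta> / \<epsilon>\<^sup>2 + prob {\<omega> \<in> space M.
        (LBINT s:{0..t}. (step_fun n q c s * H s \<omega> - step_fun n q (\<lambda>i. d i \<omega>) s)\<^sup>2) > \<delta> / 4}"
proof -
  obtain h j where simple: "\<And>m. has_simple_ito_integral M F T B (h m) (j m)"
    and hlim: "tendsto_in_probability M (\<lambda>m \<omega>. LBINT s:{0..t}. (h m s \<omega> - H s \<omega>)\<^sup>2) (\<lambda>\<omega>. 0)"
    and jlim: "\<And>s. s \<in> horizon T \<Longrightarrow> tendsto_in_probability M (\<lambda>m. j m s) (J s)"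
    using ito t unfolding has_ito_integral_def by blast
  have prog: "progressive F T H"
    and sq: "AE \<omega> in M. \<forall>t\<in>horizon T. set_integrable lborel {0..t} (\<lambda>s. (H s \<omega>)\<^sup>2)"
    using ito unfolding has_ito_integral_def by auto
  define c' where "c' = step_fun n q c"
  define d' where "d' \<omega> = step_fun n q (\<lambda>i. d i \<omega>)" for \<omega>
  define R where "R = (\<lambda>\<omega>. LBINT s:{0..t}. (c' s * H s \<omega> - d' \<omega> s)\<^sup>2)"
  define R' where "R' m = (\<lambda>\<omega>. LBINT s:{0..t}. (h m s \<omega> - H s \<omega>)\<^sup>2)" for m
  define P where "P m = (\<lambda>\<omega>. increment_sum n q c (\<lambda>s. j m s \<omega>))" for m
  define P' where "P' = (\<lambda>\<omega>. increment_sum n q c (\<lambda>s. J s \<omega>))"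
  define D where "D = (\<lambda>\<omega>. increment_sum n q (\<lambda>i. d i \<omega>) (\<lambda>s. B s \<omega>))"
  obtain C where C: "0 < C" "\<And>s. \<bar>c' s\<bar> \<le> C"
  proof
    show "0 < 1 + (\<Sum>i<n. \<bar>c i\<bar>)" by (simp add: add_pos_nonneg sum_nonneg)
    show "\<bar>c' s\<bar> \<le> 1 + (\<Sum>i<n. \<bar>c i\<bar>)" for s
      unfolding c'_def step_fun_def
      by (rule order_trans[OF order_trans[OF sum_abs sum_mono[of _ _ "\<lambda>i. \<bar>c i\<bar>"]]]) (auto simp: indicator_def)
  qed
  have Plim: "tendsto_in_probability M P P'"
    unfolding P_def P'_def using q(2) jlim by (intro tendsto_in_probability_increment_sum) auto
  have D [measurable]: "D \<in> borel_measurable M"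
    using measurable_F_M[OF increment_sum_measurable[of n q d, OF q(1,2) d]] q(2) unfolding D_def by blast
  have [measurable]: "P m \<in> borel_measurable M" "P' \<in> borel_measurable M" "R' m \<in> borel_measurable M" for m
    using Plim hlim unfolding tendsto_in_probability_def R'_def by auto
  have dM [measurable]: "d i \<in> borel_measurable M" if "i < n" for i
    using measurable_F_M[OF d[OF that]] q(2)[of i] that by simp
  have [measurable]: "R \<in> borel_measurable M"
  proof -
    have "(\<lambda>(\<omega>, s). indicator {0..t} s * (c' s * (indicator {0..t} s * H s \<omega>)
        - (\<Sum>i<n. d i \<omega> * indicator {q i<..q (Suc i)} s))\<^sup>2) \<in> borel_measurable (M \<Otimes>\<^sub>M lborel)"
    proof -
      define K where "K = (\<lambda>x. indicator {0..t} (snd x) * H (snd x) (fst x))"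
      have [measurable]: "K \<in> borel_measurable (M \<Otimes>\<^sub>M lborel)"
        using progressive_jointly_measurable[OF prog t] unfolding K_def by (simp add: split_beta')
      have [measurable]: "(\<lambda>x. \<Sum>i<n. d i (fst x) * indicator {q i<..q (Suc i)} (snd x))
          \<in> borel_measurable (M \<Otimes>\<^sub>M lborel)"
      proof (intro borel_measurable_sum borel_measurable_times)
        fix i assume "i \<in> {..<n}"
        then show "(\<lambda>x. d i (fst x)) \<in> borel_measurable (M \<Otimes>\<^sub>M lborel)"
          using measurable_compose[OF measurable_fst dM] by simp
        show "(\<lambda>x. indicator {q i<..q (Suc i)} (snd x) :: real) \<in> borel_measurable (M \<Otimes>\<^sub>M lborel)"
          by measurable
      qed
      have "(\<lambda>x. indicator {0..t} (snd x) * (c' (snd x) * K x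
          - (\<Sum>i<n. d i (fst x) * indicator {q i<..q (Suc i)} (snd x)))\<^sup>2) \<in> borel_measurable (M \<Otimes>\<^sub>M lborel)"
        unfolding c'_def by measurable
      then show ?thesis by (simp add: K_def split_beta')
    qed
    then have "(\<lambda>\<omega>. \<integral>s. indicator {0..t} s * (c' s * (indicator {0..t} s * H s \<omega>)
        - (\<Sum>i<n. d i \<omega> * indicator {q i<..q (Suc i)} s))\<^sup>2 \<partial>lborel) \<in> borel_measurable M"
      by (rule lborel.borel_measurable_lebesgue_integral)
    also have "(\<lambda>\<omega>. \<integral>s. indicator {0..t} s * (c' s * (indicator {0..t} s * H s \<omega>)
        - (\<Sum>i<n. d i \<omega> * indicator {q i<..q (Suc i)} s))\<^sup>2 \<partial>lborel) = R"
      unfolding R_def set_lebesgue_integral_def d'_def step_fun_def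
      by (intro ext Bochner_Integration.integral_cong) (auto simp: indicator_def)
    finally show ?thesis .
  qed
  have step: "prob {\<omega> \<in> space M. \<bar>P' \<omega> - D \<omega>\<bar> > 2 * \<epsilon>}
      \<le> (prob {\<omega> \<in> space M. \<bar>P m \<omega> - P' \<omega>\<bar> > \<epsilon>} + prob {\<omega> \<in> space M. \<bar>R' m \<omega> - 0\<bar> > \<delta> / (4 * C\<^sup>2)})
        + (\<delta> / \<epsilon>\<^sup>2 + prob {\<omega> \<in> space M. R \<omega> > \<delta> / 4})" for m
  proof -
    have "prob {\<omega> \<in> space M. \<bar>P' \<omega> - D \<omega>\<bar> > 2 * \<epsilon>}
        \<le> prob {\<omega> \<in> space M. \<bar>P m \<omega> - P' \<omega>\<bar> > \<epsilon>} + prob {\<omega> \<in> space M. \<bar>P m \<omega> - D \<omega>\<bar> > \<epsilon>}"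
    proof (rule prob_le_add[OF AE_I2])
      fix \<omega>
      show "2 * \<epsilon> < \<bar>P' \<omega> - D \<omega>\<bar> \<longrightarrow> \<epsilon> < \<bar>P m \<omega> - P' \<omega>\<bar> \<or> \<epsilon> < \<bar>P m \<omega> - D \<omega>\<bar>" by argo
    qed measurable
    also have "prob {\<omega> \<in> space M. \<bar>P m \<omega> - D \<omega>\<bar> > \<epsilon>}
        \<le> \<delta> / \<epsilon>\<^sup>2 + prob {\<omega> \<in> space M. (LBINT s:{0..t}. (c' s * h m s \<omega> - d' \<omega> s)\<^sup>2) > \<delta>}"
      unfolding P_def D_def c'_def d'_def using pos
      by (intro simple_lenglart[OF simple q d]) auto
    also have "prob {\<omega> \<in> space M. (LBINT s:{0..t}. (c' s * h m s \<omega> - d' \<omega> s)\<^sup>2) > \<delta>}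
        \<le> prob {\<omega> \<in> space M. \<bar>R' m \<omega> - 0\<bar> > \<delta> / (4 * C\<^sup>2)} + prob {\<omega> \<in> space M. R \<omega> > \<delta> / 4}"
    proof (rule prob_le_add)
      show "AE \<omega> in M. \<delta> < (LBINT s:{0..t}. (c' s * h m s \<omega> - d' \<omega> s)\<^sup>2) \<longrightarrow>
          \<delta> / (4 * C\<^sup>2) < \<bar>R' m \<omega> - 0\<bar> \<or> \<delta> / 4 < R \<omega>"
        using sq AE_space
      proof eventually_elim
        case (elim \<omega>)
        obtain N \<tau> \<xi> where hm: "(\<lambda>s. h m s \<omega>) = step_fun N \<tau> \<xi>"
        proof -
          obtain N \<tau> \<xi> where "h m = (\<lambda>s \<omega>. \<Sum>i<N. \<xi> i \<omega> * indicator {\<tau> i<..\<tau> (Suc i)} s)"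
            using simple[of m] unfolding has_simple_ito_integral_def by blast
          then have "(\<lambda>s. h m s \<omega>) = step_fun N \<tau> (\<lambda>i. \<xi> i \<omega>)" by (auto simp: step_fun_def)
          then show ?thesis using that by blast
        qed
        have sqH: "square_integrable_on {0..t} (\<lambda>s. H s \<omega>)"
          unfolding square_integrable_on_def
          using elim t progressive_section_measurable[OF prog t] by blast
        have sqh: "square_integrable_on {0..t} (\<lambda>s. h m s \<omega>)" unfolding hm by (rule square_integrable_on_step_fun)
        have c'm: "c' \<in> borel_measurable borel" unfolding c'_def by measurable
        have sqc: "square_integrable_on {0..t} (\<lambda>s. c' s * f s)" if "square_integrable_on {0..t} f" for f
          using square_integrable_on_mult_bounded[OF that c'm C(2)] by blast
        have sqd: "square_integrable_on {0..t} (d' \<omega>)" unfolding d'_def by (rule square_integrable_on_step_fun)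
        have "(LBINT s:{0..t}. (c' s * h m s \<omega> - d' \<omega> s)\<^sup>2)
            \<le> 2 * (LBINT s:{0..t}. (C * (h m s \<omega> - H s \<omega>))\<^sup>2) + 2 * R \<omega>"
          unfolding R_def
        proof (rule set_integral_square_le)
          fix s
          have "c' s * h m s \<omega> - d' \<omega> s = c' s * (h m s \<omega> - H s \<omega>) + (c' s * H s \<omega> - d' \<omega> s)"
            by (simp add: algebra_simps)
          moreover have "\<bar>c' s * (h m s \<omega> - H s \<omega>)\<bar> \<le> \<bar>C * (h m s \<omega> - H s \<omega>)\<bar>"
            using C by (simp add: abs_mult mult_right_mono)
          ultimately show "\<bar>c' s * h m s \<omega> - d' \<omega> s\<bar> \<le> \<bar>C * (h m s \<omega> - H s \<omega>)\<bar> + \<bar>c' s * H s \<omega> - d' \<omega> s\<bar>"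
            by linarith
        qed (intro square_integrable_on_diff square_integrable_on_cmult sqc sqh sqH sqd)+
        also have "(LBINT s:{0..t}. (C * (h m s \<omega> - H s \<omega>))\<^sup>2) = C\<^sup>2 * R' m \<omega>"
          unfolding R'_def by (simp add: power_mult_distrib)
        finally have le: "(LBINT s:{0..t}. (c' s * h m s \<omega> - d' \<omega> s)\<^sup>2) \<le> 2 * (C\<^sup>2 * R' m \<omega>) + 2 * R \<omega>" .
        show ?case
        proof (intro impI)
          assume "\<delta> < (LBINT s:{0..t}. (c' s * h m s \<omega> - d' \<omega> s)\<^sup>2)"
          then have "\<delta> / 4 < C\<^sup>2 * R' m \<omega> \<or> \<delta> / 4 < R \<omega>" using le by argo
          moreover have "\<delta> / (4 * C\<^sup>2) < R' m \<omega>" if "\<delta> / 4 < C\<^sup>2 * R' m \<omega>"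
            using that C(1) by (simp add: field_simps)
          ultimately show "\<delta> / (4 * C\<^sup>2) < \<bar>R' m \<omega> - 0\<bar> \<or> \<delta> / 4 < R \<omega>" by auto
        qed
      qed
    qed measurable
    finally show ?thesis by simp
  qed
  have "(\<lambda>m. (prob {\<omega> \<in> space M. \<bar>P m \<omega> - P' \<omega>\<bar> > \<epsilon>} + prob {\<omega> \<in> space M. \<bar>R' m \<omega> - 0\<bar> > \<delta> / (4 * C\<^sup>2)})
        + (\<delta> / \<epsilon>\<^sup>2 + prob {\<omega> \<in> space M. R \<omega> > \<delta> / 4}))
      \<longlonglongrightarrow> (0 + 0) + (\<delta> / \<epsilon>\<^sup>2 + prob {\<omega> \<in> space M. R \<omega> > \<delta> / 4})"
    using Plim hlim pos C(1) unfolding tendsto_in_probability_def R'_def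
    by (intro tendsto_add tendsto_const) auto
  from LIMSEQ_le_const[OF this] step
  have "prob {\<omega> \<in> space M. \<bar>P' \<omega> - D \<omega>\<bar> > 2 * \<epsilon>} \<le> \<delta> / \<epsilon>\<^sup>2 + prob {\<omega> \<in> space M. R \<omega> > \<delta> / 4}" by auto
  then show ?thesis unfolding P'_def D_def R_def c'_def d'_def .
qed

end

section \<open>Normal sums of signed increments\<close>

context wiener_space
begin

text \<open>A centred normal increment keeps its law and its independence of the past when it is multiplied
  by a sign that belongs to the past.\<close>

lemma signed_increment:
  assumes h: "s \<in> horizon T" "t \<in> horizon T" "s < t"
    and U: "U \<in> borel_measurable (F s)" "\<And>\<omega>. \<omega> \<in> space M \<Longrightarrow> U \<omega> = 1 \<or> U \<omega> = -1"
  shows "distributed M lborel (\<lambda>\<omega>. U \<omega> * (B t \<omega> - B s \<omega>)) (normal_density 0 (sqrt (t - s)))"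
    and "indep_set (sets (F s)) {(\<lambda>\<omega>. U \<omega> * (B t \<omega> - B s \<omega>)) -` A \<inter> space M | A. A \<in> sets borel}"
proof -
  define D where "D = (\<lambda>\<omega>. B t \<omega> - B s \<omega>)"
  note dist = wiener_increment[OF h, folded D_def]
  have ind: "prob (a \<inter> (D -` A \<inter> space M)) = prob a * prob (D -` A \<inter> space M)"
    if "a \<in> sets (F s)" "A \<in> sets borel" for a A
    using indep_setD[OF wiener_indep[OF h] that(1)] that(2) unfolding D_def by blast
  have sub: "sets (F s) \<subseteq> events" and sp: "space (F s) = space M"
    using subalgebra_F[OF h(1)] by (auto simp: subalgebra_def)
  have [measurable]: "U \<in> borel_measurable M" using U(1) h measurable_F_M by blast
  have D [measurable]: "D \<in> borel_measurable M" using dist by (auto simp: distributed_def)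
  have "distributed M lborel (\<lambda>\<omega>. 0 + (-1) * D \<omega>) (normal_density (0 + (-1) * 0) (\<bar>-1\<bar> * sqrt (t - s)))"
    using h by (intro normal_density_affine[OF dist]) auto
  then have "distributed M lborel (\<lambda>\<omega>. - D \<omega>) (normal_density 0 (sqrt (t - s)))" by simp
  then have "distr M lborel (\<lambda>\<omega>. - D \<omega>) = distr M lborel D"
    using dist by (simp add: distributed_def)
  then have symm: "prob ((\<lambda>\<omega>. - D \<omega>) -` A \<inter> space M) = prob (D -` A \<inter> space M)" if "A \<in> sets borel" for A
    using that measure_distr[of D M lborel A] measure_distr[of "\<lambda>\<omega>. - D \<omega>" M lborel A] by simp
  have key: "prob (a \<inter> ((\<lambda>\<omega>. U \<omega> * D \<omega>) -` A \<inter> space M)) = prob a * prob (D -` A \<inter> space M)"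
    if a: "a \<in> sets (F s)" and A: "A \<in> sets borel" for a A
  proof -
    define P where "P = {\<omega> \<in> space M. U \<omega> = 1}"
    have "U -` {1} \<inter> space (F s) \<in> sets (F s)" using U(1) by (rule measurable_sets) simp
    then have P: "P \<in> sets (F s)" by (simp add: P_def sp vimage_def Int_def conj_commute)
    define A' where "A' = uminus -` A"
    have A': "A' \<in> sets borel" using measurable_sets[of uminus borel borel A] A by (simp add: A'_def)
    have mem: "a \<inter> P \<in> sets (F s)" "a - P \<in> sets (F s)" using a P by auto
    have "a \<subseteq> space M" using a sub sets.sets_into_space by blast
    then have split: "a \<inter> ((\<lambda>\<omega>. U \<omega> * D \<omega>) -` A \<inter> space M)
        = ((a \<inter> P) \<inter> (D -` A \<inter> space M)) \<union> ((a - P) \<inter> (D -` A' \<inter> space M))"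
    proof (intro set_eqI)
      fix \<omega>
      show "\<omega> \<in> a \<inter> ((\<lambda>\<omega>. U \<omega> * D \<omega>) -` A \<inter> space M) \<longleftrightarrow>
          \<omega> \<in> ((a \<inter> P) \<inter> (D -` A \<inter> space M)) \<union> ((a - P) \<inter> (D -` A' \<inter> space M))"
        using U(2)[of \<omega>] by (cases "\<omega> \<in> space M"; cases "U \<omega> = 1") (auto simp: P_def A'_def)
    qed
    have sets: "D -` A \<inter> space M \<in> events" "D -` A' \<inter> space M \<in> events"
      using measurable_sets[OF D] A A' by auto
    have "prob (a \<inter> ((\<lambda>\<omega>. U \<omega> * D \<omega>) -` A \<inter> space M))
        = prob ((a \<inter> P) \<inter> (D -` A \<inter> space M)) + prob ((a - P) \<inter> (D -` A' \<inter> space M))"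
      unfolding split using mem sub sets by (intro finite_measure_Union) auto
    also have "\<dots> = prob (a \<inter> P) * prob (D -` A \<inter> space M) + prob (a - P) * prob (D -` A \<inter> space M)"
      using ind[OF mem(1) A] ind[OF mem(2) A'] symm[OF A]
      by (simp add: A'_def vimage_def)
    also have "prob (a \<inter> P) + prob (a - P) = prob a"
    proof -
      have "a \<inter> P \<union> (a - P) = a" "(a \<inter> P) \<inter> (a - P) = {}" by blast+
      then show ?thesis using finite_measure_Union[of "a \<inter> P" "a - P"] mem sub by (simp add: subset_eq)
    qed
    then have "prob (a \<inter> P) * prob (D -` A \<inter> space M) + prob (a - P) * prob (D -` A \<inter> space M)
        = prob a * prob (D -` A \<inter> space M)"
      by (simp flip: distrib_right)
    finally show ?thesis .
  qed
  have spF: "space M \<in> sets (F s)" using sets.top[of "F s"] sp by simp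
  have eq: "prob ((\<lambda>\<omega>. U \<omega> * D \<omega>) -` A \<inter> space M) = prob (D -` A \<inter> space M)" if "A \<in> sets borel" for A
    using key[OF spF that] by (simp add: prob_space Int_left_absorb Int_commute inf.left_idem)
  have "distr M lborel (\<lambda>\<omega>. U \<omega> * D \<omega>) = distr M lborel D"
  proof (rule measure_eqI)
    fix A assume "A \<in> sets (distr M lborel (\<lambda>\<omega>. U \<omega> * D \<omega>))"
    then show "emeasure (distr M lborel (\<lambda>\<omega>. U \<omega> * D \<omega>)) A = emeasure (distr M lborel D) A"
      using eq[of A] by (simp add: emeasure_distr emeasure_eq_measure)
  qed simp
  then have "distributed M lborel (\<lambda>\<omega>. U \<omega> * D \<omega>) (normal_density 0 (sqrt (t - s)))"
    using dist unfolding distributed_def by simp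
  then show "distributed M lborel (\<lambda>\<omega>. U \<omega> * (B t \<omega> - B s \<omega>)) (normal_density 0 (sqrt (t - s)))"
    by (simp add: D_def)
  have "indep_set (sets (F s)) {(\<lambda>\<omega>. U \<omega> * D \<omega>) -` A \<inter> space M | A. A \<in> sets borel}"
    unfolding indep_sets2_eq
  proof (intro conjI ballI)
    show "{(\<lambda>\<omega>. U \<omega> * D \<omega>) -` A \<inter> space M | A. A \<in> sets borel} \<subseteq> events"
      by (auto intro!: measurable_sets[of _ M borel])
  qed (use sub key eq in auto)
  then show "indep_set (sets (F s)) {(\<lambda>\<omega>. U \<omega> * (B t \<omega> - B s \<omega>)) -` A \<inter> space M | A. A \<in> sets borel}"
    by (simp add: D_def)
qed

text \<open>Each partial sum is known at the start of the next cell and is therefore independent of the next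
  signed increment. Nonzero coefficients give every partial sum a positive variance, so that it has
  a density.\<close>

lemma signed_increment_sum_normal:
  assumes p: "\<And>k. k < n \<Longrightarrow> p k < p (Suc k)" "\<And>k. k \<le> n \<Longrightarrow> p k \<in> horizon T" and n: "0 < n"
    and c: "\<And>k. k < n \<Longrightarrow> c k \<noteq> 0"
    and U: "U \<in> borel_measurable (F (p 0))" "\<And>\<omega>. \<omega> \<in> space M \<Longrightarrow> U \<omega> = 1 \<or> U \<omega> = -1"
  shows "distributed M lborel (\<lambda>\<omega>. U \<omega> * increment_sum n p c (\<lambda>s. B s \<omega>))
    (normal_density 0 (sqrt (\<Sum>k<n. (c k)\<^sup>2 * (p (Suc k) - p k))))"
proof -
  have scaled: "distributed M lborel (\<lambda>\<omega>. c k * (U \<omega> * (B (p (Suc k)) \<omega> - B (p k) \<omega>)))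
        (normal_density 0 (sqrt ((c k)\<^sup>2 * (p (Suc k) - p k))))"
    and scaled_indep: "indep_var borel Z borel (\<lambda>\<omega>. c k * (U \<omega> * (B (p (Suc k)) \<omega> - B (p k) \<omega>)))"
    if k: "k < n" and Z: "Z \<in> borel_measurable (F (p k))" for k Z
  proof -
    have h: "p k \<in> horizon T" "p (Suc k) \<in> horizon T" "p k < p (Suc k)" using p k by auto
    have "p 0 \<le> p k" by (rule grid_mono[of n p 0 k]) (use k p in \<open>auto intro: less_imp_le\<close>)
    then have Uk: "U \<in> borel_measurable (F (p k))"
      using U(1) h p(2)[of 0] measurable_F_mono by blast
    note si = signed_increment[OF h Uk U(2)]
    have "distributed M lborel (\<lambda>\<omega>. 0 + c k * (U \<omega> * (B (p (Suc k)) \<omega> - B (p k) \<omega>)))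
        (normal_density (0 + c k * 0) (\<bar>c k\<bar> * sqrt (p (Suc k) - p k)))"
      using h c[OF k] by (intro normal_density_affine[OF si(1)]) auto
    then show "distributed M lborel (\<lambda>\<omega>. c k * (U \<omega> * (B (p (Suc k)) \<omega> - B (p k) \<omega>)))
        (normal_density 0 (sqrt ((c k)\<^sup>2 * (p (Suc k) - p k))))"
      by (simp add: real_sqrt_mult)
    have D: "(\<lambda>\<omega>. U \<omega> * (B (p (Suc k)) \<omega> - B (p k) \<omega>)) \<in> borel_measurable M"
      using si(1) by (auto simp: distributed_def)
    have "indep_var borel Z borel (\<lambda>\<omega>. U \<omega> * (B (p (Suc k)) \<omega> - B (p k) \<omega>))"
      by (rule indep_var_past[OF h(1) Z D si(2)])
    from indep_var_compose[OF this, of "\<lambda>x. x" borel "\<lambda>x. c k * x" borel]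
    show "indep_var borel Z borel (\<lambda>\<omega>. c k * (U \<omega> * (B (p (Suc k)) \<omega> - B (p k) \<omega>)))"
      by (simp add: comp_def)
  qed
  define S where "S m = (\<lambda>\<omega>. increment_sum m p (\<lambda>k. c k * U \<omega>) (\<lambda>s. B s \<omega>))" for m
  have S: "S m \<in> borel_measurable (F (p m))" if "m \<le> n" for m
    unfolding S_def
  proof (rule increment_sum_measurable[where \<zeta> = "\<lambda>k \<omega>. c k * U \<omega>"])
    fix k assume k: "k < m"
    have "p 0 \<le> p k" by (rule grid_mono[of n p 0 k]) (use k that p in \<open>auto intro: less_imp_le\<close>)
    then have "U \<in> borel_measurable (F (p k))"
      using U(1) p(2)[of k] p(2)[of 0] k that measurable_F_mono by (meson le_trans less_imp_le zero_le)
    then show "(\<lambda>\<omega>. c k * U \<omega>) \<in> borel_measurable (F (p k))" by (intro borel_measurable_times) auto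
  qed (use that p in \<open>auto intro: less_imp_le\<close>)
  have "distributed M lborel (S (Suc m)) (normal_density 0 (sqrt (\<Sum>k<Suc m. (c k)\<^sup>2 * (p (Suc k) - p k))))"
    if "Suc m \<le> n" for m
    using that
  proof (induction m)
    case 0
    then show ?case using scaled[of 0 U] U(1) by (simp add: S_def increment_sum_def mult.assoc)
  next
    case (Suc m)
    define V where "V m = (\<Sum>k<m. (c k)\<^sup>2 * (p (Suc k) - p k))" for m
    define E where "E = (\<lambda>\<omega>. c (Suc m) * (U \<omega> * (B (p (Suc (Suc m))) \<omega> - B (p (Suc m)) \<omega>)))"
    have pos: "0 < (c k)\<^sup>2 * (p (Suc k) - p k)" if "k < n" for k
      using c[OF that] p(1)[OF that] by simp
    have V: "0 < V (Suc m)"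
      unfolding V_def using Suc.prems pos by (intro sum_pos) auto
    have i: "indep_var borel (S (Suc m)) borel E"
      unfolding E_def using Suc.prems S by (intro scaled_indep) auto
    have "distributed M lborel (\<lambda>\<omega>. S (Suc m) \<omega> + E \<omega>) (normal_density (0 + 0)
        (sqrt ((sqrt (V (Suc m)))\<^sup>2 + (sqrt ((c (Suc m))\<^sup>2 * (p (Suc (Suc m)) - p (Suc m))))\<^sup>2)))"
    proof (rule add_indep_normal[OF i])
      show "0 < sqrt (V (Suc m))" using V by simp
      show "0 < sqrt ((c (Suc m))\<^sup>2 * (p (Suc (Suc m)) - p (Suc m)))" using pos[of "Suc m"] Suc.prems by simp
      show "distributed M lborel (S (Suc m)) (normal_density 0 (sqrt (V (Suc m))))"
        using Suc by (simp add: V_def)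
      show "distributed M lborel E (normal_density 0 (sqrt ((c (Suc m))\<^sup>2 * (p (Suc (Suc m)) - p (Suc m)))))"
        unfolding E_def using Suc.prems S[of "Suc m"] by (intro scaled) auto
    qed
    also have "(\<lambda>\<omega>. S (Suc m) \<omega> + E \<omega>) = S (Suc (Suc m))"
      by (simp add: S_def E_def increment_sum_def fun_eq_iff mult.assoc)
    also have "(sqrt (V (Suc m)))\<^sup>2 + (sqrt ((c (Suc m))\<^sup>2 * (p (Suc (Suc m)) - p (Suc m))))\<^sup>2 = V (Suc (Suc m))"
      using V pos[of "Suc m"] Suc.prems by (simp add: V_def)
    finally show ?case by (simp add: V_def)
  qed
  from this[of "n - 1"] n
  have "distributed M lborel (S n) (normal_density 0 (sqrt (\<Sum>k<n. (c k)\<^sup>2 * (p (Suc k) - p k))))" by simp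
  also have "S n = (\<lambda>\<omega>. U \<omega> * increment_sum n p c (\<lambda>s. B s \<omega>))"
    by (simp add: S_def increment_sum_def sum_distrib_left mult.assoc mult.left_commute fun_eq_iff)
  finally show ?thesis .
qed

lemma normal_second_moment:
  assumes "distributed M lborel D (normal_density 0 (sqrt v))" "0 < v"
  shows "integrable M (\<lambda>\<omega>. (D \<omega>)\<^sup>2)" "expectation (\<lambda>\<omega>. (D \<omega>)\<^sup>2) = v"
  using distributed_integrable[OF assms(1), of "\<lambda>x. x\<^sup>2"] integrable_normal_moment[of "sqrt v" 0 2]
    distributed_integral[OF assms(1), of "\<lambda>x. x\<^sup>2"] integral_normal_moment_even[of "sqrt v" 0 1] assms(2)
  by simp_all

text \<open>The density of a centred normal law with variance \<open>v\<close> is at most \<open>1 / sqrt v\<close>.\<close>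

lemma normal_small_ball:
  assumes D: "distributed M lborel D (normal_density 0 (sqrt v))" and v: "0 < v" and \<eta>: "0 \<le> \<eta>"
  shows "prob {\<omega> \<in> space M. \<bar>D \<omega>\<bar> \<le> \<eta>} \<le> 2 * \<eta> / sqrt v"
proof -
  have "{\<omega> \<in> space M. \<bar>D \<omega>\<bar> \<le> \<eta>} = D -` {-\<eta>..\<eta>} \<inter> space M" by auto
  then have "emeasure M {\<omega> \<in> space M. \<bar>D \<omega>\<bar> \<le> \<eta>}
      = (\<integral>\<^sup>+x. ennreal (normal_density 0 (sqrt v) x) * indicator {-\<eta>..\<eta>} x \<partial>lborel)"
    using distributed_emeasure[OF D, of "{-\<eta>..\<eta>}"] by simp
  also have "\<dots> \<le> (\<integral>\<^sup>+x. ennreal (1 / sqrt v) * indicator {-\<eta>..\<eta>} x \<partial>lborel)"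
  proof (intro nn_integral_mono mult_right_mono ennreal_leI)
    fix x :: real
    have "1 * 1 \<le> 2 * pi" using pi_ge_two by (intro mult_mono) auto
    then have "sqrt v \<le> sqrt (2 * pi * v)" using v by (intro real_sqrt_le_mono) simp
    then have "1 / sqrt (2 * pi * v) \<le> 1 / sqrt v" using v by (intro divide_left_mono) auto
    moreover have "exp (- x\<^sup>2 / (2 * v)) \<le> 1" using v by simp
    ultimately have "1 / sqrt (2 * pi * v) * exp (- x\<^sup>2 / (2 * v)) \<le> 1 / sqrt v * 1"
      using v by (intro mult_mono) auto
    then show "normal_density 0 (sqrt v) x \<le> 1 / sqrt v" using v by (simp add: normal_density_def)
  qed simp
  also have "\<dots> = ennreal (1 / sqrt v) * emeasure lborel {-\<eta>..\<eta>}" by (simp add: nn_integral_cmult)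
  also have "\<dots> = ennreal (2 * \<eta> / sqrt v)" using \<eta> v by (simp add: ennreal_mult[symmetric])
  finally show ?thesis using \<eta> v by (simp add: emeasure_eq_measure ennreal_le_iff)
qed

end

section \<open>Riemann sums and integrating factors\<close>

definition uniform_grid :: "real \<Rightarrow> real \<Rightarrow> nat \<Rightarrow> nat \<Rightarrow> real" where
  "uniform_grid a t n i = a + (t - a) * (real i / real n)"

lemma uniform_grid_0 [simp]: "uniform_grid a t n 0 = a"
  by (simp add: uniform_grid_def)

lemma uniform_grid_end [simp]: "0 < n \<Longrightarrow> uniform_grid a t n n = t"
  by (simp add: uniform_grid_def)

lemma uniform_grid_cell: "uniform_grid a t n (Suc i) - uniform_grid a t n i = (t - a) / real n"
  by (simp add: uniform_grid_def field_simps add_divide_distrib)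

lemma uniform_grid_less:
  assumes "a < t" "0 < n"
  shows "uniform_grid a t n i < uniform_grid a t n (Suc i)"
proof -
  have "0 < (t - a) / real n" using assms by simp
  then show ?thesis using uniform_grid_cell[of a t n i] by linarith
qed

lemma uniform_grid_range:
  assumes "a < t" "0 < n" "i \<le> n"
  shows "a \<le> uniform_grid a t n i" "uniform_grid a t n i \<le> t"
proof -
  have "0 \<le> real i / real n" "real i / real n \<le> 1" using assms by auto
  then have "(t - a) * (real i / real n) \<le> (t - a) * 1" "0 \<le> (t - a) * (real i / real n)"
    using assms by (intro mult_left_mono mult_nonneg_nonneg; simp)+
  then show "a \<le> uniform_grid a t n i" "uniform_grid a t n i \<le> t"
    by (auto simp: uniform_grid_def)
qed

lemma uniform_grid_oscillation:
  fixes f :: "real \<Rightarrow> real"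
  assumes f: "continuous_on {a..t} f" and "a < t" "0 < \<epsilon>"
  shows "\<forall>\<^sub>F n in sequentially. 0 < n \<and> (\<forall>i<n. \<forall>r\<in>{uniform_grid a t n i..uniform_grid a t n (Suc i)}.
    \<forall>s\<in>{uniform_grid a t n i..uniform_grid a t n (Suc i)}. \<bar>f r - f s\<bar> \<le> \<epsilon>)"
proof -
  have "uniformly_continuous_on {a..t} f" using f by (intro compact_uniformly_continuous) auto
  then obtain d where d: "0 < d" "\<And>x y. x \<in> {a..t} \<Longrightarrow> y \<in> {a..t} \<Longrightarrow> dist y x < d \<Longrightarrow> dist (f y) (f x) < \<epsilon>"
    using \<open>0 < \<epsilon>\<close> unfolding uniformly_continuous_on_def by metis
  have "(\<lambda>n. (t - a) / real n) \<longlonglongrightarrow> 0" by real_asymp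
  then have "\<forall>\<^sub>F n in sequentially. (t - a) / real n < d" using d(1) by (rule order_tendstoD)
  then show ?thesis using eventually_gt_at_top[of 0]
  proof eventually_elim
    case (elim n)
    show ?case
    proof (intro conjI allI impI ballI)
      show "0 < n" by fact
      fix i r s assume i: "i < n"
        and rs: "r \<in> {uniform_grid a t n i..uniform_grid a t n (Suc i)}"
          "s \<in> {uniform_grid a t n i..uniform_grid a t n (Suc i)}"
      have "a \<le> uniform_grid a t n i" "uniform_grid a t n (Suc i) \<le> t"
        using uniform_grid_range[of a t n] i elim \<open>a < t\<close> by auto
      then have "r \<in> {a..t}" "s \<in> {a..t}" using rs by auto
      moreover have "\<bar>r - s\<bar> \<le> (t - a) / real n"
        using rs uniform_grid_cell[of a t n i] by (auto simp: abs_le_iff)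
      then have "dist r s < d" using elim(1) by (simp add: dist_real_def)
      ultimately have "dist (f r) (f s) < \<epsilon>" by (intro d(2))
      then show "\<bar>f r - f s\<bar> \<le> \<epsilon>" by (simp add: dist_real_def)
    qed
  qed
qed

lemma set_integral_combine:
  fixes f :: "real \<Rightarrow> real"
  assumes "a \<le> b" "b \<le> c" "set_integrable lborel {a..c} f"
  shows "(LBINT s:{a..c}. f s) = (LBINT s:{a..b}. f s) + (LBINT s:{b..c}. f s)"
proof -
  have "set_integrable lborel {a..b} f" "set_integrable lborel {b..c} f"
    using assms by (auto intro: set_integrable_subset)
  moreover have "AE s in lborel. \<not> (s \<in> {a..b} \<and> s \<in> {b..c})"
    using AE_lborel_singleton[of b] by eventually_elim auto
  moreover have "{a..c} = {a..b} \<union> {b..c}" using assms by auto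
  ultimately show ?thesis by (simp add: set_integral_Un_AE)
qed

lemma step_fun_uniform_approx:
  assumes osc: "\<forall>i<n. \<forall>r\<in>{q i..q (Suc i)}. \<forall>s\<in>{q i..q (Suc i)}. \<bar>f r - f s\<bar> \<le> \<epsilon>"
    and q: "\<And>i. i < n \<Longrightarrow> q i \<le> q (Suc i)" and s: "q 0 < s" "s \<le> q n"
  shows "\<bar>f s - step_fun n q (\<lambda>i. f (q i)) s\<bar> \<le> \<epsilon>"
proof (rule step_fun_cases[of n q s])
  fix k assume k: "k < n" "q k < s" "s \<le> q (Suc k)" "\<And>c. step_fun n q c s = c k"
  then show ?thesis using osc q[of k] by auto
next
  assume out: "\<And>i. i < n \<Longrightarrow> s \<notin> {q i<..q (Suc i)}" "\<And>c. step_fun n q c s = 0"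
  have "(1::real) * indicator {q 0<..q n} s = 0"
    using step_fun_const[of n q 1 s] q out(2) by simp
  then show ?thesis using s by simp
qed (use q in auto)

lemma riemann_sum_tendsto:
  fixes f :: "real \<Rightarrow> real"
  assumes f: "continuous_on {a..t} f" and at: "a < t"
  shows "(\<lambda>n. \<Sum>i<n. f (uniform_grid a t n i) * (uniform_grid a t n (Suc i) - uniform_grid a t n i))
    \<longlonglongrightarrow> (LBINT s:{a..t}. f s)"
proof (rule LIMSEQ_I)
  fix r :: real assume "0 < r"
  define \<epsilon> where "\<epsilon> = r / (2 * (t - a))"
  have "\<epsilon> * (t - a) = r / 2" using at by (simp add: \<epsilon>_def field_simps)
  moreover have "0 < \<epsilon>" using \<open>0 < r\<close> at by (simp add: \<epsilon>_def)
  ultimately have \<epsilon>: "0 < \<epsilon>" "\<epsilon> * (t - a) < r" using \<open>0 < r\<close> by linarith+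
  have fi: "set_integrable lborel {a..t} f" using f by (rule borel_integrable_atLeastAtMost')
  from uniform_grid_oscillation[OF f at \<epsilon>(1)] obtain n0 where
    n0: "\<And>n. n0 \<le> n \<Longrightarrow> 0 < n \<and> (\<forall>i<n. \<forall>r\<in>{uniform_grid a t n i..uniform_grid a t n (Suc i)}.
    \<forall>s\<in>{uniform_grid a t n i..uniform_grid a t n (Suc i)}. \<bar>f r - f s\<bar> \<le> \<epsilon>)"
    unfolding eventually_sequentially by blast
  show "\<exists>n0. \<forall>n\<ge>n0. norm ((\<Sum>i<n. f (uniform_grid a t n i)
      * (uniform_grid a t n (Suc i) - uniform_grid a t n i)) - (LBINT s:{a..t}. f s)) < r"
  proof (intro exI allI impI)
    fix n assume n: "n0 \<le> n"
    define q where "q = uniform_grid a t n"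
    have pos: "0 < n" using n0[OF n] by blast
    have q: "q i \<le> q (Suc i)" for i
      unfolding q_def by (rule less_imp_le[OF uniform_grid_less[OF at pos]])
    have q0: "q 0 = a" "q n = t" using pos by (auto simp: q_def)
    define \<phi> where "\<phi> = step_fun n q (\<lambda>i. f (q i))"
    have \<phi>i: "set_integrable lborel {a..t} \<phi>"
      unfolding \<phi>_def set_integrable_def
      by (intro integrable_mult_indicator integrable_step_fun) auto
    have "(\<Sum>i<n. f (q i) * (q (Suc i) - q i)) = (LBINT s:{a..t}. \<phi> s)"
      unfolding \<phi>_def using q q0 by (subst set_integral_step_fun) auto
    then have "(\<Sum>i<n. f (q i) * (q (Suc i) - q i)) - (LBINT s:{a..t}. f s) = (LBINT s:{a..t}. \<phi> s - f s)"
      using fi \<phi>i by (simp add: set_integral_diff)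
    also have "\<bar>\<dots>\<bar> \<le> (LBINT s:{a..t}. \<epsilon>)"
    proof -
      have "\<bar>LBINT s:{a..t}. \<phi> s - f s\<bar> \<le> (LBINT s:{a..t}. \<bar>\<phi> s - f s\<bar>)"
        using set_integral_norm_bound[of lborel "{a..t}" "\<lambda>s. \<phi> s - f s"] fi \<phi>i
        by (auto simp: set_integral_diff)
      also have "\<dots> \<le> (LBINT s:{a..t}. \<epsilon>)"
      proof (rule set_integral_mono_AE)
        show "AE s\<in>{a..t} in lborel. \<bar>\<phi> s - f s\<bar> \<le> \<epsilon>"
          using AE_lborel_singleton[of a]
        proof eventually_elim
          case (elim s)
          then show ?case
            using step_fun_uniform_approx[of n q f \<epsilon> s] n0[OF n] q q0 by (auto simp: \<phi>_def q_def abs_minus_commute)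
        qed
        show "set_integrable lborel {a..t} (\<lambda>s. \<bar>\<phi> s - f s\<bar>)"
          using fi \<phi>i by (intro set_integrable_abs set_integral_diff)
        show "set_integrable lborel {a..t} (\<lambda>s. \<epsilon>)"
          by (rule borel_integrable_atLeastAtMost') auto
      qed
      finally show ?thesis .
    qed
    also have "(LBINT s:{a..t}. \<epsilon>) = \<epsilon> * (t - a)" using at by (simp add: set_lebesgue_integral_def mult.commute)
    finally show "norm ((\<Sum>i<n. f (uniform_grid a t n i)
      * (uniform_grid a t n (Suc i) - uniform_grid a t n i)) - (LBINT s:{a..t}. f s)) < r"
      using \<epsilon>(2) by (simp add: q_def)
  qed
qed

text \<open>Integration by parts along a fixed path: \<open>e\<close> is the integrating factor of \<open>dx = k x dt + dJ\<close>, so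
  \<open>e x\<close> moves only with \<open>J\<close>. On a small cell the drift parts of \<open>e x\<close> cancel up to the oscillation of
  \<open>e\<close> and \<open>x\<close>. As \<open>J\<close> enters through its increments alone, the lemma applies path by path when \<open>J\<close> is a
  stochastic integral.\<close>

lemma integrating_factor_tendsto:
  fixes e k x J :: "real \<Rightarrow> real"
  assumes at: "a < t" and cont: "continuous_on {a..t} e" "continuous_on {a..t} k" "continuous_on {a..t} x"
    and e: "\<And>r u. a \<le> r \<Longrightarrow> r \<le> u \<Longrightarrow> u \<le> t \<Longrightarrow> e u - e r = - (LBINT s:{r..u}. k s * e s)"
    and x: "\<And>r u. a \<le> r \<Longrightarrow> r \<le> u \<Longrightarrow> u \<le> t \<Longrightarrow> x u - x r = (LBINT s:{r..u}. k s * x s) + (J u - J r)"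
  shows "(\<lambda>n. increment_sum n (uniform_grid a t n) (\<lambda>i. e (uniform_grid a t n i)) J)
    \<longlonglongrightarrow> e t * x t - e a * x a"
proof (rule LIMSEQ_I)
  fix r :: real assume "0 < r"
  have "\<exists>C>0. \<forall>s\<in>{a..t}. \<bar>f s\<bar> \<le> C" if "continuous_on {a..t} f" for f :: "real \<Rightarrow> real"
  proof -
    have "bounded (f ` {a..t})" using that by (intro compact_imp_bounded compact_continuous_image) auto
    then show ?thesis unfolding bounded_pos by auto
  qed
  then obtain Ce Ck Cx where C: "0 < Ce" "0 < Ck" "0 < Cx"
    "\<And>s. s \<in> {a..t} \<Longrightarrow> \<bar>e s\<bar> \<le> Ce" "\<And>s. s \<in> {a..t} \<Longrightarrow> \<bar>k s\<bar> \<le> Ck" "\<And>s. s \<in> {a..t} \<Longrightarrow> \<bar>x s\<bar> \<le> Cx"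
    using cont by metis
  define K where "K = Ck * (Cx + Ce) * (t - a)"
  have K: "0 < K" using C at by (simp add: K_def)
  define \<epsilon> where "\<epsilon> = r / (2 * K)"
  have \<epsilon>: "0 < \<epsilon>" "\<epsilon> * K < r" using \<open>0 < r\<close> K by (auto simp: \<epsilon>_def)
  from eventually_conj[OF uniform_grid_oscillation[OF cont(1) at \<epsilon>(1)] uniform_grid_oscillation[OF cont(3) at \<epsilon>(1)]]
  obtain n0 where n0: "\<And>n. n0 \<le> n \<Longrightarrow> 0 < n"
    "\<And>n i r s. n0 \<le> n \<Longrightarrow> i < n \<Longrightarrow> r \<in> {uniform_grid a t n i..uniform_grid a t n (Suc i)}
      \<Longrightarrow> s \<in> {uniform_grid a t n i..uniform_grid a t n (Suc i)} \<Longrightarrow> \<bar>e r - e s\<bar> \<le> \<epsilon>"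
    "\<And>n i r s. n0 \<le> n \<Longrightarrow> i < n \<Longrightarrow> r \<in> {uniform_grid a t n i..uniform_grid a t n (Suc i)}
      \<Longrightarrow> s \<in> {uniform_grid a t n i..uniform_grid a t n (Suc i)} \<Longrightarrow> \<bar>x r - x s\<bar> \<le> \<epsilon>"
    unfolding eventually_sequentially by metis
  show "\<exists>n0. \<forall>n\<ge>n0. norm (increment_sum n (uniform_grid a t n) (\<lambda>i. e (uniform_grid a t n i)) J
      - (e t * x t - e a * x a)) < r"
  proof (intro exI allI impI)
    fix n assume n: "n0 \<le> n"
    define q where "q = uniform_grid a t n"
    have pos: "0 < n" using n0(1)[OF n] .
    have q: "q i \<le> q (Suc i)" for i
      unfolding q_def by (rule less_imp_le[OF uniform_grid_less[OF at pos]])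
    have q0: "q 0 = a" "q n = t" using pos by (auto simp: q_def)
    have range: "a \<le> q i" "q i \<le> t" if "i \<le> n" for i
      using uniform_grid_range[OF at pos that] by (auto simp: q_def)
    have cell: "\<bar>(e (q (Suc i)) * x (q (Suc i)) - e (q i) * x (q i)) - e (q i) * (J (q (Suc i)) - J (q i))\<bar>
        \<le> Ck * (Cx + Ce) * \<epsilon> * (q (Suc i) - q i)" if i: "i < n" for i
    proof -
      define u v where "u = q i" and "v = q (Suc i)"
      have uv: "a \<le> u" "u \<le> v" "v \<le> t" using range[of i] range[of "Suc i"] q i by (auto simp: u_def v_def)
      have ci: "set_integrable lborel {u..v} f" if "continuous_on {a..t} f" for f :: "real \<Rightarrow> real"
        using uv by (intro borel_integrable_atLeastAtMost' continuous_on_subset[OF that]) auto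
      note ii = ci[OF continuous_on_mult[OF cont(2,1)]] ci[OF continuous_on_mult[OF cont(2,3)]]
      have "(e v * x v - e u * x u) - e u * (J v - J u) = e u * (x v - x u - (J v - J u)) + x v * (e v - e u)"
        by (simp add: algebra_simps)
      also have "\<dots> = e u * (LBINT s:{u..v}. k s * x s) - x v * (LBINT s:{u..v}. k s * e s)"
        using e[OF uv] x[OF uv] by simp
      also have "\<dots> = (LBINT s:{u..v}. e u * (k s * x s)) - (LBINT s:{u..v}. x v * (k s * e s))"
        by simp
      also have "\<dots> = (LBINT s:{u..v}. e u * (k s * x s) - x v * (k s * e s))"
        using ii by (intro set_integral_diff(2)[symmetric] set_integrable_mult_right) auto
      also have "\<bar>\<dots>\<bar> \<le> (LBINT s:{u..v}. Ck * (Cx + Ce) * \<epsilon>)"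
      proof -
        have i1: "set_integrable lborel {u..v} (\<lambda>s. e u * (k s * x s) - x v * (k s * e s))"
          using ii by (intro set_integral_diff(1) set_integrable_mult_right) auto
        have "\<bar>LBINT s:{u..v}. e u * (k s * x s) - x v * (k s * e s)\<bar>
            \<le> (LBINT s:{u..v}. \<bar>e u * (k s * x s) - x v * (k s * e s)\<bar>)"
          using set_integral_norm_bound[OF i1] by simp
        also have "\<dots> \<le> (LBINT s:{u..v}. Ck * (Cx + Ce) * \<epsilon>)"
        proof (rule set_integral_mono)
          fix s assume s: "s \<in> {u..v}"
          then have sat: "s \<in> {a..t}" using uv by auto
          have e1: "\<bar>e u - e s\<bar> \<le> \<epsilon>" using n0(2)[OF n i, of u s] s uv by (auto simp: u_def v_def q_def)
          have x1: "\<bar>x s - x v\<bar> \<le> \<epsilon>" using n0(3)[OF n i, of s v] s uv by (auto simp: u_def v_def q_def)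
          have "e u * (k s * x s) - x v * (k s * e s) = k s * ((e u - e s) * x s + e s * (x s - x v))"
            by (simp add: algebra_simps)
          also have "\<bar>\<dots>\<bar> \<le> Ck * (\<epsilon> * Cx + Ce * \<epsilon>)"
            unfolding abs_mult using C sat e1 x1 \<epsilon>(1)
            by (intro mult_mono order_trans[OF abs_triangle_ineq] add_mono)
               (auto simp: abs_mult intro!: mult_mono)
          also have "\<dots> = Ck * (Cx + Ce) * \<epsilon>" by (simp add: algebra_simps)
          finally show "\<bar>e u * (k s * x s) - x v * (k s * e s)\<bar> \<le> Ck * (Cx + Ce) * \<epsilon>" .
        next
          show "set_integrable lborel {u..v} (\<lambda>s. \<bar>e u * (k s * x s) - x v * (k s * e s)\<bar>)"
            using i1 by (rule set_integrable_abs)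
          show "set_integrable lborel {u..v} (\<lambda>s. Ck * (Cx + Ce) * \<epsilon>)"
            by (rule borel_integrable_atLeastAtMost') auto
        qed
        finally show ?thesis .
      qed
      also have "(LBINT s:{u..v}. Ck * (Cx + Ce) * \<epsilon>) = Ck * (Cx + Ce) * \<epsilon> * (v - u)"
        using uv by (simp add: set_lebesgue_integral_def)
      finally show ?thesis by (simp add: u_def v_def)
    qed
    have "e t * x t - e a * x a = (\<Sum>i<n. e (q (Suc i)) * x (q (Suc i)) - e (q i) * x (q i))"
      using q0 sum_lessThan_telescope[of "\<lambda>i. e (q i) * x (q i)" n] by simp
    then have "\<bar>increment_sum n q (\<lambda>i. e (q i)) J - (e t * x t - e a * x a)\<bar>
        = \<bar>\<Sum>i<n. (e (q (Suc i)) * x (q (Suc i)) - e (q i) * x (q i)) - e (q i) * (J (q (Suc i)) - J (q i))\<bar>"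
      by (simp add: increment_sum_def sum_subtractf abs_minus_commute)
    also have "\<dots> \<le> (\<Sum>i<n. Ck * (Cx + Ce) * \<epsilon> * (q (Suc i) - q i))"
      by (rule order_trans[OF sum_abs sum_mono]) (use cell in auto)
    also have "\<dots> = Ck * (Cx + Ce) * \<epsilon> * (t - a)"
      using q0 sum_lessThan_telescope[of q n] by (simp flip: sum_distrib_left)
    also have "\<dots> < r" using \<epsilon>(2) by (simp add: K_def mult_ac)
    finally show "norm (increment_sum n (uniform_grid a t n) (\<lambda>i. e (uniform_grid a t n i)) J
      - (e t * x t - e a * x a)) < r" by (simp add: q_def)
  qed
qed

section \<open>Moments and small balls of limits in probability\<close>

context prob_space
begin

lemma tendsto_in_probability_AE:
  assumes [measurable]: "\<And>n. Y n \<in> borel_measurable M" "Z \<in> borel_measurable M"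
    and lim: "AE \<omega> in M. (\<lambda>n. Y n \<omega>) \<longlonglongrightarrow> Z \<omega>"
  shows "tendsto_in_probability M Y Z"
proof -
  have "(\<lambda>n. prob {\<omega> \<in> space M. \<bar>Y n \<omega> - Z \<omega>\<bar> > \<epsilon>}) \<longlonglongrightarrow> 0" if "\<epsilon> > 0" for \<epsilon> :: real
  proof -
    have "(\<lambda>n. \<integral>\<omega>. indicator {\<omega> \<in> space M. \<bar>Y n \<omega> - Z \<omega>\<bar> > \<epsilon>} \<omega> \<partial>M) \<longlonglongrightarrow> (\<integral>\<omega>. 0 \<partial>M :: real)"
    proof (rule integral_dominated_convergence[where w="\<lambda>_. 1"])
      show "AE \<omega> in M. (\<lambda>n. indicator {\<omega> \<in> space M. \<bar>Y n \<omega> - Z \<omega>\<bar> > \<epsilon>} \<omega>) \<longlonglongrightarrow> (0::real)"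
        using lim
      proof eventually_elim
        case (elim \<omega>)
        have "\<forall>\<^sub>F n in sequentially. dist (Y n \<omega>) (Z \<omega>) < \<epsilon>" using elim that by (rule tendstoD)
        then show ?case
          by (intro tendsto_eventually) (auto elim!: eventually_mono simp: dist_real_def indicator_def)
      qed
    qed (auto simp: indicator_def)
    then show ?thesis by simp
  qed
  then show ?thesis by (simp add: tendsto_in_probability_def)
qed

text \<open>Truncation at level \<open>k\<close> makes the square bounded and Lipschitz, hence compatible with convergence in
  probability; Fatou's lemma then removes the truncation.\<close>

lemma limit_second_moment:
  assumes lim: "tendsto_in_probability M D Z" and v: "v \<longlonglongrightarrow> v'"
    and D: "\<forall>\<^sub>F n in sequentially. integrable M (\<lambda>\<omega>. (D n \<omega>)\<^sup>2) \<and> expectation (\<lambda>\<omega>. (D n \<omega>)\<^sup>2) \<le> v n"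
  shows "integrable M (\<lambda>\<omega>. (Z \<omega>)\<^sup>2)" "expectation (\<lambda>\<omega>. (Z \<omega>)\<^sup>2) \<le> v'"
proof -
  have [measurable]: "D n \<in> borel_measurable M" "Z \<in> borel_measurable M" for n
    using lim by (auto simp: tendsto_in_probability_def)
  have truncated: "expectation (\<lambda>\<omega>. (min \<bar>Z \<omega>\<bar> k)\<^sup>2) \<le> v'" if k: "0 \<le> k" for k
  proof (rule field_le_epsilon)
    fix r :: real assume "0 < r"
    define \<epsilon> where "\<epsilon> = r / (2 * k + 1)"
    have \<epsilon>: "0 < \<epsilon>" "2 * k * \<epsilon> \<le> r"
    proof -
      show "0 < \<epsilon>" using \<open>0 < r\<close> k by (simp add: \<epsilon>_def)
      have "2 * k * \<epsilon> \<le> (2 * k + 1) * \<epsilon>" using \<open>0 < \<epsilon>\<close> by (intro mult_right_mono) auto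
      also have "\<dots> = r" using k by (simp add: \<epsilon>_def)
      finally show "2 * k * \<epsilon> \<le> r" .
    qed
    have bi: "integrable M (\<lambda>\<omega>. (min \<bar>f \<omega>\<bar> k)\<^sup>2)" if [measurable]: "f \<in> borel_measurable M" for f
      using k by (intro integrable_const_bound[where B="k\<^sup>2"]) (auto intro!: power_mono)
    have "\<forall>\<^sub>F n in sequentially. expectation (\<lambda>\<omega>. (min \<bar>Z \<omega>\<bar> k)\<^sup>2)
        \<le> v n + r + k\<^sup>2 * prob {\<omega> \<in> space M. \<bar>D n \<omega> - Z \<omega>\<bar> > \<epsilon>}"
      using D
    proof eventually_elim
      case (elim n)
      have iI: "integrable M (\<lambda>\<omega>. k\<^sup>2 * indicator {\<omega> \<in> space M. \<bar>D n \<omega> - Z \<omega>\<bar> > \<epsilon>} \<omega>)"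
        by (intro integrable_mult_right integrable_real_indicator) (auto simp: less_top[symmetric])
      have "expectation (\<lambda>\<omega>. (min \<bar>Z \<omega>\<bar> k)\<^sup>2) \<le> expectation (\<lambda>\<omega>. ((D n \<omega>)\<^sup>2 + r)
          + k\<^sup>2 * indicator {\<omega> \<in> space M. \<bar>D n \<omega> - Z \<omega>\<bar> > \<epsilon>} \<omega>)"
      proof (rule integral_mono)
        fix \<omega> assume \<omega>: "\<omega> \<in> space M"
        show "(min \<bar>Z \<omega>\<bar> k)\<^sup>2 \<le> ((D n \<omega>)\<^sup>2 + r) + k\<^sup>2 * indicator {\<omega> \<in> space M. \<bar>D n \<omega> - Z \<omega>\<bar> > \<epsilon>} \<omega>"
        proof (cases "\<bar>D n \<omega> - Z \<omega>\<bar> > \<epsilon>")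
          case True
          have "(min \<bar>Z \<omega>\<bar> k)\<^sup>2 \<le> k\<^sup>2" using k by (intro power_mono) auto
          moreover have "0 \<le> (D n \<omega>)\<^sup>2 + r" using \<open>0 < r\<close> by simp
          ultimately show ?thesis using True \<omega> by simp
        next
          case False
          define x y where "x = min \<bar>Z \<omega>\<bar> k" and "y = min \<bar>D n \<omega>\<bar> k"
          have xy: "0 \<le> x" "x \<le> k" "0 \<le> y" "y \<le> k" "x - y \<le> \<epsilon>" "y \<le> \<bar>D n \<omega>\<bar>"
            using k False by (auto simp: x_def y_def min_def)
          have "x\<^sup>2 - y\<^sup>2 = (x + y) * (x - y)" by (simp add: power2_eq_square algebra_simps)
          also have "\<dots> \<le> (x + y) * \<epsilon>" using xy by (intro mult_left_mono) auto
          also have "\<dots> \<le> (2 * k) * \<epsilon>" using xy \<epsilon> by (intro mult_right_mono) auto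
          finally have "x\<^sup>2 \<le> y\<^sup>2 + r" using \<epsilon> by linarith
          moreover have "y\<^sup>2 \<le> (D n \<omega>)\<^sup>2" using xy power_mono[of y "\<bar>D n \<omega>\<bar>" 2] by simp
          ultimately show ?thesis using False by (simp add: x_def)
        qed
      next
        show "integrable M (\<lambda>\<omega>. (D n \<omega>)\<^sup>2 + r + k\<^sup>2 * indicator {\<omega> \<in> space M. \<bar>D n \<omega> - Z \<omega>\<bar> > \<epsilon>} \<omega>)"
          using elim iI by (intro Bochner_Integration.integrable_add) auto
      qed (auto intro!: bi)
      also have "\<dots> = expectation (\<lambda>\<omega>. (D n \<omega>)\<^sup>2) + r + k\<^sup>2 * prob {\<omega> \<in> space M. \<bar>D n \<omega> - Z \<omega>\<bar> > \<epsilon>}"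
        using elim iI by (subst Bochner_Integration.integral_add; simp add: prob_space)
      finally show ?case using elim by simp
    qed
    moreover have "(\<lambda>n. v n + r + k\<^sup>2 * prob {\<omega> \<in> space M. \<bar>D n \<omega> - Z \<omega>\<bar> > \<epsilon>}) \<longlonglongrightarrow> v' + r + k\<^sup>2 * 0"
      using lim \<epsilon>(1) v unfolding tendsto_in_probability_def by (intro tendsto_intros) auto
    ultimately show "expectation (\<lambda>\<omega>. (min \<bar>Z \<omega>\<bar> k)\<^sup>2) \<le> v' + r"
      using tendsto_lowerbound by fastforce
  qed
  have v': "0 \<le> v'" using truncated[of 0] by simp
  have "(\<integral>\<^sup>+\<omega>. ennreal ((Z \<omega>)\<^sup>2) \<partial>M) = (\<integral>\<^sup>+\<omega>. liminf (\<lambda>k. ennreal ((min \<bar>Z \<omega>\<bar> (real k))\<^sup>2)) \<partial>M)"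
  proof (rule nn_integral_cong)
    fix \<omega>
    obtain k0 :: nat where k0: "\<bar>Z \<omega>\<bar> \<le> real k0" using real_arch_simple by blast
    have "(\<lambda>k. ennreal ((min \<bar>Z \<omega>\<bar> (real k))\<^sup>2)) \<longlonglongrightarrow> ennreal ((Z \<omega>)\<^sup>2)"
      by (rule tendsto_eventually, rule eventually_sequentiallyI[of k0])
         (use k0 in \<open>auto simp: min_def\<close>)
    then show "ennreal ((Z \<omega>)\<^sup>2) = liminf (\<lambda>k. ennreal ((min \<bar>Z \<omega>\<bar> (real k))\<^sup>2))"
      by (rule lim_imp_Liminf[symmetric, rotated]) simp
  qed
  also have "\<dots> \<le> liminf (\<lambda>k. \<integral>\<^sup>+\<omega>. ennreal ((min \<bar>Z \<omega>\<bar> (real k))\<^sup>2) \<partial>M)"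
    by (rule nn_integral_liminf) measurable
  also have "\<dots> \<le> liminf (\<lambda>k. ennreal v')"
  proof (rule Liminf_mono, rule always_eventually, rule allI)
    fix k :: nat
    have "integrable M (\<lambda>\<omega>. (min \<bar>Z \<omega>\<bar> (real k))\<^sup>2)"
      by (intro integrable_const_bound[where B="(real k)\<^sup>2"]) (auto intro!: power_mono)
    then have "(\<integral>\<^sup>+\<omega>. ennreal ((min \<bar>Z \<omega>\<bar> (real k))\<^sup>2) \<partial>M) = ennreal (expectation (\<lambda>\<omega>. (min \<bar>Z \<omega>\<bar> (real k))\<^sup>2))"
      by (intro nn_integral_eq_integral) auto
    then show "(\<integral>\<^sup>+\<omega>. ennreal ((min \<bar>Z \<omega>\<bar> (real k))\<^sup>2) \<partial>M) \<le> ennreal v'"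
      using truncated[of "real k"] by (simp add: ennreal_leI)
  qed
  finally have le: "(\<integral>\<^sup>+\<omega>. ennreal ((Z \<omega>)\<^sup>2) \<partial>M) \<le> ennreal v'" by (simp add: Liminf_const)
  show i: "integrable M (\<lambda>\<omega>. (Z \<omega>)\<^sup>2)"
    using le_less_trans[OF le ennreal_less_top] by (intro integrableI_nonneg) auto
  show "expectation (\<lambda>\<omega>. (Z \<omega>)\<^sup>2) \<le> v'"
    using le nn_integral_eq_integral[OF i] v' by (simp add: ennreal_le_iff)
qed

end

lemma (in prob_space) limit_small_ball:
  assumes lim: "tendsto_in_probability M D Z" and \<eta>: "0 < \<eta>" and c: "c \<longlonglongrightarrow> c'"
    and D: "\<forall>\<^sub>F n in sequentially. prob {\<omega> \<in> space M. \<bar>D n \<omega>\<bar> \<le> 2 * \<eta>} \<le> c n"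
  shows "prob {\<omega> \<in> space M. \<bar>Z \<omega>\<bar> \<le> \<eta>} \<le> c'"
proof -
  have [measurable]: "D n \<in> borel_measurable M" "Z \<in> borel_measurable M" for n
    using lim by (auto simp: tendsto_in_probability_def)
  have "(\<lambda>n. c n + prob {\<omega> \<in> space M. \<bar>D n \<omega> - Z \<omega>\<bar> > \<eta>}) \<longlonglongrightarrow> c' + 0"
    using lim \<eta> c unfolding tendsto_in_probability_def by (intro tendsto_add) auto
  moreover have "\<forall>\<^sub>F n in sequentially. prob {\<omega> \<in> space M. \<bar>Z \<omega>\<bar> \<le> \<eta>}
      \<le> c n + prob {\<omega> \<in> space M. \<bar>D n \<omega> - Z \<omega>\<bar> > \<eta>}"
    using D
  proof eventually_elim
    case (elim n)
    have "prob {\<omega> \<in> space M. \<bar>Z \<omega>\<bar> \<le> \<eta>}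
        \<le> prob {\<omega> \<in> space M. \<bar>D n \<omega>\<bar> \<le> 2 * \<eta>} + prob {\<omega> \<in> space M. \<bar>D n \<omega> - Z \<omega>\<bar> > \<eta>}"
      by (rule prob_le_add[OF AE_I2]) auto
    then show ?case using elim by simp
  qed
  ultimately show ?thesis using tendsto_lowerbound by fastforce
qed

section \<open>The discounted solution as a Wiener integral\<close>

locale linear_sde = wiener_space M F T B
  for M :: "'a measure" and F :: "real \<Rightarrow> 'a measure" and T :: ereal and B :: "real \<Rightarrow> 'a \<Rightarrow> real" +
  fixes b \<sigma> :: "real \<Rightarrow> real" and \<alpha> :: real and X :: "real \<Rightarrow> 'a \<Rightarrow> real"
  assumes b_cont: "continuous_on (horizon T) b"
    and \<sigma>_cont: "continuous_on (horizon T) \<sigma>"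
    and \<sigma>_pos: "t \<in> horizon T \<Longrightarrow> 0 < \<sigma> t"
    and solution: "strong_solution M F T B b \<sigma> \<alpha> X"
begin

text \<open>The integrating factor of the drift.\<close>

definition discount :: "real \<Rightarrow> real" where
  "discount s = exp (- \<alpha> * (LBINT v:{0..s}. b v))"

definition discounted :: "real \<Rightarrow> 'a \<Rightarrow> real" where
  "discounted s \<omega> = discount s * X s \<omega>"

text \<open>The quadratic variation of the discounted solution.\<close>

definition variance_clock :: "real \<Rightarrow> real" where
  "variance_clock t = (LBINT s:{0..t}. (\<sigma> s * discount s)\<^sup>2)"

lemma Icc_subset_horizon: "t \<in> horizon T \<Longrightarrow> 0 \<le> a \<Longrightarrow> {a..t} \<subseteq> horizon T"
  using horizon_downward by auto

lemma continuous_on_Icc: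
  assumes "continuous_on (horizon T) f" "t \<in> horizon T" "0 \<le> a"
  shows "continuous_on {a..t} f"
  using assms Icc_subset_horizon continuous_on_subset by blast

lemma discount_pos: "0 < discount s" by (simp add: discount_def)

lemma discount_has_derivative:
  assumes t: "t \<in> horizon T" and s: "s \<in> {0..t}"
  shows "(discount has_real_derivative (- \<alpha> * b s * discount s)) (at s within {0..t})"
proof -
  have bc: "continuous_on {0..t} b" using b_cont t by (rule continuous_on_Icc) simp
  have "((\<lambda>x. integral {0..x} b) has_real_derivative b s) (at s within {0..t})"
    using bc s by (rule integral_has_real_derivative)
  then have deriv: "((\<lambda>x. exp (- \<alpha> * integral {0..x} b)) has_real_derivative
      (exp (- \<alpha> * integral {0..s} b) * (- \<alpha> * b s))) (at s within {0..t})"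
    by (auto intro!: derivative_eq_intros)
  have eq: "exp (- \<alpha> * integral {0..x} b) = discount x" if "x \<in> {0..t}" for x
  proof -
    have "(LBINT v:{0..x}. b v) = integral {0..x} b"
      using that by (intro set_borel_integral_eq_integral(2) borel_integrable_atLeastAtMost'
          continuous_on_subset[OF bc]) auto
    then show ?thesis by (simp add: discount_def)
  qed
  have "(discount has_real_derivative (exp (- \<alpha> * integral {0..s} b) * (- \<alpha> * b s))) (at s within {0..t})"
    by (rule has_field_derivative_transform_within[OF deriv zero_less_one s]) (rule eq)
  then show ?thesis by (simp only: eq[OF s] mult.commute[of "discount s"])
qed

lemma discount_cont:
  assumes "t \<in> horizon T" "0 \<le> a"
  shows "continuous_on {a..t} discount"
proof (rule continuous_on_subset)
  show "continuous_on {0..t} discount"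
    by (rule DERIV_continuous_on[where D="\<lambda>s. - \<alpha> * b s * discount s"])
       (rule discount_has_derivative[OF assms(1)])
qed (use assms in auto)

lemma discount_increment:
  assumes "u \<in> horizon T" "0 \<le> r" "r \<le> u"
  shows "discount u - discount r = - (LBINT s:{r..u}. \<alpha> * b s * discount s)"
proof -
  have "((\<lambda>s. - \<alpha> * b s * discount s) has_integral (discount u - discount r)) {r..u}"
  proof (rule fundamental_theorem_of_calculus[OF \<open>r \<le> u\<close>])
    fix s assume "s \<in> {r..u}"
    then have "(discount has_real_derivative (- \<alpha> * b s * discount s)) (at s within {0..u})"
      using assms by (intro discount_has_derivative) auto
    then have "(discount has_real_derivative (- \<alpha> * b s * discount s)) (at s within {r..u})"
      by (rule DERIV_subset) (use assms in auto)
    then show "(discount has_vector_derivative (- \<alpha> * b s * discount s)) (at s within {r..u})"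
      by (simp add: has_real_derivative_iff_has_vector_derivative)
  qed
  moreover have "continuous_on {r..u} (\<lambda>s. - \<alpha> * b s * discount s)"
    using assms continuous_on_Icc[OF b_cont] discount_cont by (intro continuous_intros) auto
  then have "(LBINT s:{r..u}. - \<alpha> * b s * discount s) = integral {r..u} (\<lambda>s. - \<alpha> * b s * discount s)"
    by (intro set_borel_integral_eq_integral(2) borel_integrable_atLeastAtMost')
  ultimately have "discount u - discount r = (LBINT s:{r..u}. - \<alpha> * b s * discount s)"
    by (metis integral_unique)
  also have "\<dots> = (LBINT s:{r..u}. - (\<alpha> * b s * discount s))" by simp
  finally show ?thesis unfolding set_lebesgue_integral_def by simp
qed

lemma X_cont: "\<omega> \<in> space M \<Longrightarrow> continuous_on (horizon T) (\<lambda>s. X s \<omega>)"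
  using solution by (simp add: strong_solution_def ito_process_def continuous_paths_def)

lemma X_measurable: "t \<in> horizon T \<Longrightarrow> X t \<in> borel_measurable (F t)"
  using solution by (simp add: strong_solution_def ito_process_def adapted_def)

lemma discounted_measurable: "t \<in> horizon T \<Longrightarrow> discounted t \<in> borel_measurable (F t)"
  unfolding discounted_def using X_measurable by (intro borel_measurable_times) auto

lemma weight_cont: "t \<in> horizon T \<Longrightarrow> 0 \<le> a \<Longrightarrow> continuous_on {a..t} (\<lambda>s. \<sigma> s * discount s)"
  using continuous_on_Icc[OF \<sigma>_cont] discount_cont by (intro continuous_intros) auto

text \<open>Integration by parts along each path turns the increment into a limit of weighted increment sums
  of the stochastic integral \<open>J\<close> of \<open>\<sigma>\<close>, and Lenglart's inequality replaces the increments of \<open>J\<close> by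
  those of \<open>B\<close>. The resulting sums are normal with explicit variances.\<close>

lemma discounted_tendsto_in_probability:
  assumes t: "t \<in> horizon T" and a: "0 \<le> a" "a < t"
  defines "q \<equiv> uniform_grid a t"
  shows "tendsto_in_probability M
    (\<lambda>n \<omega>. increment_sum n (q n) (\<lambda>i. \<sigma> (q n i) * discount (q n i)) (\<lambda>s. B s \<omega>))
    (\<lambda>\<omega>. discounted t \<omega> - discounted a \<omega>)"
proof -
  obtain J where J: "has_ito_integral M F T B (\<lambda>s \<omega>. \<sigma> s) J"
    and XJ: "AE \<omega> in M. \<forall>t\<in>horizon T. X t \<omega> = X 0 \<omega> + (LBINT s:{0..t}. \<alpha> * b s * X s \<omega>) + J t \<omega>"
    using solution unfolding strong_solution_def ito_process_def by blast
  have Jm: "J s \<in> borel_measurable M" if "s \<in> horizon T" for s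
    using J that measurable_F_M[of "J s" s borel] unfolding has_ito_integral_def adapted_def by blast
  have Bm: "B s \<in> borel_measurable M" if "s \<in> horizon T" for s
    by (rule measurable_F_M[OF measurable_B[OF that that order_refl] that])
  have ah: "a \<in> horizon T" using horizon_downward t a by auto
  have q_range: "q n i \<in> horizon T" "a \<le> q n i" "q n i \<le> t" if "0 < n" "i \<le> n" for n i
    using uniform_grid_range[OF a(2) that] a(1) horizon_downward[OF t] by (auto simp: q_def)
  have q_less: "q n i < q n (Suc i)" if "0 < n" for n i
    using uniform_grid_less[OF a(2) that] by (simp add: q_def)
  define A where "A n = (\<lambda>\<omega>. increment_sum n (q n) (\<lambda>i. discount (q n i)) (\<lambda>s. J s \<omega>))" for n
  define D where "D n = (\<lambda>\<omega>. increment_sum n (q n) (\<lambda>i. \<sigma> (q n i) * discount (q n i)) (\<lambda>s. B s \<omega>))" for n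
  define Z where "Z = (\<lambda>\<omega>. discounted t \<omega> - discounted a \<omega>)"
  have Zm [measurable]: "Z \<in> borel_measurable M"
    unfolding Z_def using discounted_measurable[OF t] discounted_measurable[OF ah] measurable_F_M t ah
    by (intro borel_measurable_diff) blast+
  have Am [measurable]: "A n \<in> borel_measurable M" for n
    unfolding A_def increment_sum_def
  proof (intro borel_measurable_sum borel_measurable_times borel_measurable_diff)
    fix i assume "i \<in> {..<n}"
    then show "J (q n (Suc i)) \<in> borel_measurable M" "J (q n i) \<in> borel_measurable M"
      using q_range[of n i] q_range[of n "Suc i"] Jm by auto
  qed (rule borel_measurable_const)
  have Dm [measurable]: "D n \<in> borel_measurable M" for n
    unfolding D_def increment_sum_def
  proof (intro borel_measurable_sum borel_measurable_times borel_measurable_diff)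
    fix i assume "i \<in> {..<n}"
    then show "B (q n (Suc i)) \<in> borel_measurable M" "B (q n i) \<in> borel_measurable M"
      using q_range[of n i] q_range[of n "Suc i"] Bm by auto
  qed (rule borel_measurable_const)+
  have "tendsto_in_probability M A Z"
  proof (rule tendsto_in_probability_AE)
    show "AE \<omega> in M. (\<lambda>n. A n \<omega>) \<longlonglongrightarrow> Z \<omega>"
      using XJ AE_space
    proof eventually_elim
      case (elim \<omega>)
      show ?case
        unfolding A_def Z_def discounted_def q_def
      proof (rule integrating_factor_tendsto[OF a(2), where k="\<lambda>s. \<alpha> * b s"])
        show "continuous_on {a..t} discount" by (rule discount_cont[OF t a(1)])
        show "continuous_on {a..t} (\<lambda>s. \<alpha> * b s)"
          using continuous_on_Icc[OF b_cont t a(1)] by (intro continuous_intros)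
        show "continuous_on {a..t} (\<lambda>s. X s \<omega>)" by (rule continuous_on_Icc[OF X_cont t a(1)]) (use elim in simp)
      next
        fix r u assume ru: "a \<le> r" "r \<le> u" "u \<le> t"
        then have h: "u \<in> horizon T" "r \<in> horizon T" "0 \<le> r" using horizon_downward[OF t] a by auto
        show "discount u - discount r = - (LBINT s:{r..u}. \<alpha> * b s * discount s)"
          using discount_increment h ru by simp
        have "set_integrable lborel {0..u} (\<lambda>s. \<alpha> * b s * X s \<omega>)"
          using continuous_on_Icc[OF b_cont h(1)] continuous_on_Icc[OF X_cont h(1)] elim
          by (intro borel_integrable_atLeastAtMost' continuous_intros) auto
        from set_integral_combine[OF h(3) ru(2) this] elim h
        show "X u \<omega> - X r \<omega> = (LBINT s:{r..u}. \<alpha> * b s * X s \<omega>) + (J u \<omega> - J r \<omega>)" by simp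
      qed
    qed
  qed measurable
  moreover have "tendsto_in_probability M (\<lambda>n \<omega>. D n \<omega> - A n \<omega>) (\<lambda>\<omega>. 0)"
    unfolding tendsto_in_probability_def
  proof (intro conjI allI impI)
    fix \<epsilon> :: real assume \<epsilon>: "0 < \<epsilon>"
    show "(\<lambda>n. prob {\<omega> \<in> space M. \<bar>D n \<omega> - A n \<omega> - 0\<bar> > \<epsilon>}) \<longlonglongrightarrow> 0"
    proof (rule tendstoI)
      fix \<rho> :: real assume \<rho>: "0 < \<rho>"
      define \<delta> where "\<delta> = \<rho> * (\<epsilon> / 2)\<^sup>2 / 2"
      have \<delta>: "0 < \<delta>" "\<delta> / (\<epsilon> / 2)\<^sup>2 < \<rho>" using \<rho> \<epsilon> by (auto simp: \<delta>_def)
      have "compact (discount ` {a..t})"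
        by (rule compact_continuous_image[OF discount_cont[OF t a(1)]]) simp
      then obtain C where C: "0 < C" "\<And>s. s \<in> {a..t} \<Longrightarrow> \<bar>discount s\<bar> \<le> C"
        using compact_imp_bounded[of "discount ` {a..t}"] unfolding bounded_pos by auto
      define \<kappa> where "\<kappa> = sqrt (\<delta> / (4 * C\<^sup>2 * (t - a)))"
      have "0 < \<delta> / (4 * C\<^sup>2 * (t - a))" using \<delta> C a by simp
      then have \<kappa>: "0 < \<kappa>" "\<kappa>\<^sup>2 * (C\<^sup>2 * (t - a)) = \<delta> / 4"
        using C a by (auto simp: \<kappa>_def field_simps)
      have "\<forall>\<^sub>F n in sequentially. 0 < n \<and> (\<forall>i<n. \<forall>r\<in>{q n i..q n (Suc i)}. \<forall>s\<in>{q n i..q n (Suc i)}. \<bar>\<sigma> r - \<sigma> s\<bar> \<le> \<kappa>)"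
        unfolding q_def by (rule uniform_grid_oscillation[OF continuous_on_Icc[OF \<sigma>_cont t a(1)] a(2) \<kappa>(1)])
      then show "\<forall>\<^sub>F n in sequentially. dist (prob {\<omega> \<in> space M. \<bar>D n \<omega> - A n \<omega> - 0\<bar> > \<epsilon>}) 0 < \<rho>"
      proof eventually_elim
        case (elim n)
        then have n: "0 < n" and osc: "\<And>i r s. i < n \<Longrightarrow> r \<in> {q n i..q n (Suc i)} \<Longrightarrow> s \<in> {q n i..q n (Suc i)} \<Longrightarrow> \<bar>\<sigma> r - \<sigma> s\<bar> \<le> \<kappa>"
          by blast+
        have mono: "\<And>i. i < n \<Longrightarrow> q n i \<le> q n (Suc i)" using q_less[OF n] by (simp add: less_imp_le)
        have qn: "q n 0 = a" "q n n = t" using n by (auto simp: q_def)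
        define c d where "c = step_fun n (q n) (\<lambda>i. discount (q n i))"
          and "d = step_fun n (q n) (\<lambda>i. \<sigma> (q n i) * discount (q n i))"
        have pt: "(c s * \<sigma> s - d s)\<^sup>2 \<le> \<kappa>\<^sup>2 * C\<^sup>2 * indicator {a..t} s" for s
        proof (rule step_fun_cases[of n "q n" s])
          fix k assume k: "k < n" "q n k < s" "s \<le> q n (Suc k)" and val: "\<And>c. step_fun n (q n) c s = c k"
          have r: "q n k \<in> {a..t}" "s \<in> {a..t}" using q_range[OF n, of k] q_range[OF n, of "Suc k"] k by auto
          have "\<bar>c s * \<sigma> s - d s\<bar> = \<bar>\<sigma> s - \<sigma> (q n k)\<bar> * \<bar>discount (q n k)\<bar>"
            by (simp add: c_def d_def val abs_mult[symmetric] algebra_simps)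
          also have "\<dots> \<le> \<kappa> * C" using osc[OF k(1), of s "q n k"] k C(2)[OF r(1)] \<kappa> by (intro mult_mono) auto
          finally have "\<bar>c s * \<sigma> s - d s\<bar>\<^sup>2 \<le> (\<kappa> * C)\<^sup>2" by (intro power_mono) auto
          then show ?thesis using r by (simp add: power_mult_distrib)
        next
          assume "\<And>c. step_fun n (q n) c s = 0"
          then show ?thesis by (simp add: c_def d_def)
        qed (rule mono)
        have "(LBINT s:{0..t}. (c s * \<sigma> s - d s)\<^sup>2) \<le> (\<integral>s. \<kappa>\<^sup>2 * C\<^sup>2 * indicator {a..t} s \<partial>lborel)"
          unfolding set_lebesgue_integral_def
        proof (rule integral_mono')
          show "indicator {0..t} s *\<^sub>R (c s * \<sigma> s - d s)\<^sup>2 \<le> \<kappa>\<^sup>2 * C\<^sup>2 * indicator {a..t} s" for s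
            using pt[of s] by (auto simp: indicator_def split: if_splits)
        qed (auto intro!: integrable_mult_right integrable_real_indicator emeasure_bounded_finite)
        also have "\<dots> = \<delta> / 4" using a \<kappa>(2) by (simp add: mult.assoc)
        finally have small: "\<not> (LBINT s:{0..t}. (c s * \<sigma> s - d s)\<^sup>2) > \<delta> / 4" by simp
        have "prob {\<omega> \<in> space M. \<bar>A n \<omega> - D n \<omega>\<bar> > 2 * (\<epsilon> / 2)} \<le> \<delta> / (\<epsilon> / 2)\<^sup>2
            + prob {\<omega> \<in> space M. (LBINT s:{0..t}. (c s * \<sigma> s - d s)\<^sup>2) > \<delta> / 4}"
          unfolding A_def D_def c_def d_def
          by (rule ito_lenglart[OF J t]) (use mono q_range[OF n] qn \<epsilon> \<delta> in auto)
        also have "\<dots> < \<rho>" using small \<delta>(2) by simp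
        finally show ?case by (simp add: abs_minus_commute)
      qed
    qed
  qed measurable
  ultimately have "tendsto_in_probability M (\<lambda>n \<omega>. A n \<omega> + (D n \<omega> - A n \<omega>)) (\<lambda>\<omega>. Z \<omega> + 0)"
    by (rule tendsto_in_probability_add)
  then show ?thesis by (simp add: D_def Z_def)
qed

lemma discounted_increment_sum_normal:
  assumes t: "t \<in> horizon T" and a: "0 \<le> a" "a < t" and n: "0 < n"
  defines "q \<equiv> uniform_grid a t n"
  shows "distributed M lborel (\<lambda>\<omega>. increment_sum n q (\<lambda>i. \<sigma> (q i) * discount (q i)) (\<lambda>s. B s \<omega>))
      (normal_density 0 (sqrt (\<Sum>i<n. (\<sigma> (q i) * discount (q i))\<^sup>2 * (q (Suc i) - q i))))"
    and "0 < (\<Sum>i<n. (\<sigma> (q i) * discount (q i))\<^sup>2 * (q (Suc i) - q i))"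
proof -
  have q: "q i < q (Suc i)" for i unfolding q_def by (rule uniform_grid_less[OF a(2) n])
  have qh: "q i \<in> horizon T" if "i \<le> n" for i
    using uniform_grid_range[OF a(2) n that] a(1) horizon_downward[OF t] by (auto simp: q_def)
  have nz: "\<sigma> (q i) * discount (q i) \<noteq> 0" if "i < n" for i
    using \<sigma>_pos[OF qh[of i]] that discount_pos[of "q i"] by auto
  show "0 < (\<Sum>i<n. (\<sigma> (q i) * discount (q i))\<^sup>2 * (q (Suc i) - q i))"
    using n nz q by (intro sum_pos mult_pos_pos) auto
  have "distributed M lborel (\<lambda>\<omega>. 1 * increment_sum n q (\<lambda>i. \<sigma> (q i) * discount (q i)) (\<lambda>s. B s \<omega>))
      (normal_density 0 (sqrt (\<Sum>i<n. (\<sigma> (q i) * discount (q i))\<^sup>2 * (q (Suc i) - q i))))"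
    by (rule signed_increment_sum_normal[where U="\<lambda>_. 1"]) (use q qh n nz in auto)
  then show "distributed M lborel (\<lambda>\<omega>. increment_sum n q (\<lambda>i. \<sigma> (q i) * discount (q i)) (\<lambda>s. B s \<omega>))
      (normal_density 0 (sqrt (\<Sum>i<n. (\<sigma> (q i) * discount (q i))\<^sup>2 * (q (Suc i) - q i))))"
    by simp
qed

lemma variance_clock_integrable:
  "t \<in> horizon T \<Longrightarrow> 0 \<le> a \<Longrightarrow> set_integrable lborel {a..t} (\<lambda>s. (\<sigma> s * discount s)\<^sup>2)"
  using weight_cont by (intro borel_integrable_atLeastAtMost' continuous_on_power)

lemma variance_clock_diff:
  assumes "t \<in> horizon T" "0 \<le> a" "a \<le> t"
  shows "variance_clock t - variance_clock a = (LBINT s:{a..t}. (\<sigma> s * discount s)\<^sup>2)"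
  using set_integral_combine[OF assms(2,3) variance_clock_integrable[OF assms(1)]]
  by (simp add: variance_clock_def)

lemma variance_clock_mono:
  assumes "t \<in> horizon T" "0 \<le> a" "a \<le> t"
  shows "variance_clock a \<le> variance_clock t"
proof -
  have "0 \<le> (LBINT s:{a..t}. (\<sigma> s * discount s)\<^sup>2)"
    unfolding set_lebesgue_integral_def by (intro Bochner_Integration.integral_nonneg) auto
  then show ?thesis using variance_clock_diff[OF assms] by simp
qed

lemma variance_clock_0: "variance_clock 0 = 0"
proof -
  have "AE s in lborel. indicator {0..0} s *\<^sub>R (\<sigma> s * discount s)\<^sup>2 = 0"
    using AE_lborel_singleton[of 0] by eventually_elim simp
  then show ?thesis unfolding variance_clock_def set_lebesgue_integral_def by (rule integral_eq_zero_AE)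
qed

lemma variance_clock_pos:
  assumes t: "t \<in> horizon T" "0 < t"
  shows "0 < variance_clock t"
proof -
  obtain s0 where s0: "s0 \<in> {0..t}" "\<And>s. s \<in> {0..t} \<Longrightarrow> (\<sigma> s0 * discount s0)\<^sup>2 \<le> (\<sigma> s * discount s)\<^sup>2"
    using continuous_attains_inf[of "{0..t}" "\<lambda>s. (\<sigma> s * discount s)\<^sup>2"] t
      continuous_on_power[OF weight_cont[OF t(1), of 0], of 2] by auto
  have "0 < (\<sigma> s0 * discount s0)\<^sup>2"
    using \<sigma>_pos[of s0] discount_pos[of s0] s0(1) horizon_downward[OF t(1)] by fastforce
  then have "0 < (\<sigma> s0 * discount s0)\<^sup>2 * t" using t by simp
  also have "\<dots> = (LBINT s:{0..t}. (\<sigma> s0 * discount s0)\<^sup>2)"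
    using t by (simp add: set_lebesgue_integral_def)
  also have "\<dots> \<le> variance_clock t"
    unfolding variance_clock_def
  proof (rule set_integral_mono)
    show "set_integrable lborel {0..t} (\<lambda>s. (\<sigma> s0 * discount s0)\<^sup>2)"
      by (rule borel_integrable_atLeastAtMost') auto
  qed (use s0(2) variance_clock_integrable[OF t(1), of 0] in auto)
  finally show ?thesis .
qed

lemma discounted_second_moment:
  assumes t: "t \<in> horizon T" and a: "0 \<le> a" "a \<le> t"
  shows "integrable M (\<lambda>\<omega>. (discounted t \<omega> - discounted a \<omega>)\<^sup>2)"
    and "expectation (\<lambda>\<omega>. (discounted t \<omega> - discounted a \<omega>)\<^sup>2) \<le> variance_clock t - variance_clock a"
proof -
  define q where "q = uniform_grid a t"
  define D where "D n = (\<lambda>\<omega>. increment_sum n (q n) (\<lambda>i. \<sigma> (q n i) * discount (q n i)) (\<lambda>s. B s \<omega>))" for n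
  define v where "v n = (\<Sum>i<n. (\<sigma> (q n i) * discount (q n i))\<^sup>2 * (q n (Suc i) - q n i))" for n
  have lim: "integrable M (\<lambda>\<omega>. (discounted t \<omega> - discounted a \<omega>)\<^sup>2) \<and>
    expectation (\<lambda>\<omega>. (discounted t \<omega> - discounted a \<omega>)\<^sup>2) \<le> variance_clock t - variance_clock a" if "a < t"
  proof -
    have "tendsto_in_probability M D (\<lambda>\<omega>. discounted t \<omega> - discounted a \<omega>)"
      unfolding D_def q_def by (rule discounted_tendsto_in_probability[OF t a(1) that])
    moreover have "v \<longlonglongrightarrow> variance_clock t - variance_clock a"
      unfolding v_def q_def variance_clock_diff[OF t a]
      by (rule riemann_sum_tendsto[OF continuous_on_power[OF weight_cont[OF t a(1)]] that])
    moreover have "\<forall>\<^sub>F n in sequentially. integrable M (\<lambda>\<omega>. (D n \<omega>)\<^sup>2) \<and> expectation (\<lambda>\<omega>. (D n \<omega>)\<^sup>2) \<le> v n"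
      using eventually_gt_at_top[of 0]
    proof eventually_elim
      case (elim n)
      from normal_second_moment[OF discounted_increment_sum_normal[OF t a(1) that elim]]
      show ?case by (simp add: D_def v_def q_def)
    qed
    ultimately show ?thesis using limit_second_moment by blast
  qed
  show "integrable M (\<lambda>\<omega>. (discounted t \<omega> - discounted a \<omega>)\<^sup>2)"
    "expectation (\<lambda>\<omega>. (discounted t \<omega> - discounted a \<omega>)\<^sup>2) \<le> variance_clock t - variance_clock a"
    using lim a by (cases "a = t"; simp)+
qed

lemma discounted_0: "AE \<omega> in M. discounted 0 \<omega> = 0"
  using solution by (auto simp: strong_solution_def discounted_def)

lemma discounted_second_moment_0:
  assumes t: "t \<in> horizon T"
  shows "integrable M (\<lambda>\<omega>. (discounted t \<omega>)\<^sup>2)" "expectation (\<lambda>\<omega>. (discounted t \<omega>)\<^sup>2) \<le> variance_clock t"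
proof -
  have ae: "AE \<omega> in M. (discounted t \<omega> - discounted 0 \<omega>)\<^sup>2 = (discounted t \<omega>)\<^sup>2"
    using discounted_0 by eventually_elim simp
  have [measurable]: "discounted t \<in> borel_measurable M" "discounted 0 \<in> borel_measurable M"
    using discounted_measurable measurable_F_M t zero_in_horizon by blast+
  note m = discounted_second_moment[OF t order_refl horizon_nonneg[OF t]]
  show "integrable M (\<lambda>\<omega>. (discounted t \<omega>)\<^sup>2)"
    using m(1) integrable_cong_AE[OF _ _ ae] by simp
  show "expectation (\<lambda>\<omega>. (discounted t \<omega>)\<^sup>2) \<le> variance_clock t"
    using m(2) integral_cong_AE[OF _ _ ae] by (simp add: variance_clock_0)
qed

text \<open>The normalisation divides by the modulus of the discounted solution, which must therefore rarely
  be small. The bound improves as \<open>t\<close> grows, hence is uniform over late times.\<close>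

lemma discounted_small_ball:
  assumes t: "t \<in> horizon T" "0 < t" and \<eta>: "0 < \<eta>"
  shows "prob {\<omega> \<in> space M. \<bar>discounted t \<omega>\<bar> \<le> \<eta>} \<le> 4 * \<eta> / sqrt (variance_clock t)"
proof -
  define q where "q = uniform_grid 0 t"
  define D where "D n = (\<lambda>\<omega>. increment_sum n (q n) (\<lambda>i. \<sigma> (q n i) * discount (q n i)) (\<lambda>s. B s \<omega>))" for n
  define v where "v n = (\<Sum>i<n. (\<sigma> (q n i) * discount (q n i))\<^sup>2 * (q n (Suc i) - q n i))" for n
  have [measurable]: "discounted t \<in> borel_measurable M" "discounted 0 \<in> borel_measurable M"
    using discounted_measurable measurable_F_M t zero_in_horizon by blast+
  have "tendsto_in_probability M D (\<lambda>\<omega>. discounted t \<omega> - discounted 0 \<omega>)"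
    unfolding D_def q_def by (rule discounted_tendsto_in_probability[OF t(1) order_refl t(2)])
  moreover have "v \<longlonglongrightarrow> variance_clock t - variance_clock 0"
    unfolding v_def q_def variance_clock_diff[OF t(1) order_refl less_imp_le[OF t(2)]]
    by (rule riemann_sum_tendsto[OF continuous_on_power[OF weight_cont[OF t(1) order_refl]] t(2)])
  then have "(\<lambda>n. 2 * (2 * \<eta>) / sqrt (v n)) \<longlonglongrightarrow> 2 * (2 * \<eta>) / sqrt (variance_clock t - variance_clock 0)"
    using variance_clock_pos[OF t] by (intro tendsto_intros) (auto simp: variance_clock_0)
  moreover have "\<forall>\<^sub>F n in sequentially. prob {\<omega> \<in> space M. \<bar>D n \<omega>\<bar> \<le> 2 * \<eta>} \<le> 2 * (2 * \<eta>) / sqrt (v n)"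
    using eventually_gt_at_top[of 0]
  proof eventually_elim
    case (elim n)
    show ?case
      unfolding D_def v_def q_def using \<eta>
      by (intro normal_small_ball discounted_increment_sum_normal[OF t(1) order_refl t(2) elim]) auto
  qed
  ultimately have "prob {\<omega> \<in> space M. \<bar>discounted t \<omega> - discounted 0 \<omega>\<bar> \<le> \<eta>}
      \<le> 2 * (2 * \<eta>) / sqrt (variance_clock t - variance_clock 0)"
    using limit_small_ball[of D _ \<eta>] \<eta> by blast
  moreover have "prob {\<omega> \<in> space M. \<bar>discounted t \<omega>\<bar> \<le> \<eta>} = prob {\<omega> \<in> space M. \<bar>discounted t \<omega> - discounted 0 \<omega>\<bar> \<le> \<eta>}"
    using discounted_0 by (intro finite_measure_eq_AE) (auto elim!: eventually_mono)
  ultimately show ?thesis by (simp add: variance_clock_0)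
qed

end

section \<open>Studentized approximation and the maximum likelihood estimator\<close>

lemma L2_cauchy_schwarz:
  assumes f: "square_integrable_on A f" and g: "square_integrable_on A g"
  shows "(LBINT s:A. f s * g s)\<^sup>2 \<le> (LBINT s:A. (f s)\<^sup>2) * (LBINT s:A. (g s)\<^sup>2)"
proof -
  define a c d where "a = (LBINT s:A. (f s)\<^sup>2)" and "c = (LBINT s:A. f s * g s)" and "d = (LBINT s:A. (g s)\<^sup>2)"
  have i: "set_integrable lborel A (\<lambda>s. (f s)\<^sup>2)" "set_integrable lborel A (\<lambda>s. (g s)\<^sup>2)"
    "set_integrable lborel A (\<lambda>s. f s * g s)"
    using f g square_integrable_on_add(2)[OF f g] by (auto simp: square_integrable_on_def)
  have quad: "0 \<le> a - 2 * x * c + x\<^sup>2 * d" for x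
  proof -
    have "0 \<le> (LBINT s:A. (f s - x * g s)\<^sup>2)"
      unfolding set_lebesgue_integral_def by (intro Bochner_Integration.integral_nonneg) auto
    also have "\<dots> = (LBINT s:A. ((f s)\<^sup>2 - 2 * x * (f s * g s)) + x\<^sup>2 * (g s)\<^sup>2)"
      by (simp add: power2_eq_square algebra_simps)
    also have "\<dots> = a - 2 * x * c + x\<^sup>2 * d"
      using i by (simp add: set_integral_add set_integral_diff a_def c_def d_def)
    finally show ?thesis .
  qed
  have "c\<^sup>2 \<le> a * d"
  proof (cases "d = 0")
    case True
    have "c = 0"
    proof (rule ccontr)
      assume "c \<noteq> 0"
      then show False using quad[of "(a + 1) / (2 * c)"] True by simp
    qed
    then show ?thesis using True by simp
  next
    case False
    have "0 \<le> d" unfolding d_def set_lebesgue_integral_def by (intro Bochner_Integration.integral_nonneg) auto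
    with False have "0 < d" by simp
    then show ?thesis using quad[of "c / d"] by (simp add: field_simps power2_eq_square)
  qed
  then show ?thesis by (simp add: a_def c_def d_def)
qed

text \<open>This inequality turns closeness of the score to a multiple of the signal into closeness of the
  roots of their energies.\<close>

lemma L2_triangle:
  assumes f: "square_integrable_on A f" and g: "square_integrable_on A g"
  shows "\<bar>sqrt (LBINT s:A. (f s)\<^sup>2) - sqrt (LBINT s:A. (g s)\<^sup>2)\<bar> \<le> sqrt (LBINT s:A. (f s - g s)\<^sup>2)"
proof (rule real_le_rsqrt)
  define a c d where "a = (LBINT s:A. (f s)\<^sup>2)" and "c = (LBINT s:A. f s * g s)" and "d = (LBINT s:A. (g s)\<^sup>2)"
  have i: "set_integrable lborel A (\<lambda>s. (f s)\<^sup>2)" "set_integrable lborel A (\<lambda>s. (g s)\<^sup>2)"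
    "set_integrable lborel A (\<lambda>s. f s * g s)"
    using f g square_integrable_on_add(2)[OF f g] by (auto simp: square_integrable_on_def)
  have nn: "0 \<le> a" "0 \<le> d"
    unfolding a_def d_def set_lebesgue_integral_def by (intro Bochner_Integration.integral_nonneg; simp)+
  have "c \<le> sqrt (a * d)"
    using L2_cauchy_schwarz[OF f g] by (intro real_le_rsqrt) (simp add: a_def c_def d_def)
  then have "a + d - 2 * (sqrt a * sqrt d) \<le> a + d - 2 * c" by (simp add: real_sqrt_mult)
  also have "\<dots> = (LBINT s:A. ((f s)\<^sup>2 - 2 * (f s * g s)) + (g s)\<^sup>2)"
    using i by (simp add: set_integral_add set_integral_diff a_def c_def d_def)
  also have "\<dots> = (LBINT s:A. (f s - g s)\<^sup>2)" by (simp add: power2_eq_square algebra_simps)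
  also have "a + d - 2 * (sqrt a * sqrt d) = \<bar>sqrt a - sqrt d\<bar>\<^sup>2"
    using nn by (simp add: power2_diff)
  finally show "\<bar>sqrt (LBINT s:A. (f s)\<^sup>2) - sqrt (LBINT s:A. (g s)\<^sup>2)\<bar>\<^sup>2 \<le> (LBINT s:A. (f s - g s)\<^sup>2)"
    by (simp add: a_def d_def)
qed

lemma eventually_upto_horizon:
  assumes "0 < T"
  shows "eventually P (upto_horizon T) \<longleftrightarrow> (\<exists>s\<in>horizon T. \<forall>t\<in>horizon T. s < t \<longrightarrow> P t)"
proof
  assume "eventually P (upto_horizon T)"
  then obtain Q where Q: "eventually Q (at_left T)" "\<And>t. Q (ereal t) \<Longrightarrow> P t"
    unfolding upto_horizon_def eventually_filtercomap by blast
  obtain c where c: "c < T" "\<And>y. c < y \<Longrightarrow> y < T \<Longrightarrow> Q y"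
    using Q(1) eventually_at_left[OF assms] by blast
  have "max c 0 < T" using c(1) assms by simp
  then obtain s where s: "max c 0 < ereal s" "ereal s < T" using ereal_dense2 by blast
  show "\<exists>s\<in>horizon T. \<forall>t\<in>horizon T. s < t \<longrightarrow> P t"
  proof (intro bexI ballI impI)
    show "s \<in> horizon T" using s by (simp add: horizon_def)
    fix t assume "t \<in> horizon T" "s < t"
    moreover have "c < ereal s" using s(1) by simp
    ultimately show "P t"
      using less_trans[of c "ereal s" "ereal t"] by (intro Q(2) c(2)) (auto simp: horizon_def)
  qed
next
  assume "\<exists>s\<in>horizon T. \<forall>t\<in>horizon T. s < t \<longrightarrow> P t"
  then obtain s where s: "s \<in> horizon T" "\<And>t. t \<in> horizon T \<Longrightarrow> s < t \<Longrightarrow> P t" by blast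
  have "eventually (\<lambda>y. ereal s < y \<and> y < T) (at_left T)"
    using s(1) by (intro eventually_at_leftI[of "ereal s"]) (auto simp: horizon_def)
  moreover have "\<forall>t. ereal s < ereal t \<and> ereal t < T \<longrightarrow> P t"
    using s by (auto simp: horizon_def)
  ultimately show "eventually P (upto_horizon T)"
    unfolding upto_horizon_def eventually_filtercomap by blast
qed

text \<open>The modulus of \<open>y\<close> occurs in both \<open>z\<close> and \<open>S\<close> and cancels in the quotient; its sign is what remains in
  \<open>w\<close>.\<close>

lemma studentized_close:
  fixes y z w W r S :: real
  assumes r: "0 < r" and z: "\<bar>z - y * W\<bar> \<le> 2 * \<epsilon> * r" and S: "\<bar>S - \<bar>y\<bar> * r\<bar> \<le> \<delta> * r"
    and y: "\<eta> < \<bar>y\<bar>" and w: "w = (if 0 \<le> y then 1 else -1) * W / r" "\<bar>w\<bar> \<le> K"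
    and par: "0 < \<eta>" "0 \<le> \<delta>" "\<delta> \<le> \<eta> / 2" "2 * \<epsilon> + K * \<delta> \<le> \<theta> * \<eta> / 2" "0 \<le> \<theta>"
  shows "\<bar>z / S - w\<bar> \<le> \<theta>"
proof -
  have "\<eta> * r \<le> \<bar>y\<bar> * r" "\<delta> * r \<le> \<eta> / 2 * r" using y r par by (auto intro!: mult_right_mono)
  then have Spos: "\<eta> / 2 * r \<le> S" using S by (simp add: abs_le_iff)
  moreover have "0 < \<eta> / 2 * r" using par r by simp
  ultimately have S0: "0 < S" by linarith
  have yW: "y * W = w * (\<bar>y\<bar> * r)" using w(1) r by (auto simp: abs_if)
  have "z - w * S = (z - y * W) - w * (S - \<bar>y\<bar> * r)" unfolding yW by (simp add: algebra_simps)
  then have "\<bar>z - w * S\<bar> \<le> \<bar>z - y * W\<bar> + \<bar>w\<bar> * \<bar>S - \<bar>y\<bar> * r\<bar>"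
    using abs_triangle_ineq4[of "z - y * W" "w * (S - \<bar>y\<bar> * r)"] by (simp only: abs_mult)
  also have "\<dots> \<le> 2 * \<epsilon> * r + K * (\<delta> * r)" using z S w(2) by (intro add_mono mult_mono) auto
  also have "\<dots> = (2 * \<epsilon> + K * \<delta>) * r" by (simp add: algebra_simps)
  also have "\<dots> \<le> \<theta> * \<eta> / 2 * r" using par r by (intro mult_right_mono) auto
  also have "\<dots> = \<theta> * (\<eta> / 2 * r)" by simp
  also have "\<dots> \<le> \<theta> * S" using par Spos by (intro mult_left_mono) auto
  finally have "\<bar>z - w * S\<bar> / S \<le> \<theta>" using S0 by (simp add: pos_divide_le_eq)
  moreover have "\<bar>z / S - w\<bar> = \<bar>z - w * S\<bar> / S" using S0 by (simp add: field_simps)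
  ultimately show ?thesis by simp
qed

text \<open>Every approximating variable has exactly the limit law, so the distribution function of \<open>R t\<close> at \<open>x\<close>
  is squeezed between values of the limiting one at points near \<open>x\<close>.\<close>

lemma (in prob_space) tendsto_in_distribution_by_approximation:
  assumes meas: "\<forall>\<^sub>F t in G. R t \<in> borel_measurable M"
    and approx: "\<And>\<theta> \<epsilon>. 0 < \<theta> \<Longrightarrow> 0 < \<epsilon> \<Longrightarrow> \<forall>\<^sub>F t in G. \<exists>w\<in>borel_measurable M. distr M borel w = \<nu> \<and>
      prob {\<omega> \<in> space M. \<bar>R t \<omega> - w \<omega>\<bar> > \<theta>} \<le> \<epsilon>"
  shows "tendsto_in_distribution M R \<nu> G"
  unfolding tendsto_in_distribution_def
proof (intro conjI meas allI impI)
  fix x assume "isCont (cdf \<nu>) x"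
  show "((\<lambda>t. cdf (distr M borel (R t)) x) \<longlongrightarrow> cdf \<nu> x) G"
  proof (rule tendstoI)
    fix \<epsilon> :: real assume \<epsilon>: "0 < \<epsilon>"
    obtain d where d: "0 < d" "\<And>y. dist y x < d \<Longrightarrow> dist (cdf \<nu> y) (cdf \<nu> x) < \<epsilon> / 2"
      using \<open>isCont (cdf \<nu>) x\<close> \<epsilon> half_gt_zero[OF \<epsilon>] unfolding continuous_at_eps_delta by metis
    define \<theta> where "\<theta> = d / 2"
    have \<theta>: "0 < \<theta>" using d(1) by (simp add: \<theta>_def)
    have near: "\<bar>cdf \<nu> (x + \<theta>) - cdf \<nu> x\<bar> < \<epsilon> / 2" "\<bar>cdf \<nu> (x - \<theta>) - cdf \<nu> x\<bar> < \<epsilon> / 2"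
      using d(2)[of "x + \<theta>"] d(2)[of "x - \<theta>"] d(1) by (auto simp: \<theta>_def dist_real_def)
    have "0 < \<epsilon> / 2" using \<epsilon> by simp
    from approx[OF \<theta> this] meas
    show "\<forall>\<^sub>F t in G. dist (cdf (distr M borel (R t)) x) (cdf \<nu> x) < \<epsilon>"
    proof eventually_elim
      case (elim t)
      then obtain w where w: "w \<in> borel_measurable M" "distr M borel w = \<nu>"
        "prob {\<omega> \<in> space M. \<bar>R t \<omega> - w \<omega>\<bar> > \<theta>} \<le> \<epsilon> / 2" by blast
      note [measurable] = w(1) elim(2)
      have cw: "cdf \<nu> y = prob {\<omega> \<in> space M. w \<omega> \<le> y}" for y
        unfolding w(2)[symmetric] cdf_def by (subst measure_distr) (auto simp: vimage_def Int_def conj_commute)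
      have cR: "cdf (distr M borel (R t)) x = prob {\<omega> \<in> space M. R t \<omega> \<le> x}"
        unfolding cdf_def by (subst measure_distr) (auto simp: vimage_def Int_def conj_commute)
      have "prob {\<omega> \<in> space M. R t \<omega> \<le> x}
          \<le> prob {\<omega> \<in> space M. w \<omega> \<le> x + \<theta>} + prob {\<omega> \<in> space M. \<bar>R t \<omega> - w \<omega>\<bar> > \<theta>}"
        by (rule prob_le_add[OF AE_I2]) auto
      then have up: "cdf (distr M borel (R t)) x \<le> cdf \<nu> (x + \<theta>) + \<epsilon> / 2" using w(3) by (simp add: cw cR)
      have "prob {\<omega> \<in> space M. w \<omega> \<le> x - \<theta>}
          \<le> prob {\<omega> \<in> space M. R t \<omega> \<le> x} + prob {\<omega> \<in> space M. \<bar>R t \<omega> - w \<omega>\<bar> > \<theta>}"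
        by (rule prob_le_add[OF AE_I2]) auto
      then have "cdf \<nu> (x - \<theta>) \<le> cdf (distr M borel (R t)) x + \<epsilon> / 2" using w(3) by (simp add: cw cR)
      then have "cdf \<nu> x - cdf (distr M borel (R t)) x < \<epsilon>" using near(2) by argo
      moreover have "cdf (distr M borel (R t)) x - cdf \<nu> x < \<epsilon>" using up near(1) by argo
      ultimately show ?case by (simp add: dist_real_def abs_less_iff)
    qed
  qed
qed

lemma (in complete_measure) measurable_AE_eq:
  fixes f g :: "'a \<Rightarrow> real"
  assumes "f \<in> borel_measurable M" "AE \<omega> in M. f \<omega> = g \<omega>"
  shows "g \<in> borel_measurable M"
proof (rule borel_measurableI_le)
  show "{\<omega> \<in> space M. g \<omega> \<le> x} \<in> sets M" for x
  proof (rule in_sets_AE)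
    show "AE \<omega> in M. \<omega> \<in> {\<omega> \<in> space M. f \<omega> \<le> x} \<longleftrightarrow> \<omega> \<in> {\<omega> \<in> space M. g \<omega> \<le> x}"
      using assms(2) by eventually_elim simp
    show "{\<omega> \<in> space M. f \<omega> \<le> x} \<in> sets M" using assms(1) by measurable
  qed auto
qed

text \<open>Completing the square shows that the log-likelihood has a unique maximum.\<close>

lemma mle_eq:
  assumes "0 < observed_information b \<sigma> X t \<omega>"
  shows "mle b \<sigma> X N t \<omega> = N t \<omega> / observed_information b \<sigma> X t \<omega>"
proof -
  define Q where "Q = observed_information b \<sigma> X t \<omega>"
  have Q: "0 < Q" using assms by (simp add: Q_def)
  have eq: "log_likelihood b \<sigma> X N t \<omega> \<theta> = (N t \<omega>)\<^sup>2 / (2 * Q) - Q / 2 * (\<theta> - N t \<omega> / Q)\<^sup>2" for \<theta>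
    unfolding log_likelihood_def Q_def[symmetric] using Q by (simp add: power2_eq_square field_simps)
  have le: "log_likelihood b \<sigma> X N t \<omega> \<theta> \<le> log_likelihood b \<sigma> X N t \<omega> (N t \<omega> / Q)" for \<theta>
    unfolding eq using Q by simp
  have lt: "log_likelihood b \<sigma> X N t \<omega> \<theta> < log_likelihood b \<sigma> X N t \<omega> (N t \<omega> / Q)" if "\<theta> \<noteq> N t \<omega> / Q" for \<theta>
    unfolding eq using Q that by simp
  have "is_arg_max (log_likelihood b \<sigma> X N t \<omega>) (\<lambda>_. True) \<theta> \<longleftrightarrow> \<theta> = N t \<omega> / Q" for \<theta>
    unfolding is_arg_max_def using le lt by (metis not_le)
  then have "is_arg_max (log_likelihood b \<sigma> X N t \<omega>) (\<lambda>_. True) = (\<lambda>\<theta>. \<theta> = N t \<omega> / Q)" by blast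
  then show ?thesis unfolding mle_def arg_max_def Q_def[symmetric] by simp
qed

section \<open>Comparison of an Ito integral with a multiple of a Wiener integral\<close>

context wiener_space
begin

lemma ito_integral_0:
  assumes "has_ito_integral M F T B H J"
  shows "AE \<omega> in M. J 0 \<omega> = 0"
proof -
  obtain h j where simple: "\<And>m. has_simple_ito_integral M F T B (h m) (j m)"
    and lim: "tendsto_in_probability M (\<lambda>m. j m 0) (J 0)"
    using assms zero_in_horizon unfolding has_ito_integral_def by blast
  have j0: "j m 0 \<omega> = 0" for m \<omega>
  proof -
    obtain n \<tau> \<xi> where \<tau>: "\<forall>i\<le>n. \<tau> i \<in> horizon T"
      and j: "j m = (\<lambda>t \<omega>. \<Sum>i<n. \<xi> i \<omega> * (B (min (\<tau> (Suc i)) t) \<omega> - B (min (\<tau> i) t) \<omega>))"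
      using simple[of m] unfolding has_simple_ito_integral_def by blast
    have "min (\<tau> i) 0 = 0" if "i \<le> n" for i using \<tau> that horizon_nonneg[of "\<tau> i"] by (simp add: min_def)
    then show ?thesis unfolding j by (intro sum.neutral) auto
  qed
  have [measurable]: "J 0 \<in> borel_measurable M" using lim by (simp add: tendsto_in_probability_def)
  have "prob {\<omega> \<in> space M. \<bar>J 0 \<omega>\<bar> > 1 / real (Suc k)} = 0" for k
  proof -
    have "(\<lambda>m. prob {\<omega> \<in> space M. \<bar>j m 0 \<omega> - J 0 \<omega>\<bar> > 1 / real (Suc k)}) \<longlonglongrightarrow> 0"
      using lim unfolding tendsto_in_probability_def by auto
    then show ?thesis unfolding j0 by (simp add: LIMSEQ_const_iff)
  qed
  then have "AE \<omega> in M. \<not> \<bar>J 0 \<omega>\<bar> > 1 / real (Suc k)" for k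
    by (intro AE_I[where N="{\<omega> \<in> space M. \<bar>J 0 \<omega>\<bar> > 1 / real (Suc k)}"]) (auto simp: emeasure_eq_measure)
  then have "AE \<omega> in M. \<forall>k. \<not> \<bar>J 0 \<omega>\<bar> > 1 / real (Suc k)" by (simp add: AE_all_countable)
  then show ?thesis
  proof eventually_elim
    case (elim \<omega>)
    show ?case
    proof (rule ccontr)
      assume "J 0 \<omega> \<noteq> 0"
      then obtain k where "inverse (real (Suc k)) < \<bar>J 0 \<omega>\<bar>" using reals_Archimedean[of "\<bar>J 0 \<omega>\<bar>"] by auto
      then show False using elim by (auto simp: inverse_eq_divide)
    qed
  qed
qed

text \<open>The comparison starts at \<open>q 0\<close>, the Ito integral at 0. A cell from 0 to \<open>q 0\<close> is put in front, with
  weight 1 for the Ito integral and coefficient 0 for the elementary one.\<close>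

lemma lenglart_past_multiple:
  assumes ito: "has_ito_integral M F T B H J" and t: "t \<in> horizon T"
    and q: "\<And>i. i < n \<Longrightarrow> q i \<le> q (Suc i)" "\<And>i. i \<le> n \<Longrightarrow> q i \<in> horizon T" "q n = t"
    and y: "y \<in> borel_measurable (F (q 0))"
    and pos: "0 < \<epsilon>" "0 < \<delta>"
  shows "prob {\<omega> \<in> space M. \<bar>J t \<omega> - y \<omega> * increment_sum n q c (\<lambda>s. B s \<omega>)\<bar> > 2 * \<epsilon>}
    \<le> \<delta> / \<epsilon>\<^sup>2 + prob {\<omega> \<in> space M. (LBINT s:{0..t}. (H s \<omega> - y \<omega> * step_fun n q c s)\<^sup>2) > \<delta> / 4}"
proof -
  define p where "p i = (case i of 0 \<Rightarrow> 0 | Suc k \<Rightarrow> q k)" for i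
  define d where "d i \<omega> = (case i of 0 \<Rightarrow> 0 | Suc k \<Rightarrow> c k * y \<omega>)" for i \<omega>
  have prog: "progressive F T H" using ito by (simp add: has_ito_integral_def)
  have p_mono: "p i \<le> p (Suc i)" if "i < Suc n" for i
    using that q(1) q(2)[of 0] horizon_nonneg by (cases i) (auto simp: p_def)
  have p_hor: "p i \<in> horizon T" if "i \<le> Suc n" for i
    using that q(2) zero_in_horizon by (cases i) (auto simp: p_def)
  have q0: "q 0 \<le> q k" if "k \<le> n" for k by (rule grid_mono[of n q 0 k]) (use q(1) that in auto)
  have d_meas: "d i \<in> borel_measurable (F (p i))" if "i < Suc n" for i
  proof (cases i)
    case 0
    then show ?thesis by (simp add: d_def[abs_def])
  next
    case (Suc k)
    then have "y \<in> borel_measurable (F (q k))"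
      using measurable_F_mono[OF y] q(2)[of 0] q(2)[of k] q0[of k] that by simp
    then show ?thesis using Suc by (simp add: d_def[abs_def] p_def)
  qed
  have telescope: "increment_sum (Suc n) p (\<lambda>_. 1) f = f t - f 0" for f
    using sum_lessThan_telescope[of "\<lambda>i. f (p i)" "Suc n"] q(3)
    by (simp add: increment_sum_def p_def del: sum.lessThan_Suc)
  have dB: "increment_sum (Suc n) p (\<lambda>i. d i \<omega>) f = y \<omega> * increment_sum n q c f" for \<omega> f
    by (simp add: increment_sum_def p_def d_def sum.lessThan_Suc_shift sum_distrib_left mult_ac del: sum.lessThan_Suc)
  have ds: "step_fun (Suc n) p (\<lambda>i. d i \<omega>) s = y \<omega> * step_fun n q c s" for \<omega> s
    by (simp only: step_fun_def p_def d_def sum.lessThan_Suc_shift sum_distrib_left nat.case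
        mult_zero_left add_0 mult.assoc mult.left_commute)
  have one: "step_fun (Suc n) p (\<lambda>_. 1) s = indicator {0<..t} s" for s
    using step_fun_const[of "Suc n" p 1 s] p_mono q(3) by (simp add: p_def)
  have int_eq: "(LBINT s:{0..t}. (step_fun (Suc n) p (\<lambda>_. 1) s * H s \<omega> - step_fun (Suc n) p (\<lambda>i. d i \<omega>) s)\<^sup>2)
      = (LBINT s:{0..t}. (H s \<omega> - y \<omega> * step_fun n q c s)\<^sup>2)" if "\<omega> \<in> space M" for \<omega>
    unfolding ds one set_lebesgue_integral_def
  proof (rule integral_cong_AE)
    have [measurable]: "(\<lambda>s. indicator {0..t} s * H s \<omega>) \<in> borel_measurable lborel"
      using progressive_section_measurable[OF prog t that] by (simp add: set_borel_measurable_def)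
    have "(\<lambda>s. indicator {0..t} s * (indicator {0<..t} s * (indicator {0..t} s * H s \<omega>) - y \<omega> * step_fun n q c s)\<^sup>2)
        \<in> borel_measurable lborel" by measurable
    also have "(\<lambda>s. indicator {0..t} s * (indicator {0<..t} s * (indicator {0..t} s * H s \<omega>) - y \<omega> * step_fun n q c s)\<^sup>2)
        = (\<lambda>s. indicator {0..t} s *\<^sub>R (indicator {0<..t} s * H s \<omega> - y \<omega> * step_fun n q c s)\<^sup>2)"
      by (auto simp: indicator_def)
    finally show "(\<lambda>s. indicator {0..t} s *\<^sub>R (indicator {0<..t} s * H s \<omega> - y \<omega> * step_fun n q c s)\<^sup>2)
        \<in> borel_measurable lborel" .
    have "(\<lambda>s. indicator {0..t} s * (indicator {0..t} s * H s \<omega> - y \<omega> * step_fun n q c s)\<^sup>2)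
        \<in> borel_measurable lborel" by measurable
    also have "(\<lambda>s. indicator {0..t} s * (indicator {0..t} s * H s \<omega> - y \<omega> * step_fun n q c s)\<^sup>2)
        = (\<lambda>s. indicator {0..t} s *\<^sub>R (H s \<omega> - y \<omega> * step_fun n q c s)\<^sup>2)"
      by (auto simp: indicator_def)
    finally show "(\<lambda>s. indicator {0..t} s *\<^sub>R (H s \<omega> - y \<omega> * step_fun n q c s)\<^sup>2) \<in> borel_measurable lborel" .
    show "AE s in lborel. indicator {0..t} s *\<^sub>R (indicator {0<..t} s * H s \<omega> - y \<omega> * step_fun n q c s)\<^sup>2
        = indicator {0..t} s *\<^sub>R (H s \<omega> - y \<omega> * step_fun n q c s)\<^sup>2"
      using AE_lborel_singleton[of 0] by eventually_elim (auto simp: indicator_def)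
  qed
  have Jm: "J s \<in> borel_measurable M" if "s \<in> horizon T" for s
    using ito that measurable_F_M[of "J s" s borel] unfolding has_ito_integral_def adapted_def by blast
  have incr: "(\<lambda>\<omega>. increment_sum (Suc n) p (\<lambda>i. d i \<omega>) (\<lambda>s. B s \<omega>)) \<in> borel_measurable M"
    using measurable_F_M[OF increment_sum_measurable[of "Suc n" p d, OF p_mono p_hor d_meas]] p_hor by blast
  note [measurable] = Jm[OF t] Jm[OF zero_in_horizon] incr[unfolded dB]
  have "prob {\<omega> \<in> space M. \<bar>J t \<omega> - y \<omega> * increment_sum n q c (\<lambda>s. B s \<omega>)\<bar> > 2 * \<epsilon>}
      = prob {\<omega> \<in> space M. \<bar>J t \<omega> - J 0 \<omega> - y \<omega> * increment_sum n q c (\<lambda>s. B s \<omega>)\<bar> > 2 * \<epsilon>}"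
    using ito_integral_0[OF ito] by (intro finite_measure_eq_AE) (auto elim!: eventually_mono)
  also have "\<dots> \<le> \<delta> / \<epsilon>\<^sup>2 + prob {\<omega> \<in> space M.
      (LBINT s:{0..t}. (step_fun (Suc n) p (\<lambda>_. 1) s * H s \<omega> - step_fun (Suc n) p (\<lambda>i. d i \<omega>) s)\<^sup>2) > \<delta> / 4}"
    using ito_lenglart[OF ito t, of "Suc n" p d \<epsilon> \<delta> "\<lambda>_. 1"] p_mono p_hor d_meas pos q(3)
    unfolding telescope dB by (simp add: p_def)
  also have "{\<omega> \<in> space M. (LBINT s:{0..t}. (step_fun (Suc n) p (\<lambda>_. 1) s * H s \<omega>
        - step_fun (Suc n) p (\<lambda>i. d i \<omega>) s)\<^sup>2) > \<delta> / 4}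
      = {\<omega> \<in> space M. (LBINT s:{0..t}. (H s \<omega> - y \<omega> * step_fun n q c s)\<^sup>2) > \<delta> / 4}"
    using int_eq by auto
  finally show ?thesis .
qed

end

section \<open>The score and the information\<close>

context wiener_space
begin

lemma horizon_unbounded:
  assumes "s \<in> horizon T"
  obtains u where "u \<in> horizon T" "s < u"
proof -
  have "ereal s < T" using assms by (simp add: horizon_def)
  then obtain u where "ereal s < ereal u" "ereal u < T" using ereal_dense2 by blast
  then show ?thesis using that[of u] assms by (auto simp: horizon_def)
qed

lemma upto_horizon_nontrivial: "upto_horizon T \<noteq> bot"
proof
  assume "upto_horizon T = bot"
  then have "eventually (\<lambda>_. False) (upto_horizon T)" by simp
  then obtain s where "s \<in> horizon T" "\<forall>t\<in>horizon T. s < t \<longrightarrow> False"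
    unfolding eventually_upto_horizon[OF horizon_pos] by blast
  then show False using horizon_unbounded by blast
qed

lemma squared_error_measurable:
  assumes prog: "progressive F T H" and t: "t \<in> horizon T"
    and y [measurable]: "y \<in> borel_measurable M" and c [measurable]: "c \<in> borel_measurable borel"
  shows "(\<lambda>(\<omega>, s). indicator {0..t} s * (H s \<omega> - y \<omega> * c s)\<^sup>2) \<in> borel_measurable (M \<Otimes>\<^sub>M lborel)"
    and "(\<lambda>\<omega>. LBINT s:{0..t}. (H s \<omega> - y \<omega> * c s)\<^sup>2) \<in> borel_measurable M"
proof -
  have [measurable]: "(\<lambda>x. indicator {0..t} (snd x) * H (snd x) (fst x)) \<in> borel_measurable (M \<Otimes>\<^sub>M lborel)"
    using progressive_jointly_measurable[OF prog t] by (simp add: split_beta')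
  have "(\<lambda>x. indicator {0..t} (snd x) * (indicator {0..t} (snd x) * H (snd x) (fst x) - y (fst x) * c (snd x))\<^sup>2)
      \<in> borel_measurable (M \<Otimes>\<^sub>M lborel)" by measurable
  also have "(\<lambda>x. indicator {0..t} (snd x) * (indicator {0..t} (snd x) * H (snd x) (fst x) - y (fst x) * c (snd x))\<^sup>2)
      = (\<lambda>(\<omega>, s). indicator {0..t} s * (H s \<omega> - y \<omega> * c s)\<^sup>2)"
    by (auto simp: indicator_def)
  finally show m: "(\<lambda>(\<omega>, s). indicator {0..t} s * (H s \<omega> - y \<omega> * c s)\<^sup>2) \<in> borel_measurable (M \<Otimes>\<^sub>M lborel)" .
  from lborel.borel_measurable_lebesgue_integral[OF m]
  show "(\<lambda>\<omega>. LBINT s:{0..t}. (H s \<omega> - y \<omega> * c s)\<^sup>2) \<in> borel_measurable M"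
    by (simp add: set_lebesgue_integral_def)
qed

end

context linear_sde
begin

text \<open>On the horizon the score is the product of this deterministic factor with the discounted solution.\<close>

definition signal :: "real \<Rightarrow> real" where
  "signal s = b s / (\<sigma> s * discount s)"

definition signal_energy :: "real \<Rightarrow> real" where
  "signal_energy t = (LBINT s:{0..t}. (signal s)\<^sup>2)"

text \<open>On the horizon this is \<open>b X / \<sigma>\<close>. It is written as the product of the integrand of the estimator with
  \<open>\<sigma>\<close>, the form in which it occurs in an integral with respect to \<open>X\<close>.\<close>

definition score :: "real \<Rightarrow> 'a \<Rightarrow> real" where
  "score s \<omega> = b s * X s \<omega> / (\<sigma> s)\<^sup>2 * \<sigma> s"

lemma score_eq: "s \<in> horizon T \<Longrightarrow> score s \<omega> = signal s * discounted s \<omega>"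
  using \<sigma>_pos[of s] discount_pos[of s]
  by (simp add: score_def signal_def discounted_def power2_eq_square)

lemma signal_cont:
  assumes "t \<in> horizon T" "0 \<le> a"
  shows "continuous_on {a..t} signal"
  unfolding signal_def[abs_def]
proof (intro continuous_on_divide weight_cont assms ballI)
  show "continuous_on {a..t} b" by (rule continuous_on_Icc[OF b_cont assms])
  fix s assume "s \<in> {a..t}"
  then have "s \<in> horizon T" using horizon_downward assms by auto
  then show "\<sigma> s * discount s \<noteq> 0" using \<sigma>_pos[of s] discount_pos[of s] by simp
qed

lemma signal_energy_integrable:
  "t \<in> horizon T \<Longrightarrow> 0 \<le> a \<Longrightarrow> set_integrable lborel {a..t} (\<lambda>s. (signal s)\<^sup>2)"
  using signal_cont by (intro borel_integrable_atLeastAtMost' continuous_on_power)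

lemma signal_energy_diff:
  assumes "t \<in> horizon T" "0 \<le> a" "a \<le> t"
  shows "signal_energy t - signal_energy a = (LBINT s:{a..t}. (signal s)\<^sup>2)"
  using set_integral_combine[OF assms(2,3) signal_energy_integrable[OF assms(1)]]
  by (simp add: signal_energy_def)

lemma score_square_integrable:
  assumes "t \<in> horizon T" "\<omega> \<in> space M"
  shows "square_integrable_on {0..t} (\<lambda>s. score s \<omega>)"
proof (rule square_integrable_on_continuous)
  have "continuous_on {0..t} (\<lambda>s. signal s * (discount s * X s \<omega>))"
    using assms by (intro continuous_intros signal_cont discount_cont continuous_on_Icc[OF X_cont]) auto
  moreover have "score s \<omega> = signal s * (discount s * X s \<omega>)" if "s \<in> {0..t}" for s
    using score_eq horizon_downward[OF assms(1)] that by (simp add: discounted_def)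
  ultimately show "continuous_on {0..t} (\<lambda>s. score s \<omega>)" using continuous_on_eq by fastforce
qed

text \<open>Freezing the discounted solution at time \<open>a\<close> costs little in mean square: its later increments have
  variance at most \<open>L - variance_clock a\<close>. Before \<open>a\<close> the step function vanishes, and the whole score
  is counted as error; this part does not grow with \<open>t\<close>.\<close>

lemma frozen_score_error:
  assumes prog: "progressive F T score" and t: "t \<in> horizon T" and a: "0 \<le> a" "a < t"
    and q: "\<And>i. i < n \<Longrightarrow> q i \<le> q (Suc i)" "q 0 = a" "q n = t"
    and \<kappa>: "\<And>s. a < s \<Longrightarrow> s \<le> t \<Longrightarrow> \<bar>signal s - step_fun n q c s\<bar> \<le> \<kappa>" "0 \<le> \<kappa>"
    and L: "\<And>s. s \<in> horizon T \<Longrightarrow> variance_clock s \<le> L" and \<delta>: "0 < \<delta>"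
  shows "prob {\<omega> \<in> space M. (LBINT s:{0..t}. (score s \<omega> - discounted a \<omega> * step_fun n q c s)\<^sup>2) > \<delta>}
    \<le> (L * signal_energy a + 2 * (L - variance_clock a) * (signal_energy t - signal_energy a)
        + 2 * L * \<kappa>\<^sup>2 * (t - a)) / \<delta>"
proof -
  define \<gamma> where "\<gamma> = step_fun n q c"
  define f where "f \<omega> s = indicator {0..t} s * (score s \<omega> - discounted a \<omega> * \<gamma> s)\<^sup>2" for \<omega> s
  define A where "A \<omega> = (LBINT s:{0..t}. (score s \<omega> - discounted a \<omega> * \<gamma> s)\<^sup>2)" for \<omega>
  define bound where "bound s = indicator {0..a} s * (L * (signal s)\<^sup>2)
    + indicator {a..t} s * (2 * (L - variance_clock a) * (signal s)\<^sup>2 + 2 * L * \<kappa>\<^sup>2)" for s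
  define R where "R = L * signal_energy a + 2 * (L - variance_clock a) * (signal_energy t - signal_energy a)
        + 2 * L * \<kappa>\<^sup>2 * (t - a)"
  have ah: "a \<in> horizon T" using horizon_downward t a by auto
  have Va: "variance_clock a \<le> L" by (rule L[OF ah])
  have "0 \<le> variance_clock a" using variance_clock_mono[OF ah order_refl a(1)] by (simp add: variance_clock_0)
  then have L0: "0 \<le> L" using Va by linarith
  have dm [measurable]: "discounted s \<in> borel_measurable M" if "s \<in> horizon T" for s
    using measurable_F_M[OF discounted_measurable[OF that] that] .
  have \<gamma>m: "\<gamma> \<in> borel_measurable borel" unfolding \<gamma>_def by measurable
  note meas = squared_error_measurable[OF prog t dm[OF ah] \<gamma>m]
  have fm [measurable]: "(\<lambda>x. f (fst x) (snd x)) \<in> borel_measurable (M \<Otimes>\<^sub>M lborel)"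
    using meas(1) by (simp add: f_def split_beta')
  have Am [measurable]: "A \<in> borel_measurable M" using meas(2) unfolding A_def[abs_def] .
  have f0: "0 \<le> f \<omega> s" for \<omega> s by (simp add: f_def)
  have A0: "0 \<le> A \<omega>" for \<omega>
    unfolding A_def set_lebesgue_integral_def by (intro Bochner_Integration.integral_nonneg) auto
  have inner: "(\<integral>\<^sup>+s. ennreal (f \<omega> s) \<partial>lborel) = ennreal (A \<omega>)" if "\<omega> \<in> space M" for \<omega>
  proof -
    have "square_integrable_on {0..t} (\<lambda>s. score s \<omega> - discounted a \<omega> * \<gamma> s)"
      unfolding \<gamma>_def
      by (intro square_integrable_on_diff square_integrable_on_cmult score_square_integrable t that
          square_integrable_on_step_fun)
    then have "integrable lborel (f \<omega>)"
      by (simp add: square_integrable_on_def set_integrable_def f_def[abs_def])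
    then have "(\<integral>\<^sup>+s. ennreal (f \<omega> s) \<partial>lborel) = ennreal (\<integral>s. f \<omega> s \<partial>lborel)"
      by (intro nn_integral_eq_integral) (auto simp: f0)
    then show ?thesis by (simp add: A_def set_lebesgue_integral_def f_def)
  qed
  have slice: "(\<integral>\<^sup>+\<omega>. ennreal (f \<omega> s) \<partial>M) \<le> ennreal (bound s)" for s
  proof -
    consider "s \<notin> {0..t}" | "s \<in> {0..a}" | "a < s" "s \<le> t" by fastforce
    then show ?thesis
    proof cases
      case 1
      then show ?thesis by (simp add: f_def)
    next
      case 2
      then have sh: "s \<in> horizon T" using horizon_downward[OF ah] by auto
      have "\<gamma> s = 0" unfolding \<gamma>_def using step_fun_outside[of n q s c] q 2 by simp
      then have eq: "f \<omega> s = (signal s)\<^sup>2 * (discounted s \<omega>)\<^sup>2" for \<omega>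
        using 2 a by (simp add: f_def score_eq[OF sh] power_mult_distrib)
      have "(\<integral>\<^sup>+\<omega>. ennreal (f \<omega> s) \<partial>M) = ennreal (expectation (\<lambda>\<omega>. (signal s)\<^sup>2 * (discounted s \<omega>)\<^sup>2))"
        unfolding eq using discounted_second_moment_0[OF sh] by (intro nn_integral_eq_integral) auto
      also have "expectation (\<lambda>\<omega>. (signal s)\<^sup>2 * (discounted s \<omega>)\<^sup>2) \<le> (signal s)\<^sup>2 * L"
        using discounted_second_moment_0(2)[OF sh] L[OF sh] by (simp add: mult_left_mono)
      also have "\<dots> \<le> bound s"
        using 2 L0 Va by (simp add: bound_def mult.commute indicator_def)
      finally show ?thesis by (simp add: ennreal_leI)
    next
      case 3
      then have sh: "s \<in> horizon T" using horizon_downward[OF t] a by auto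
      have le: "f \<omega> s \<le> 2 * (signal s)\<^sup>2 * (discounted s \<omega> - discounted a \<omega>)\<^sup>2 + 2 * \<kappa>\<^sup>2 * (discounted a \<omega>)\<^sup>2" for \<omega>
      proof -
        define u v where "u = signal s * (discounted s \<omega> - discounted a \<omega>)"
          and "v = (signal s - \<gamma> s) * discounted a \<omega>"
        have "f \<omega> s = (u + v)\<^sup>2"
          using 3 a by (simp add: f_def score_eq[OF sh] u_def v_def algebra_simps)
        also have "\<dots> \<le> 2 * u\<^sup>2 + 2 * v\<^sup>2"
          using sum_squares_bound[of u v] by (simp add: power2_sum)
        also have "v\<^sup>2 \<le> \<kappa>\<^sup>2 * (discounted a \<omega>)\<^sup>2"
        proof -
          have "(signal s - \<gamma> s)\<^sup>2 \<le> \<kappa>\<^sup>2"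
            using \<kappa>(1)[OF 3] \<kappa>(2) power_mono[of "\<bar>signal s - \<gamma> s\<bar>" \<kappa> 2] by (simp add: \<gamma>_def)
          then show ?thesis unfolding v_def power_mult_distrib by (rule mult_right_mono) simp
        qed
        finally show ?thesis by (simp add: u_def power_mult_distrib mult.assoc)
      qed
      note m1 = discounted_second_moment[OF sh a(1) less_imp_le[OF 3(1)]]
      note m2 = discounted_second_moment_0[OF ah]
      have "(\<integral>\<^sup>+\<omega>. ennreal (f \<omega> s) \<partial>M) \<le> (\<integral>\<^sup>+\<omega>. ennreal (2 * (signal s)\<^sup>2 * (discounted s \<omega> - discounted a \<omega>)\<^sup>2
          + 2 * \<kappa>\<^sup>2 * (discounted a \<omega>)\<^sup>2) \<partial>M)"
        using le by (intro nn_integral_mono ennreal_leI) auto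
      also have "\<dots> = ennreal (expectation (\<lambda>\<omega>. 2 * (signal s)\<^sup>2 * (discounted s \<omega> - discounted a \<omega>)\<^sup>2
          + 2 * \<kappa>\<^sup>2 * (discounted a \<omega>)\<^sup>2))"
        using m1 m2 by (intro nn_integral_eq_integral) auto
      also have "expectation (\<lambda>\<omega>. 2 * (signal s)\<^sup>2 * (discounted s \<omega> - discounted a \<omega>)\<^sup>2
          + 2 * \<kappa>\<^sup>2 * (discounted a \<omega>)\<^sup>2)
          = 2 * (signal s)\<^sup>2 * expectation (\<lambda>\<omega>. (discounted s \<omega> - discounted a \<omega>)\<^sup>2)
            + 2 * \<kappa>\<^sup>2 * expectation (\<lambda>\<omega>. (discounted a \<omega>)\<^sup>2)"
        using m1 m2 by simp
      also have "\<dots> \<le> 2 * (signal s)\<^sup>2 * (L - variance_clock a) + 2 * \<kappa>\<^sup>2 * L"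
        using m1(2) m2(2) L[OF sh] Va by (intro add_mono mult_left_mono) auto
      also have "\<dots> = bound s" using 3 a by (simp add: bound_def indicator_def mult_ac)
      finally show ?thesis by (simp add: ennreal_leI)
    qed
  qed
  have const: "set_integrable lborel {a..t} (\<lambda>s. k)" for k :: real
    by (rule borel_integrable_atLeastAtMost') auto
  have i1: "set_integrable lborel {0..a} (\<lambda>s. L * (signal s)\<^sup>2)"
    using signal_energy_integrable[OF ah, of 0] by simp
  have i2: "set_integrable lborel {a..t} (\<lambda>s. 2 * (L - variance_clock a) * (signal s)\<^sup>2)"
    using signal_energy_integrable[OF t a(1)] by simp
  have bi: "integrable lborel bound"
    unfolding bound_def[abs_def]
    using i1 set_integral_add(1)[OF i2 const[of "2 * L * \<kappa>\<^sup>2"]]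
    by (intro Bochner_Integration.integrable_add) (simp_all add: set_integrable_def)
  have "(\<integral>s. bound s \<partial>lborel) = (LBINT s:{0..a}. L * (signal s)\<^sup>2)
      + (LBINT s:{a..t}. 2 * (L - variance_clock a) * (signal s)\<^sup>2 + 2 * L * \<kappa>\<^sup>2)"
    unfolding bound_def using i1 set_integral_add(1)[OF i2 const[of "2 * L * \<kappa>\<^sup>2"]]
    unfolding set_integrable_def set_lebesgue_integral_def real_scaleR_def
    by (rule Bochner_Integration.integral_add)
  also have "\<dots> = (LBINT s:{0..a}. L * (signal s)\<^sup>2)
      + ((LBINT s:{a..t}. 2 * (L - variance_clock a) * (signal s)\<^sup>2) + (LBINT s:{a..t}. 2 * L * \<kappa>\<^sup>2))"
    using set_integral_add(2)[OF i2 const[of "2 * L * \<kappa>\<^sup>2"]] by simp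
  also have "(LBINT s:{a..t}. 2 * L * \<kappa>\<^sup>2) = 2 * L * \<kappa>\<^sup>2 * (t - a)"
    using a by (simp add: set_lebesgue_integral_def)
  finally have bint: "(\<integral>s. bound s \<partial>lborel) = R"
    using signal_energy_diff[OF t a(1) less_imp_le[OF a(2)]] by (simp add: R_def signal_energy_def)
  have b0: "0 \<le> bound s" for s using L0 Va by (simp add: bound_def)
  have R0: "0 \<le> R" unfolding bint[symmetric] using b0 by (rule Bochner_Integration.integral_nonneg)
  interpret P: pair_sigma_finite M lborel ..
  have "(\<integral>\<^sup>+\<omega>. ennreal (A \<omega>) \<partial>M) = (\<integral>\<^sup>+\<omega>. (\<integral>\<^sup>+s. ennreal (f \<omega> s) \<partial>lborel) \<partial>M)"
    using inner by (intro nn_integral_cong) simp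
  also have "\<dots> = (\<integral>\<^sup>+s. (\<integral>\<^sup>+\<omega>. ennreal (f \<omega> s) \<partial>M) \<partial>lborel)"
    using P.Fubini[of "\<lambda>x. ennreal (f (fst x) (snd x))"] by simp
  also have "\<dots> \<le> (\<integral>\<^sup>+s. ennreal (bound s) \<partial>lborel)" by (intro nn_integral_mono slice)
  also have "\<dots> = ennreal R" using nn_integral_eq_integral[OF bi] b0 bint by simp
  finally have nn: "(\<integral>\<^sup>+\<omega>. ennreal (A \<omega>) \<partial>M) \<le> ennreal R" .
  have Ai: "integrable M A"
    using le_less_trans[OF nn ennreal_less_top] A0 by (intro integrableI_nonneg) auto
  have EA: "expectation A \<le> R"
    using nn nn_integral_eq_integral[OF Ai] A0 R0 by (simp add: ennreal_le_iff)
  have "prob {\<omega> \<in> space M. A \<omega> > \<delta>} \<le> prob {\<omega> \<in> space M. \<delta> \<le> A \<omega>}"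
    by (intro finite_measure_mono) auto
  also have "\<dots> \<le> expectation A / \<delta>"
    using integral_Markov_inequality_measure[OF Ai _ _ \<delta>, of "{}"] A0 by simp
  also have "\<dots> \<le> R / \<delta>" using EA \<delta> by (simp add: divide_right_mono)
  finally show ?thesis by (simp add: A_def R_def \<gamma>_def)
qed

lemma score_energy_measurable:
  assumes "progressive F T score" "t \<in> horizon T"
  shows "(\<lambda>\<omega>. LBINT s:{0..t}. (score s \<omega>)\<^sup>2) \<in> borel_measurable M"
proof -
  have "(\<lambda>\<omega>. LBINT s:{0..t}. (score s \<omega> - 0 * 0)\<^sup>2) \<in> borel_measurable M"
    by (rule squared_error_measurable(2)[OF assms, where y="\<lambda>_. 0" and c="\<lambda>_. 0"]; rule borel_measurable_const)
  then show ?thesis unfolding mult_zero_left diff_zero .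
qed

text \<open>The second moment of the discounted solution at a time is at most the variance clock, hence at most
  \<open>L\<close>. If the integrand of the Fisher
  information is not integrable, the integral has the default value 0 and the bound persists.\<close>

lemma fisher_information_le:
  assumes t: "t \<in> horizon T" and L: "\<And>s. s \<in> horizon T \<Longrightarrow> variance_clock s \<le> L"
  shows "fisher_information M b \<sigma> X t \<le> L * signal_energy t"
proof -
  have "0 \<le> L" using L[OF zero_in_horizon] by (simp add: variance_clock_0)
  have le: "(b s)\<^sup>2 * expectation (\<lambda>\<omega>. (X s \<omega>)\<^sup>2) / (\<sigma> s)\<^sup>2 \<le> L * (signal s)\<^sup>2" if "s \<in> {0..t}" for s
  proof -
    have sh: "s \<in> horizon T" using that horizon_downward[OF t] by auto
    have "expectation (\<lambda>\<omega>. (discounted s \<omega>)\<^sup>2) = (discount s)\<^sup>2 * expectation (\<lambda>\<omega>. (X s \<omega>)\<^sup>2)"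
      by (simp add: discounted_def power_mult_distrib)
    then have "(discount s)\<^sup>2 * expectation (\<lambda>\<omega>. (X s \<omega>)\<^sup>2) \<le> L"
      using discounted_second_moment_0(2)[OF sh] L[OF sh] by simp
    then have "(signal s)\<^sup>2 * ((discount s)\<^sup>2 * expectation (\<lambda>\<omega>. (X s \<omega>)\<^sup>2)) \<le> (signal s)\<^sup>2 * L"
      by (rule mult_left_mono) simp
    then show ?thesis
      using \<sigma>_pos[OF sh] discount_pos[of s] by (simp add: signal_def power_mult_distrib power_divide mult.commute)
  qed
  have int: "set_integrable lborel {0..t} (\<lambda>s. L * (signal s)\<^sup>2)"
    using signal_energy_integrable[OF t, of 0] by simp
  have "0 \<le> signal_energy t"
    unfolding signal_energy_def set_lebesgue_integral_def by (intro Bochner_Integration.integral_nonneg) auto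
  show ?thesis
  proof (cases "set_integrable lborel {0..t} (\<lambda>s. (b s)\<^sup>2 * expectation (\<lambda>\<omega>. (X s \<omega>)\<^sup>2) / (\<sigma> s)\<^sup>2)")
    case True
    then have "fisher_information M b \<sigma> X t \<le> (LBINT s:{0..t}. L * (signal s)\<^sup>2)"
      unfolding fisher_information_def using le int by (intro set_integral_mono) auto
    then show ?thesis by (simp add: signal_energy_def)
  next
    case False
    then have "fisher_information M b \<sigma> X t = 0"
      unfolding fisher_information_def set_integrable_def set_lebesgue_integral_def
      by (rule not_integrable_integral_eq)
    then show ?thesis using \<open>0 \<le> L\<close> \<open>0 \<le> signal_energy t\<close> by simp
  qed
qed

end

section \<open>Asymptotic normality of the studentized score\<close>

context linear_sde
begin

lemma variance_clock_le_limit: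
  assumes "(variance_clock \<longlongrightarrow> L) (upto_horizon T)" "s \<in> horizon T"
  shows "variance_clock s \<le> L"
proof (rule tendsto_lowerbound[OF assms(1) _ upto_horizon_nontrivial])
  show "\<forall>\<^sub>F t in upto_horizon T. variance_clock s \<le> variance_clock t"
    unfolding eventually_upto_horizon[OF horizon_pos]
    using assms(2) variance_clock_mono horizon_nonneg by (intro bexI[of _ s]) auto
qed

text \<open>The time \<open>a\<close> is chosen first, so late that the discounted solution hardly moves afterwards; then \<open>t\<close>
  is taken so large that the energy of the signal before \<open>a\<close> is negligible. The score integral is now
  close to \<open>discounted a\<close> times the Wiener integral of \<open>signal\<close> over \<open>{a..t}\<close>, which is independent of
  the past of \<open>a\<close>. Normalisation by the root of the observed information removes the modulus of
  \<open>discounted a\<close>, and the sign that is left does not change the normal law.\<close>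

lemma studentized_score_near_normal:
  assumes J: "has_ito_integral M F T B score J"
    and b_nz: "t\<^sub>0 \<in> horizon T" "0 < t\<^sub>0" "\<And>s. s \<in> horizon T \<Longrightarrow> t\<^sub>0 \<le> s \<Longrightarrow> b s \<noteq> 0"
    and energy: "filterlim signal_energy at_top (upto_horizon T)"
    and L: "(variance_clock \<longlongrightarrow> L) (upto_horizon T)"
    and \<theta>: "0 < \<theta>" and \<epsilon>: "0 < \<epsilon>"
  shows "\<forall>\<^sub>F t in upto_horizon T. \<exists>w\<in>borel_measurable M. distr M borel w = std_normal_distribution \<and>
    prob {\<omega> \<in> space M. \<bar>J t \<omega> / sqrt (LBINT s:{0..t}. (score s \<omega>)\<^sup>2) - w \<omega>\<bar> > \<theta>} \<le> \<epsilon>"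
proof -
  have prog: "progressive F T score" using J by (simp add: has_ito_integral_def)
  have VL: "variance_clock s \<le> L" if "s \<in> horizon T" for s using variance_clock_le_limit[OF L that] .
  have V0: "0 < variance_clock t\<^sub>0" by (rule variance_clock_pos[OF b_nz(1,2)])
  have L0: "0 < L" using V0 VL[OF b_nz(1)] by linarith
  \<comment> \<open>\<open>\<eta>\<close> bounds the discounted solution away from 0 and \<open>K\<close> bounds the normal variable, each up to
    probability \<open>\<epsilon> / 4\<close>; \<open>\<epsilon>1\<close> and \<open>\<delta>\<close> are the relative precisions of the score integral and of the
    score that these bounds require. They hold up to probability \<open>\<epsilon> / 4\<close> and \<open>\<epsilon> / 8\<close>.\<close>
  define \<eta> where "\<eta> = \<epsilon> * sqrt (variance_clock t\<^sub>0) / 16"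
  define K where "K = 2 / sqrt \<epsilon>"
  define \<epsilon>1 where "\<epsilon>1 = \<theta> * \<eta> / 8"
  define \<delta> where "\<delta> = min (min (\<eta> / 2) (\<theta> * \<eta> / (4 * K))) (sqrt (\<epsilon> / 32) * \<epsilon>1)"
  have \<eta>: "0 < \<eta>" using \<epsilon> V0 by (simp add: \<eta>_def)
  have K: "0 < K" "1 / K\<^sup>2 = \<epsilon> / 4" using \<epsilon> by (simp_all add: K_def power_divide)
  have \<epsilon>1: "0 < \<epsilon>1" using \<theta> \<eta> by (simp add: \<epsilon>1_def)
  have \<delta>: "0 < \<delta>" "\<delta> \<le> \<eta> / 2" "\<delta> \<le> \<theta> * \<eta> / (4 * K)" "\<delta> \<le> sqrt (\<epsilon> / 32) * \<epsilon>1"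
    using \<eta> \<theta> K \<epsilon>1 \<epsilon> by (auto simp: \<delta>_def)
  have \<delta>K: "2 * \<epsilon>1 + K * \<delta> \<le> \<theta> * \<eta> / 2"
  proof -
    have "K * \<delta> \<le> K * (\<theta> * \<eta> / (4 * K))" using K \<delta>(3) by (intro mult_left_mono) auto
    also have "\<dots> = \<theta> * \<eta> / 4" using K by simp
    finally show ?thesis unfolding \<epsilon>1_def by linarith
  qed
  have \<delta>\<epsilon>: "4 * \<delta>\<^sup>2 / \<epsilon>1\<^sup>2 \<le> \<epsilon> / 8"
  proof -
    have "\<delta>\<^sup>2 \<le> (sqrt (\<epsilon> / 32) * \<epsilon>1)\<^sup>2" using \<delta> by (intro power_mono) auto
    also have "\<dots> = \<epsilon> / 32 * \<epsilon>1\<^sup>2" using \<epsilon> by (simp add: power_mult_distrib)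
    finally show ?thesis using \<epsilon>1 by (simp add: field_simps)
  qed
  have "\<forall>\<^sub>F s in upto_horizon T. L - \<epsilon> * \<delta>\<^sup>2 / 128 < variance_clock s"
    using \<epsilon> \<delta>(1) by (intro order_tendstoD(1)[OF L]) simp
  then obtain s1 where s1: "s1 \<in> horizon T" "\<And>s. s \<in> horizon T \<Longrightarrow> s1 < s \<Longrightarrow> L - \<epsilon> * \<delta>\<^sup>2 / 128 < variance_clock s"
    unfolding eventually_upto_horizon[OF horizon_pos] by blast
  have "max s1 t\<^sub>0 \<in> horizon T" using s1(1) b_nz(1) by (simp add: max_def)
  then obtain a where a: "a \<in> horizon T" "s1 < a" "t\<^sub>0 < a" using horizon_unbounded by (metis max_less_iff_conj)
  have a0: "0 < a" "0 \<le> a" using a b_nz by auto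
  define \<rho> where "\<rho> = L - variance_clock a"
  have \<rho>: "0 \<le> \<rho>" "\<rho> \<le> \<epsilon> * \<delta>\<^sup>2 / 128" using VL[OF a(1)] s1(2)[OF a(1,2)] by (auto simp: \<rho>_def)
  define y where "y = discounted a"
  have yF: "y \<in> borel_measurable (F a)" unfolding y_def by (rule discounted_measurable[OF a(1)])
  have ym [measurable]: "y \<in> borel_measurable M" using measurable_F_M[OF yF a(1)] .
  define U where "U \<omega> = (if 0 \<le> y \<omega> then 1 else -1 :: real)" for \<omega>
  have UF: "U \<in> borel_measurable (F a)" unfolding U_def[abs_def] using yF by measurable
  have Um [measurable]: "U \<in> borel_measurable M" using measurable_F_M[OF UF a(1)] .
  have small_y: "prob {\<omega> \<in> space M. \<bar>y \<omega>\<bar> \<le> \<eta>} \<le> \<epsilon> / 4"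
  proof -
    have "prob {\<omega> \<in> space M. \<bar>y \<omega>\<bar> \<le> \<eta>} \<le> 4 * \<eta> / sqrt (variance_clock a)"
      unfolding y_def by (rule discounted_small_ball[OF a(1) a0(1) \<eta>])
    also have "\<dots> \<le> 4 * \<eta> / sqrt (variance_clock t\<^sub>0)"
      using V0 \<eta> variance_clock_mono[OF a(1), of t\<^sub>0] a b_nz by (intro divide_left_mono) auto
    also have "\<dots> = \<epsilon> / 4" using V0 by (simp add: \<eta>_def)
    finally show ?thesis .
  qed
  \<comment> \<open>the summand 4 guarantees that discretisation keeps a quarter of the energy, and the last summand
    makes the energy before \<open>a\<close> negligible\<close>
  define C where "C = signal_energy a + 4 + 64 * (L * signal_energy a + 1) / (\<epsilon> * \<delta>\<^sup>2)"
  have "\<forall>\<^sub>F t in upto_horizon T. C \<le> signal_energy t"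
    using energy unfolding filterlim_at_top by blast
  moreover have "\<forall>\<^sub>F t in upto_horizon T. t \<in> horizon T \<and> a < t"
    unfolding eventually_upto_horizon[OF horizon_pos] using a(1) by blast
  ultimately show ?thesis
  proof eventually_elim
    case (elim t)
    then have t: "t \<in> horizon T" and at: "a < t" and C: "C \<le> signal_energy t" by auto
    define \<Gamma> where "\<Gamma> = signal_energy t - signal_energy a"
    have Ga: "0 \<le> signal_energy a"
      unfolding signal_energy_def set_lebesgue_integral_def by (intro Bochner_Integration.integral_nonneg) auto
    have e\<delta>: "0 < \<epsilon> * \<delta>\<^sup>2" using \<epsilon> \<delta>(1) by simp
    have \<Gamma>: "4 \<le> \<Gamma>" "64 * (L * signal_energy a + 1) / (\<epsilon> * \<delta>\<^sup>2) \<le> \<Gamma>"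
    proof -
      have "0 \<le> L * signal_energy a" using L0 Ga by simp
      then have "0 \<le> 64 * (L * signal_energy a + 1) / (\<epsilon> * \<delta>\<^sup>2)" using e\<delta> by simp
      then show "4 \<le> \<Gamma>" "64 * (L * signal_energy a + 1) / (\<epsilon> * \<delta>\<^sup>2) \<le> \<Gamma>"
        using C Ga unfolding C_def \<Gamma>_def by linarith+
    qed
    \<comment> \<open>\<open>\<kappa>\<close> makes both \<open>2 * L * \<kappa>\<^sup>2 * (t - a)\<close> and \<open>\<kappa>\<^sup>2 * (t - a)\<close> at most 1, however long the
      interval is\<close>
    define E where "E = (t - a) * (2 * L + 1)"
    have E0: "0 < E" using L0 at by (simp add: E_def)
    define \<kappa> where "\<kappa> = sqrt (1 / E)"
    have \<kappa>0: "0 < \<kappa>" using E0 by (simp add: \<kappa>_def)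
    have "\<kappa>\<^sup>2 * E = 1" using E0 by (simp add: \<kappa>_def)
    then have "\<kappa>\<^sup>2 * (t - a) * (2 * L + 1) = 1" by (simp add: E_def mult.assoc)
    then have \<kappa>: "2 * L * \<kappa>\<^sup>2 * (t - a) + \<kappa>\<^sup>2 * (t - a) = 1" by (simp add: algebra_simps)
    have \<kappa>nn: "0 \<le> 2 * L * \<kappa>\<^sup>2 * (t - a)" "0 \<le> \<kappa>\<^sup>2 * (t - a)" using L0 at by auto
    have \<kappa>1: "2 * L * \<kappa>\<^sup>2 * (t - a) \<le> 1" "\<kappa>\<^sup>2 * (t - a) \<le> 1" using \<kappa> \<kappa>nn by linarith+
    obtain n where n: "0 < n" and osc: "\<forall>i<n. \<forall>r\<in>{uniform_grid a t n i..uniform_grid a t n (Suc i)}.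
        \<forall>s\<in>{uniform_grid a t n i..uniform_grid a t n (Suc i)}. \<bar>signal r - signal s\<bar> \<le> \<kappa>"
      using eventually_happens[OF uniform_grid_oscillation[OF signal_cont[OF t a0(2)] at \<kappa>0]] by auto
    define q where "q = uniform_grid a t n"
    define c where "c i = signal (q i)" for i
    define \<gamma> where "\<gamma> = step_fun n q c"
    define W where "W \<omega> = increment_sum n q c (\<lambda>s. B s \<omega>)" for \<omega>
    define V where "V = (\<Sum>i<n. (c i)\<^sup>2 * (q (Suc i) - q i))"
    define r where "r = sqrt V"
    have q_less: "q i < q (Suc i)" for i unfolding q_def by (rule uniform_grid_less[OF at n])
    have q_le: "\<And>i. i < n \<Longrightarrow> q i \<le> q (Suc i)" using q_less by (simp add: less_imp_le)
    have q0: "q 0 = a" "q n = t" using n by (auto simp: q_def)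
    have q_ge: "a \<le> q i" "q i \<in> horizon T" if "i \<le> n" for i
      using uniform_grid_range[OF at n that] a0 horizon_downward[OF t] by (auto simp: q_def)
    have c_nz: "c i \<noteq> 0" if "i < n" for i
      using b_nz(3)[of "q i"] q_ge[of i] a(3) that \<sigma>_pos[of "q i"] discount_pos[of "q i"]
      by (simp add: c_def signal_def)
    have \<gamma>\<kappa>: "\<bar>signal s - \<gamma> s\<bar> \<le> \<kappa>" if "a < s" "s \<le> t" for s
      unfolding \<gamma>_def c_def using step_fun_uniform_approx[of n q signal \<kappa> s] osc q_le q0 that
      by (simp add: q_def)
    have \<gamma>sq: "square_integrable_on {u..v} \<gamma>" for u v unfolding \<gamma>_def by (rule square_integrable_on_step_fun)
    have intV: "(LBINT s:{u..t}. (\<gamma> s)\<^sup>2) = V" if "u \<le> a" for u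
      unfolding \<gamma>_def V_def using step_fun_power2[of n q, OF q_le] set_integral_step_fun[of n q u t] q_le q0 that by simp
    have V: "\<Gamma> / 4 \<le> V"
    proof -
      define h where "h s = \<kappa> + indicator {a} s * \<bar>signal a\<bar>" for s
      have hm [measurable]: "h \<in> borel_measurable borel" unfolding h_def[abs_def] by measurable
      have sq: "square_integrable_on {a..t} signal" "square_integrable_on {a..t} h"
      proof -
        show "square_integrable_on {a..t} signal"
          by (rule square_integrable_on_continuous[OF signal_cont[OF t a0(2)]])
        show "square_integrable_on {a..t} h"
          by (rule square_integrable_on_bounded[OF hm, where C="\<kappa> + \<bar>signal a\<bar>"])
             (use \<kappa>0 in \<open>auto simp: h_def indicator_def\<close>)
      qed
      have "(LBINT s:{a..t}. (signal s)\<^sup>2) \<le> 2 * (LBINT s:{a..t}. (\<gamma> s)\<^sup>2) + 2 * (LBINT s:{a..t}. (h s)\<^sup>2)"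
      proof (rule set_integral_square_le[OF sq(1) \<gamma>sq sq(2)])
        fix s assume "s \<in> {a..t}"
        then show "\<bar>signal s\<bar> \<le> \<bar>\<gamma> s\<bar> + \<bar>h s\<bar>"
          using \<gamma>\<kappa>[of s] \<kappa>0 by (cases "s = a") (auto simp: h_def)
      qed
      also have "(LBINT s:{a..t}. (h s)\<^sup>2) = (LBINT s:{a..t}. \<kappa>\<^sup>2)"
        unfolding set_lebesgue_integral_def
      proof (rule integral_cong_AE)
        show "AE s in lborel. indicator {a..t} s *\<^sub>R (h s)\<^sup>2 = indicator {a..t} s *\<^sub>R \<kappa>\<^sup>2"
          using AE_lborel_singleton[of a] by eventually_elim (auto simp: h_def)
      qed measurable
      also have "\<dots> = \<kappa>\<^sup>2 * (t - a)" using at by (simp add: set_lebesgue_integral_def)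
      finally have "\<Gamma> \<le> 2 * V + 2"
        using \<kappa>1(2) signal_energy_diff[OF t a0(2)] at by (simp add: \<Gamma>_def intV)
      then show ?thesis using \<Gamma>(1) by linarith
    qed
    have V0': "0 < V" and r0: "0 < r" "r\<^sup>2 = V" using V \<Gamma>(1) by (auto simp: r_def)
    define w where "w \<omega> = U \<omega> * W \<omega> / r" for \<omega>
    have "distributed M lborel (\<lambda>\<omega>. U \<omega> * W \<omega>) (normal_density 0 r)"
      unfolding W_def r_def V_def
    proof (rule signed_increment_sum_normal)
      show "U \<in> borel_measurable (F (q 0))" using UF q0 by simp
      show "U \<omega> = 1 \<or> U \<omega> = -1" for \<omega> by (simp add: U_def)
    qed (use q_less q_ge n c_nz in auto)
    then have "distributed M lborel (\<lambda>\<omega>. 0 + (1 / r) * (U \<omega> * W \<omega>)) (normal_density (0 + (1 / r) * 0) (\<bar>1 / r\<bar> * r))"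
      using r0 by (intro normal_density_affine) auto
    then have wd: "distributed M lborel w (normal_density 0 (sqrt 1))"
      using r0 by (simp add: w_def[abs_def])
    have wm [measurable]: "w \<in> borel_measurable M" using wd by (simp add: distributed_def)
    have "distr M borel w = distr M lborel w" by (intro distr_cong) auto
    then have wlaw: "distr M borel w = std_normal_distribution" using wd by (simp add: distributed_def)
    have large_w: "prob {\<omega> \<in> space M. K \<le> \<bar>w \<omega>\<bar>} \<le> \<epsilon> / 4"
      using second_moment_method[OF wm normal_second_moment(1)[OF wd] K(1)] normal_second_moment(2)[OF wd] K(2) by simp
    define A where "A \<omega> = (LBINT s:{0..t}. (score s \<omega> - y \<omega> * \<gamma> s)\<^sup>2)" for \<omega>
    define Q where "Q \<omega> = (LBINT s:{0..t}. (score s \<omega>)\<^sup>2)" for \<omega>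
    have \<gamma>m: "\<gamma> \<in> borel_measurable borel" unfolding \<gamma>_def by measurable
    have [measurable]: "A \<in> borel_measurable M"
      unfolding A_def[abs_def] by (rule squared_error_measurable(2)[OF prog t ym \<gamma>m])
    have [measurable]: "Q \<in> borel_measurable M"
      unfolding Q_def[abs_def] by (rule score_energy_measurable[OF prog t])
    have [measurable]: "J t \<in> borel_measurable M"
      using J t measurable_F_M[of "J t" t borel] unfolding has_ito_integral_def adapted_def by blast
    have "W \<in> borel_measurable (F (q n))"
      unfolding W_def[abs_def] by (rule increment_sum_measurable) (use q_le q_ge in auto)
    then have [measurable]: "W \<in> borel_measurable M" using measurable_F_M q_ge(2)[of n] by blast
    have A_small: "prob {\<omega> \<in> space M. A \<omega> > \<delta>\<^sup>2 * V} \<le> \<epsilon> / 8"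
    proof -
      have d: "0 < \<delta>\<^sup>2 * V" using \<delta>(1) V0' by simp
      have "prob {\<omega> \<in> space M. A \<omega> > \<delta>\<^sup>2 * V}
          \<le> (L * signal_energy a + 2 * \<rho> * \<Gamma> + 2 * L * \<kappa>\<^sup>2 * (t - a)) / (\<delta>\<^sup>2 * V)"
        unfolding A_def y_def \<gamma>_def \<rho>_def \<Gamma>_def
        using frozen_score_error[OF prog t a0(2) at q_le q0 \<gamma>\<kappa>[unfolded \<gamma>_def] less_imp_le[OF \<kappa>0] VL d] .
      also have "\<dots> \<le> ((L * signal_energy a + 1) + 2 * \<rho> * \<Gamma>) / (\<delta>\<^sup>2 * V)"
        using d \<kappa>1(1) by (intro divide_right_mono) auto
      also have "\<dots> \<le> ((L * signal_energy a + 1) + 2 * \<rho> * \<Gamma>) / (\<delta>\<^sup>2 * (\<Gamma> / 4))"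
        using \<delta>(1) V V0' \<Gamma>(1) L0 Ga \<rho>(1) by (intro divide_left_mono mult_left_mono) auto
      also have "\<dots> \<le> \<epsilon> / 8"
      proof -
        have "64 * (L * signal_energy a + 1) \<le> \<Gamma> * (\<epsilon> * \<delta>\<^sup>2)" using \<Gamma>(2) e\<delta> by (simp add: pos_divide_le_eq)
        moreover have "2 * \<rho> * \<Gamma> \<le> 2 * (\<epsilon> * \<delta>\<^sup>2 / 128) * \<Gamma>" using \<rho> \<Gamma>(1) by (intro mult_right_mono mult_left_mono) auto
        ultimately have "(L * signal_energy a + 1) + 2 * \<rho> * \<Gamma> \<le> \<epsilon> / 8 * (\<delta>\<^sup>2 * (\<Gamma> / 4))"
          by (simp add: algebra_simps)
        then show ?thesis using \<delta>(1) \<Gamma>(1) by (simp add: pos_divide_le_eq)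
      qed
      finally show ?thesis .
    qed
    have J_close: "prob {\<omega> \<in> space M. \<bar>J t \<omega> - y \<omega> * W \<omega>\<bar> > 2 * (\<epsilon>1 * r)} \<le> \<epsilon> / 8 + \<epsilon> / 8"
    proof -
      have "prob {\<omega> \<in> space M. \<bar>J t \<omega> - y \<omega> * W \<omega>\<bar> > 2 * (\<epsilon>1 * r)}
          \<le> (4 * (\<delta>\<^sup>2 * V)) / (\<epsilon>1 * r)\<^sup>2 + prob {\<omega> \<in> space M. A \<omega> > 4 * (\<delta>\<^sup>2 * V) / 4}"
        unfolding W_def A_def \<gamma>_def
        by (rule lenglart_past_multiple[OF J t]) (use q_le q_ge q0 yF \<epsilon>1 r0 \<delta>(1) V0' in auto)
      also have "(4 * (\<delta>\<^sup>2 * V)) / (\<epsilon>1 * r)\<^sup>2 = 4 * \<delta>\<^sup>2 / \<epsilon>1\<^sup>2"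
        using V0' r0 by (simp add: power_mult_distrib)
      finally show ?thesis using A_small \<delta>\<epsilon> by simp
    qed
    have close: "\<bar>J t \<omega> / sqrt (Q \<omega>) - w \<omega>\<bar> \<le> \<theta>"
      if \<omega>: "\<omega> \<in> space M" "\<not> \<bar>y \<omega>\<bar> \<le> \<eta>" "\<not> K \<le> \<bar>w \<omega>\<bar>"
        "\<not> \<bar>J t \<omega> - y \<omega> * W \<omega>\<bar> > 2 * (\<epsilon>1 * r)" "\<not> A \<omega> > \<delta>\<^sup>2 * V" for \<omega>
    proof (rule studentized_close[where r=r and y="y \<omega>" and W="W \<omega>" and \<epsilon>=\<epsilon>1 and \<delta>=\<delta> and \<eta>=\<eta> and K=K])
      have "\<bar>sqrt (Q \<omega>) - sqrt (LBINT s:{0..t}. (y \<omega> * \<gamma> s)\<^sup>2)\<bar> \<le> sqrt (A \<omega>)"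
        unfolding Q_def A_def
        by (intro L2_triangle score_square_integrable[OF t \<omega>(1)] square_integrable_on_cmult \<gamma>sq)
      also have "sqrt (LBINT s:{0..t}. (y \<omega> * \<gamma> s)\<^sup>2) = \<bar>y \<omega>\<bar> * r"
        using intV[OF a0(2)] by (simp add: power_mult_distrib real_sqrt_mult r_def)
      also have "sqrt (A \<omega>) \<le> sqrt (\<delta>\<^sup>2 * V)" using \<omega>(5) by simp
      also have "\<dots> = \<delta> * r" using \<delta>(1) by (simp add: real_sqrt_mult r_def)
      finally show "\<bar>sqrt (Q \<omega>) - \<bar>y \<omega>\<bar> * r\<bar> \<le> \<delta> * r" .
    qed (use \<omega> r0 \<eta> \<delta> \<delta>K \<theta> in \<open>auto simp: w_def U_def mult.assoc\<close>)
    have "prob {\<omega> \<in> space M. \<bar>J t \<omega> / sqrt (Q \<omega>) - w \<omega>\<bar> > \<theta>}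
        \<le> prob {\<omega> \<in> space M. \<bar>y \<omega>\<bar> \<le> \<eta> \<or> K \<le> \<bar>w \<omega>\<bar>}
          + prob {\<omega> \<in> space M. \<bar>J t \<omega> - y \<omega> * W \<omega>\<bar> > 2 * (\<epsilon>1 * r) \<or> A \<omega> > \<delta>\<^sup>2 * V}"
    proof (rule prob_le_add[OF AE_I2])
      fix \<omega> assume "\<omega> \<in> space M"
      then show "\<theta> < \<bar>J t \<omega> / sqrt (Q \<omega>) - w \<omega>\<bar> \<longrightarrow> (\<bar>y \<omega>\<bar> \<le> \<eta> \<or> K \<le> \<bar>w \<omega>\<bar>)
          \<or> (2 * (\<epsilon>1 * r) < \<bar>J t \<omega> - y \<omega> * W \<omega>\<bar> \<or> \<delta>\<^sup>2 * V < A \<omega>)"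
        using close[of \<omega>] by linarith
    qed measurable
    also have "\<dots> \<le> (prob {\<omega> \<in> space M. \<bar>y \<omega>\<bar> \<le> \<eta>} + prob {\<omega> \<in> space M. K \<le> \<bar>w \<omega>\<bar>})
        + (prob {\<omega> \<in> space M. \<bar>J t \<omega> - y \<omega> * W \<omega>\<bar> > 2 * (\<epsilon>1 * r)} + prob {\<omega> \<in> space M. A \<omega> > \<delta>\<^sup>2 * V})"
      by (intro add_mono prob_le_add[OF AE_I2]) auto
    also have "\<dots> \<le> \<epsilon>" using small_y large_w J_close A_small \<epsilon> by linarith
    finally show ?case using wlaw wm by (auto simp: Q_def)
  qed
qed

lemma observed_information_eq:
  assumes "t \<in> horizon T"
  shows "observed_information b \<sigma> X t \<omega> = (LBINT s:{0..t}. (score s \<omega>)\<^sup>2)"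
  unfolding observed_information_def
proof (rule set_lebesgue_integral_cong)
  show "\<forall>s. s \<in> {0..t} \<longrightarrow> (b s)\<^sup>2 * (X s \<omega>)\<^sup>2 / (\<sigma> s)\<^sup>2 = (score s \<omega>)\<^sup>2"
  proof (intro allI impI)
    fix s assume "s \<in> {0..t}"
    then have "\<sigma> s \<noteq> 0" using \<sigma>_pos[of s] horizon_downward[OF assms] by force
    then show "(b s)\<^sup>2 * (X s \<omega>)\<^sup>2 / (\<sigma> s)\<^sup>2 = (score s \<omega>)\<^sup>2"
      by (simp add: score_def power2_eq_square)
  qed
qed simp

text \<open>The drift of \<open>X\<close> contributes \<open>\<alpha>\<close> times the observed information to \<open>N\<close>. When the observed information
  is 0, both sides are 0, whatever value the maximiser takes by default.\<close>

lemma studentized_mle_eq: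
  assumes t: "t \<in> horizon T"
    and N: "N t \<omega> = (LBINT s:{0..t}. b s * X s \<omega> / (\<sigma> s)\<^sup>2 * (\<alpha> * b s * X s \<omega>)) + J"
  shows "sqrt (observed_information b \<sigma> X t \<omega>) * (mle b \<sigma> X N t \<omega> - \<alpha>)
    = J / sqrt (LBINT s:{0..t}. (score s \<omega>)\<^sup>2)"
proof -
  define Q where "Q = observed_information b \<sigma> X t \<omega>"
  have Q0: "0 \<le> Q"
    unfolding Q_def observed_information_def set_lebesgue_integral_def
    by (intro Bochner_Integration.integral_nonneg) auto
  have "(LBINT s:{0..t}. b s * X s \<omega> / (\<sigma> s)\<^sup>2 * (\<alpha> * b s * X s \<omega>))
      = (LBINT s:{0..t}. \<alpha> * ((b s)\<^sup>2 * (X s \<omega>)\<^sup>2 / (\<sigma> s)\<^sup>2))"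
    by (simp add: power2_eq_square mult_ac)
  also have "\<dots> = \<alpha> * Q" unfolding Q_def observed_information_def by (rule set_integral_mult_right)
  finally have NQ: "N t \<omega> = \<alpha> * Q + J" using N by simp
  show ?thesis
  proof (cases "Q = 0")
    case False
    with Q0 have Q: "0 < Q" by simp
    have "sqrt Q * (N t \<omega> / Q - \<alpha>) = sqrt Q * J / Q" using Q by (simp add: NQ field_simps)
    also have "\<dots> = sqrt Q * J / (sqrt Q * sqrt Q)" using Q by simp
    also have "\<dots> = J / sqrt Q" using Q by (simp del: real_sqrt_mult_self)
    finally show ?thesis
      using mle_eq[of b \<sigma> X t \<omega> N] Q by (simp add: Q_def observed_information_eq[OF t])
  qed (simp add: Q_def observed_information_eq[OF t])
qed

lemma signal_energy_at_top:
  assumes fisher: "filterlim (fisher_information M b \<sigma> X) at_top (upto_horizon T)"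
    and L: "(variance_clock \<longlongrightarrow> L) (upto_horizon T)" "0 < L"
  shows "filterlim signal_energy at_top (upto_horizon T)"
  unfolding filterlim_at_top
proof
  fix Z :: real
  have "\<forall>\<^sub>F t in upto_horizon T. L * Z \<le> fisher_information M b \<sigma> X t"
    using fisher unfolding filterlim_at_top by blast
  moreover have "\<forall>\<^sub>F t in upto_horizon T. t \<in> horizon T"
    unfolding eventually_upto_horizon[OF horizon_pos] using zero_in_horizon by blast
  ultimately show "\<forall>\<^sub>F t in upto_horizon T. Z \<le> signal_energy t"
  proof eventually_elim
    case (elim t)
    then have "L * Z \<le> L * signal_energy t"
      using fisher_information_le[OF elim(2), of L] variance_clock_le_limit[OF L(1)] by fastforce
    then show ?case using L(2) by simp
  qed
qed

end

theorem corollary2p10: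
  fixes M :: "'a measure" and F :: "real \<Rightarrow> 'a measure" and T :: ereal
    and B X N :: "real \<Rightarrow> 'a \<Rightarrow> real" and b \<sigma> :: "real \<Rightarrow> real" and \<alpha> :: real
  assumes "wiener_space M F T B"
    and "continuous_on (horizon T) b"
    and "continuous_on (horizon T) \<sigma>"
    and "\<And>t. t \<in> horizon T \<Longrightarrow> \<sigma> t > 0"
    and "\<exists>t\<^sub>0>0. ereal t\<^sub>0 < T \<and> (\<forall>t\<in>horizon T. t\<^sub>0 \<le> t \<longrightarrow> b t \<noteq> 0)"
    and "strong_solution M F T B b \<sigma> \<alpha> X"
    and "has_integral_wrt_ito_process M F T B (\<lambda>s \<omega>. \<alpha> * b s * X s \<omega>) (\<lambda>s \<omega>. \<sigma> s) X
           (\<lambda>s \<omega>. b s * X s \<omega> / (\<sigma> s)\<^sup>2) N"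
    and "filterlim (fisher_information M b \<sigma> X) at_top (upto_horizon T)"
    and "\<exists>L::real. ((\<lambda>t. LBINT s:{0..t}. (\<sigma> s)\<^sup>2 * exp (- 2 * \<alpha> * (LBINT v:{0..s}. b v))) \<longlongrightarrow> L)
           (upto_horizon T)"
  shows "tendsto_in_distribution M
           (\<lambda>t \<omega>. sqrt (observed_information b \<sigma> X t \<omega>) * (mle b \<sigma> X N t \<omega> - \<alpha>))
           std_normal_distribution (upto_horizon T)"
proof -
  interpret wiener_space M F T B by fact
  interpret linear_sde M F T B b \<sigma> \<alpha> X
    by unfold_locales (use assms(2,3,4,6) in auto)
  obtain t\<^sub>0 where t0: "t\<^sub>0 \<in> horizon T" "0 < t\<^sub>0" "\<And>s. s \<in> horizon T \<Longrightarrow> t\<^sub>0 \<le> s \<Longrightarrow> b s \<noteq> 0"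
    using assms(5) by (auto simp: horizon_def)
  have "(\<sigma> s * discount s)\<^sup>2 = (\<sigma> s)\<^sup>2 * exp (- 2 * \<alpha> * (LBINT v:{0..s}. b v))" for s
    unfolding discount_def power_mult_distrib exp_double[symmetric] by (simp add: mult.assoc)
  then obtain L where L: "(variance_clock \<longlongrightarrow> L) (upto_horizon T)"
    using assms(9) unfolding variance_clock_def[abs_def] by auto
  have "0 < L" using variance_clock_pos[OF t0(1,2)] variance_clock_le_limit[OF L t0(1)] by linarith
  then have energy: "filterlim signal_energy at_top (upto_horizon T)"
    using signal_energy_at_top assms(8) L by blast
  obtain J where "has_ito_integral M F T B (\<lambda>s \<omega>. b s * X s \<omega> / (\<sigma> s)\<^sup>2 * \<sigma> s) J"
    and N: "AE \<omega> in M. \<forall>t\<in>horizon T.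
      N t \<omega> = (LBINT s:{0..t}. b s * X s \<omega> / (\<sigma> s)\<^sup>2 * (\<alpha> * b s * X s \<omega>)) + J t \<omega>"
    using assms(7) unfolding has_integral_wrt_ito_process_def by blast
  then have J: "has_ito_integral M F T B score J" by (simp add: score_def[abs_def])
  define R where "R t \<omega> = sqrt (observed_information b \<sigma> X t \<omega>) * (mle b \<sigma> X N t \<omega> - \<alpha>)" for t \<omega>
  define S where "S t \<omega> = J t \<omega> / sqrt (LBINT s:{0..t}. (score s \<omega>)\<^sup>2)" for t \<omega>
  have RS: "AE \<omega> in M. S t \<omega> = R t \<omega>" if "t \<in> horizon T" for t
    using N
  proof eventually_elim
    case (elim \<omega>)
    then show ?case using studentized_mle_eq[OF that, of N \<omega> "J t \<omega>"] that by (simp add: R_def S_def)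
  qed
  have Sm: "S t \<in> borel_measurable M" if t: "t \<in> horizon T" for t
  proof -
    have prog: "progressive F T score" and "J t \<in> borel_measurable (F t)"
      using J t by (auto simp: has_ito_integral_def adapted_def)
    then have Jm: "J t \<in> borel_measurable M" using measurable_F_M t by blast
    note [measurable] = Jm score_energy_measurable[OF prog t]
    show ?thesis unfolding S_def[abs_def] by measurable
  qed
  have Rm: "R t \<in> borel_measurable M" if "t \<in> horizon T" for t
    using measurable_AE_eq[OF Sm[OF that] RS[OF that]] .
  have hor: "\<forall>\<^sub>F t in upto_horizon T. t \<in> horizon T"
    unfolding eventually_upto_horizon[OF horizon_pos] using zero_in_horizon by blast
  have "tendsto_in_distribution M R std_normal_distribution (upto_horizon T)"
  proof (rule tendsto_in_distribution_by_approximation)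
    show "\<forall>\<^sub>F t in upto_horizon T. R t \<in> borel_measurable M"
      using hor by eventually_elim (rule Rm)
    fix \<theta> \<epsilon> :: real assume "0 < \<theta>" "0 < \<epsilon>"
    then have "\<forall>\<^sub>F t in upto_horizon T. \<exists>w\<in>borel_measurable M. distr M borel w = std_normal_distribution \<and>
      prob {\<omega> \<in> space M. \<bar>S t \<omega> - w \<omega>\<bar> > \<theta>} \<le> \<epsilon>"
      unfolding S_def using t0(3) by (intro studentized_score_near_normal[OF J t0(1,2) _ energy L]) auto
    then show "\<forall>\<^sub>F t in upto_horizon T. \<exists>w\<in>borel_measurable M. distr M borel w = std_normal_distribution \<and>
      prob {\<omega> \<in> space M. \<bar>R t \<omega> - w \<omega>\<bar> > \<theta>} \<le> \<epsilon>"
      using hor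
    proof eventually_elim
      case (elim t)
      then obtain w where w: "w \<in> borel_measurable M" "distr M borel w = std_normal_distribution"
        "prob {\<omega> \<in> space M. \<bar>S t \<omega> - w \<omega>\<bar> > \<theta>} \<le> \<epsilon>"
        by blast
      note [measurable] = w(1) Sm[OF elim(2)] Rm[OF elim(2)]
      have "prob {\<omega> \<in> space M. \<bar>R t \<omega> - w \<omega>\<bar> > \<theta>} = prob {\<omega> \<in> space M. \<bar>S t \<omega> - w \<omega>\<bar> > \<theta>}"
        using RS[OF elim(2)] by (intro finite_measure_eq_AE) (auto elim!: eventually_mono)
      then show ?case using w by auto
    qed
  qed
  then show ?thesis by (simp add: R_def[abs_def])
qed

end
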